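(* Let $\mathbf X$ be a monoid variety with $\mathbf L\subset\mathbf X\subseteq\mathbf O$ (the first inclusion being strict). Then $\mathbf X$ is not a chain variety and does not contain a just non-chain subvariety.
   Context: Monoids are algebras of type $(2,0)$ (associative multiplication and the constant $1$). $\operatorname{var}\Sigma$ is the variety of all monoids satisfying the identity system $\Sigma$. A chain variety is a variety whose lattice of subvarieties is a chain. A just non-chain variety is a minimal non-chain variety, i.e. a non-chain variety all of whose proper subvarieties are chain varieties. $\sigma_1$ is $xyzxty\approx yxzxty$ and $\sigma_2$ is $xtyzxy\approx xtyzyx$. For $n\in\mathbb N$ and $\pi,\tau\in S_n$ put $$\mathbf w_n(\pi,\tau)=\Bigl(\prod_{i=1}^n z_it_i\Bigr)x\Bigl(\prod_{i=1}^n z_{\pi(i)}z_{n+\tau(i)}\Bigr)x\Bigl(\prod_{i=n+1}^{2n}t_iz_i\Bigr),$$ $$\mathbf w_n'(\pi,\tau)=\Bigl(\prod_{i=1}^n z_it_i\Bigr)x^2\Bigl(\prod_{i=1}^n z_{\pi(i)}z_{n+\tau(i)}\Bigr)\Bigl(\prod_{i=n+1}^{2n}t_iz_i\Bigr)$$ (products in increasing order of $i$). Then $\mathbf L=\operatorname{var}\{x^2y\approx yx^2,\ xyxzx\approx x^2yz,\ \sigma_1,\ \sigma_2,\ \mathbf w_n(\pi,\tau)\approx\mathbf w_n'(\pi,\tau)\mid n\in\mathbb N,\ \pi,\tau\in S_n\}$ and $\mathbf O=\operatorname{var}\{x^2y\approx yx^2,\ xyxzx\approx x^2yz,\ \sigma_1,\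 \sigma_2\}$. *)

theory Defs
  imports
    "HOL-Algebra.Group"
    "HOL-Combinatorics.Permutations"
    "HOL-Library.Infinite_Typeclass"
    "HOL-Library.Countable_Set"
begin

text \<open>
  Words are lists over the countably infinite alphabet \<^typ>\<open>nat\<close>; an identity is a pair of words.
\<close>

type_synonym word = "nat list"
type_synonym identity = "word \<times> word"

definition eval_word :: "('a, 'm) monoid_scheme \<Rightarrow> (nat \<Rightarrow> 'a) \<Rightarrow> word \<Rightarrow> 'a" where
  "eval_word M \<phi> w = foldr (\<otimes>\<^bsub>M\<^esub>) (map \<phi> w) \<one>\<^bsub>M\<^esub>"

definition satisfies :: "('a, 'm) monoid_scheme \<Rightarrow> identity \<Rightarrow> bool" where
  "satisfies M e \<longleftrightarrow>
     (\<forall>\<phi>. range \<phi> \<subseteq> carrier M \<longrightarrow> eval_word M \<phi> (fst e) = eval_word M \<phi> (snd e))"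

text \<open>
  A variety is represented by the class of its members whose carrier lies in a type \<^typ>\<open>'a\<close>.
  When \<^typ>\<open>'a\<close> is infinite, this loses nothing: inclusions between varieties are already decided
  by their countable members, hence by the members on \<^typ>\<open>'a\<close>; see the lemma
  \<open>variety_of_subset_transfer\<close> below.
\<close>

definition variety_of :: "identity set \<Rightarrow> 'a monoid set" where
  "variety_of \<Sigma> = {M. monoid M \<and> (\<forall>e\<in>\<Sigma>. satisfies M e)}"

definition monoid_variety :: "'a monoid set \<Rightarrow> bool" where
  "monoid_variety V \<longleftrightarrow> (\<exists>\<Sigma>. V = variety_of \<Sigma>)"

definition subvarieties :: "'a monoid set \<Rightarrow> 'a monoid set set" where
  "subvarieties V = {W. monoid_variety W \<and> W \<subseteq> V}"

definition chain_variety :: "'a monoid set \<Rightarrow> bool" where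
  "chain_variety V \<longleftrightarrow> monoid_variety V \<and> chain\<^sub>\<subseteq> (subvarieties V)"

definition just_non_chain_variety :: "'a monoid set \<Rightarrow> bool" where
  "just_non_chain_variety V \<longleftrightarrow>
     monoid_variety V \<and> \<not> chain_variety V \<and>
     (\<forall>W\<in>subvarieties V. W \<noteq> V \<longrightarrow> chain_variety W)"

text \<open>
  Pairwise distinct letters. The unindexed letters \<open>z\<close> and \<open>t\<close> of an identity are
  \<open>lz 0\<close> and \<open>lt 0\<close>.
\<close>

definition lx :: nat where "lx = 0"
definition ly :: nat where "ly = 1"
definition lz :: "nat \<Rightarrow> nat" where "lz i = 2 * i + 2"
definition lt :: "nat \<Rightarrow> nat" where "lt i = 2 * i + 3"

definition sigma1 :: identity where
  "sigma1 = ([lx, ly, lz 0, lx, lt 0, ly], [ly, lx, lz 0, lx, lt 0, ly])"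

definition sigma2 :: identity where
  "sigma2 = ([lx, lt 0, ly, lz 0, lx, ly], [lx, lt 0, ly, lz 0, ly, lx])"

definition word_w :: "nat \<Rightarrow> (nat \<Rightarrow> nat) \<Rightarrow> (nat \<Rightarrow> nat) \<Rightarrow> word" where
  "word_w n \<pi> \<tau> =
     concat (map (\<lambda>i. [lz i, lt i]) [1..<n + 1]) @ [lx] @
     concat (map (\<lambda>i. [lz (\<pi> i), lz (n + \<tau> i)]) [1..<n + 1]) @ [lx] @
     concat (map (\<lambda>i. [lt i, lz i]) [n + 1..<2 * n + 1])"

definition word_w' :: "nat \<Rightarrow> (nat \<Rightarrow> nat) \<Rightarrow> (nat \<Rightarrow> nat) \<Rightarrow> word" where
  "word_w' n \<pi> \<tau> =
     concat (map (\<lambda>i. [lz i, lt i]) [1..<n + 1]) @ [lx, lx] @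
     concat (map (\<lambda>i. [lz (\<pi> i), lz (n + \<tau> i)]) [1..<n + 1]) @
     concat (map (\<lambda>i. [lt i, lz i]) [n + 1..<2 * n + 1])"

definition identities_O :: "identity set" where
  "identities_O =
     {([lx, lx, ly], [ly, lx, lx]), ([lx, ly, lx, lz 0, lx], [lx, lx, ly, lz 0]), sigma1, sigma2}"

definition identities_L :: "identity set" where
  "identities_L = identities_O \<union>
     {(word_w n \<pi> \<tau>, word_w' n \<pi> \<tau>) | n \<pi> \<tau>. \<pi> permutes {1..n} \<and> \<tau> permutes {1..n}}"

definition variety_O :: "'a monoid set" where
  "variety_O = variety_of identities_O"

definition variety_L :: "'a monoid set" where
  "variety_L = variety_of identities_L"

lemma eval_word_Nil [simp]: "eval_word M \<phi> [] = \<one>\<^bsub>M\<^esub>"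
  by (simp add: eval_word_def)

lemma eval_word_Cons [simp]: "eval_word M \<phi> (a # u) = \<phi> a \<otimes>\<^bsub>M\<^esub> eval_word M \<phi> u"
  by (simp add: eval_word_def)

lemma eval_word_closed:
  "monoid M \<Longrightarrow> range \<phi> \<subseteq> carrier M \<Longrightarrow> eval_word M \<phi> u \<in> carrier M"
  by (induction u) (auto intro: monoid.m_closed monoid.one_closed)

lemma eval_word_append:
  "monoid M \<Longrightarrow> range \<phi> \<subseteq> carrier M \<Longrightarrow>
   eval_word M \<phi> (u @ v) = eval_word M \<phi> u \<otimes>\<^bsub>M\<^esub> eval_word M \<phi> v"
proof (induction u)
  case Nil
  then show ?case by (simp add: monoid.l_one eval_word_closed)
next
  case (Cons a u)
  then have "\<phi> a \<in> carrier M" by auto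
  with Cons show ?case by (simp add: monoid.m_assoc eval_word_closed)
qed

text \<open>
  Inclusion of varieties on an infinite type implies inclusion on every type.
\<close>

lemma variety_of_subset_transfer:
  assumes sub: "(variety_of \<Sigma> :: 'a::infinite monoid set) \<subseteq> variety_of \<Delta>"
  shows "(variety_of \<Sigma> :: 'b monoid set) \<subseteq> variety_of \<Delta>"
proof
  fix M :: "'b monoid"
  assume "M \<in> variety_of \<Sigma>"
  then have M: "monoid M" and sat: "\<And>e. e \<in> \<Sigma> \<Longrightarrow> satisfies M e"
    by (auto simp: variety_of_def)
  interpret M: monoid M by (rule M)
  have "satisfies M e" if e: "e \<in> \<Delta>" for e
    unfolding satisfies_def
  proof (intro allI impI)
    fix \<phi> :: "nat \<Rightarrow> 'b"
    assume \<phi>: "range \<phi> \<subseteq> carrier M"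
    define C where "C = range (eval_word M \<phi>)"
    have CM: "C \<subseteq> carrier M" using eval_word_closed[OF M \<phi>] by (auto simp: C_def)
    have C1: "\<one>\<^bsub>M\<^esub> \<in> C" unfolding C_def by (metis eval_word_Nil rangeI)
    have Cm: "a \<otimes>\<^bsub>M\<^esub> b \<in> C" if "a \<in> C" "b \<in> C" for a b
      using that eval_word_append[OF M \<phi>] unfolding C_def by (auto simp flip: eval_word_append[OF M \<phi>])
    have C\<phi>: "\<phi> i \<in> C" for i
    proof -
      have "eval_word M \<phi> [i] = \<phi> i" using \<phi> by (auto simp: image_subset_iff)
      then show ?thesis unfolding C_def by (metis rangeI)
    qed
    obtain h :: "nat \<Rightarrow> 'a" where h: "inj h"
      using infinite_countable_subset[OF infinite_UNIV] by blast
    have "countable C" by (simp add: C_def)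
    then have inj: "inj_on (h \<circ> to_nat_on C) C"
      using h by (auto intro!: comp_inj_on inj_on_subset[OF h])
    define f where "f = h \<circ> to_nat_on C"
    define g where "g = inv_into C f"
    have gf: "g (f c) = c" if "c \<in> C" for c
      using inj that by (simp add: g_def f_def[symmetric] inv_into_f_f)
    define N :: "'a monoid" where
      "N = \<lparr>carrier = f ` C, monoid.mult = (\<lambda>a b. f (g a \<otimes>\<^bsub>M\<^esub> g b)), one = f \<one>\<^bsub>M\<^esub>\<rparr>"
    have N: "monoid N"
      by (rule monoidI)
        (use C1 Cm CM in \<open>auto simp: N_def gf subset_iff M.m_assoc\<close>)
    have ev: "eval_word N \<psi> u = f (eval_word M (g \<circ> \<psi>) u) \<and> eval_word M (g \<circ> \<psi>) u \<in> C"
      if "range \<psi> \<subseteq> carrier N" for \<psi> u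
    proof (induction u)
      case Nil
      show ?case using C1 by (simp add: N_def)
    next
      case (Cons a u)
      have "\<psi> a \<in> f ` C" using that by (auto simp: N_def)
      then have "g (\<psi> a) \<in> C" by (auto simp: gf)
      with Cons Cm show ?case by (simp add: N_def gf)
    qed
    have "N \<in> variety_of \<Sigma>"
    proof -
      have "satisfies N d" if d: "d \<in> \<Sigma>" for d
        unfolding satisfies_def
      proof (intro allI impI)
        fix \<psi> :: "nat \<Rightarrow> 'a"
        assume \<psi>: "range \<psi> \<subseteq> carrier N"
        then have "range (g \<circ> \<psi>) \<subseteq> carrier M"
          using CM by (auto simp: N_def gf image_subset_iff) (metis (no_types) gf imageE subsetD)
        then have "eval_word M (g \<circ> \<psi>) (fst d) = eval_word M (g \<circ> \<psi>) (snd d)"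
          using sat[OF d] unfolding satisfies_def by blast
        then show "eval_word N \<psi> (fst d) = eval_word N \<psi> (snd d)"
          using ev[OF \<psi>] by simp
      qed
      then show ?thesis using N by (simp add: variety_of_def)
    qed
    with sub e have satN: "satisfies N e" by (auto simp: variety_of_def)
    have r: "range (f \<circ> \<phi>) \<subseteq> carrier N" using C\<phi> by (auto simp: N_def)
    have gf\<phi>: "g \<circ> (f \<circ> \<phi>) = \<phi>" using gf C\<phi> by (auto simp: fun_eq_iff)
    have "f (eval_word M \<phi> (fst e)) = f (eval_word M \<phi> (snd e))"
      using satN r ev[OF r] unfolding satisfies_def gf\<phi> by metis
    then show "eval_word M \<phi> (fst e) = eval_word M \<phi> (snd e)"
      using inj unfolding f_def[symmetric] by (auto simp: C_def inj_on_def)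
  qed
  with M show "M \<in> variety_of \<Delta>" by (simp add: variety_of_def)
qed

end

theory Submission
  imports Defs "HOL-Library.Sublist"
begin

text \<open>
  Inclusion of varieties is inclusion of fully invariant congruences on words, so everything is
  decided by derivations. Modulo the identities of \<open>L\<close>, a word is determined by its content, its
  letters that occur once, the letters that occur twice around such a letter, and the relative order
  of second and first occurrences of the latter. Weakening these invariants one by one gives a chain
  of relations that exhausts the congruences above that of \<open>L\<close>, hence \<open>L\<close> is a chain variety.

  Let \<open>Y \<subseteq> O\<close> be not contained in \<open>L\<close>, and take the least \<open>n\<close> such that \<open>Y\<close> fails
  some \<open>w\<^sub>n(\<pi>, \<tau>) \<approx> w'\<^sub>n(\<pi>, \<tau>)\<close>. Doubling the first two letters between the
  occurrences of \<open>x\<close>, in two different ways, gives two words of level \<open>n + 1\<close> that differ only in the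
  order of their prefix. If \<open>Y\<close> satisfied a nontrivial identity on one of them, then deleting one of
  the doubled pairs would give an identity that shortens the span of \<open>x\<close> in \<open>w\<^sub>n(\<pi>, \<tau>)\<close>, and the
  identities of lower level would yield the one that fails. The identity of either word cannot be
  applied to the other word. So adjoining either identity to \<open>Y\<close> gives incomparable proper
  subvarieties; \<open>Y\<close> is not a chain variety, and neither is the first of these subvarieties, because
  it is again not contained in \<open>L\<close>.
\<close>

section \<open>Derivations and relatively free monoids\<close>

text \<open>Larger varieties have smaller congruences, so a variety outside \<open>L\<close> is one
  whose congruence misses some w_n identity. The watershed is \<open>sigma3\<close>, the identity
  xzxyty \<approx> xzyxty. A congruence that contains the identities of \<open>O\<close> but does
  not lie inside \<open>Q 5\<close> satisfies \<open>sigma3\<close>, and \<open>sigma3\<close>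
  yields every w_n identity. So a congruence that misses one of them lies inside \<open>Q 5\<close>.
  There, w_n with \<open>x\<close> deleted is rigid, because first and second occurrences alternate
  between its outer parts. All that can move is \<open>x\<close>, and up to \<open>sigma1\<close>
  and \<open>sigma2\<close> its span changes only by whole pairs. This is why every identity on such
  a word can be read as a shortening of the span, and why the minimality of \<open>n\<close> is
  needed: a shortened span is covered by some w_k with \<open>k < n\<close>. The doubled words
  differ in the prefix only, since an instance of one inside the other is forced to fix all letters
  between the occurrences of \<open>x\<close>, and the prefix order is then what remains to obstruct
  it.\<close>

definition subst :: "(nat \<Rightarrow> word) \<Rightarrow> word \<Rightarrow> word" where
  "subst \<theta> u = concat (map \<theta> u)"

lemma subst_simps [simp]:
  "subst \<theta> [] = []" "subst \<theta> (c # u) = \<theta> c @ subst \<theta> u" "subst \<theta> (u @ v) = subst \<theta> u @ subst \<theta> v"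
  by (auto simp: subst_def)

lemma subst_subst: "subst \<theta> (subst \<eta> u) = subst (\<lambda>c. subst \<theta> (\<eta> c)) u"
  by (induction u) auto

lemma subst_singleton: "subst (\<lambda>c. [c]) u = u"
  by (induction u) auto

text \<open>The empty word is an admissible value in monoids, so deletion of letters is a
  substitution. Hence every identity of a congruence restricts to any set of letters, the main
  device below.\<close>

lemma subst_filter: "subst (\<lambda>c. if P c then [c] else []) u = filter P u"
  by (induction u) auto

lemma subst_id: "(\<And>c. c \<in> set u \<Longrightarrow> \<theta> c = [c]) \<Longrightarrow> subst \<theta> u = u"
  by (induction u) auto

text \<open>Equational theories, abstractly. Derivability and validity in one fixed monoid are both
  instances; soundness is \<open>derives_le\<close> for the second one.\<close>

locale fully_invariant =
  fixes R :: "word \<Rightarrow> word \<Rightarrow> bool" (infix "\<approx>" 50)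
  assumes refl [simp, intro!]: "u \<approx> u"
    and sym: "u \<approx> v \<Longrightarrow> v \<approx> u"
    and trans [trans]: "u \<approx> v \<Longrightarrow> v \<approx> w \<Longrightarrow> u \<approx> w"
    and context_closed: "u \<approx> v \<Longrightarrow> p @ u @ q \<approx> p @ v @ q"
    and subst_closed: "u \<approx> v \<Longrightarrow> subst \<theta> u \<approx> subst \<theta> v"
begin

lemma prefix_closed: "u \<approx> v \<Longrightarrow> p @ u \<approx> p @ v"
  using context_closed[of u v p "[]"] by simp

lemma suffix_closed: "u \<approx> v \<Longrightarrow> u @ q \<approx> v @ q"
  using context_closed[of u v "[]" q] by simp

lemma filter_closed: "u \<approx> v \<Longrightarrow> filter P u \<approx> filter P v"
  using subst_closed[of u v "\<lambda>c. if P c then [c] else []"] by (simp add: subst_filter)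

lemma append_closed: "u \<approx> v \<Longrightarrow> u' \<approx> v' \<Longrightarrow> u @ u' \<approx> v @ v'"
  using prefix_closed suffix_closed trans by blast

end

definition deriv_step :: "identity set \<Rightarrow> word \<Rightarrow> word \<Rightarrow> bool" where
  "deriv_step \<Sigma> u v \<longleftrightarrow> (\<exists>l r p q \<theta>. ((l, r) \<in> \<Sigma> \<or> (r, l) \<in> \<Sigma>) \<and>
     u = p @ subst \<theta> l @ q \<and> v = p @ subst \<theta> r @ q)"

definition derives :: "identity set \<Rightarrow> word \<Rightarrow> word \<Rightarrow> bool" where
  "derives \<Sigma> = (deriv_step \<Sigma>)\<^sup>*\<^sup>*"

lemma deriv_step_sym: "deriv_step \<Sigma> u v \<Longrightarrow> deriv_step \<Sigma> v u"
  unfolding deriv_step_def by blast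

lemma deriv_step_context: "deriv_step \<Sigma> u v \<Longrightarrow> deriv_step \<Sigma> (p @ u @ q) (p @ v @ q)"
proof -
  assume "deriv_step \<Sigma> u v"
  then obtain l r p' q' \<theta> where "(l, r) \<in> \<Sigma> \<or> (r, l) \<in> \<Sigma>"
    "u = p' @ subst \<theta> l @ q'" "v = p' @ subst \<theta> r @ q'"
    unfolding deriv_step_def by blast
  then show ?thesis unfolding deriv_step_def
    by (intro exI[of _ l] exI[of _ r] exI[of _ "p @ p'"] exI[of _ "q' @ q"] exI[of _ \<theta>]) simp
qed

lemma deriv_step_subst: "deriv_step \<Sigma> u v \<Longrightarrow> deriv_step \<Sigma> (subst \<eta> u) (subst \<eta> v)"
proof -
  assume "deriv_step \<Sigma> u v"
  then obtain l r p q \<theta> where "(l, r) \<in> \<Sigma> \<or> (r, l) \<in> \<Sigma>"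
    "u = p @ subst \<theta> l @ q" "v = p @ subst \<theta> r @ q"
    unfolding deriv_step_def by blast
  then show ?thesis unfolding deriv_step_def
    by (intro exI[of _ l] exI[of _ r] exI[of _ "subst \<eta> p"] exI[of _ "subst \<eta> q"]
        exI[of _ "\<lambda>c. subst \<eta> (\<theta> c)"]) (simp add: subst_subst)
qed

lemma derives_fully_invariant: "fully_invariant (derives \<Sigma>)"
proof
  fix u v w p q and \<theta> :: "nat \<Rightarrow> word"
  show "derives \<Sigma> u u" by (simp add: derives_def)
  show "derives \<Sigma> u v \<Longrightarrow> derives \<Sigma> v w \<Longrightarrow> derives \<Sigma> u w" by (simp add: derives_def)
  show "derives \<Sigma> v u" if "derives \<Sigma> u v"
    using that unfolding derives_def
    by (induction) (auto intro: deriv_step_sym converse_rtranclp_into_rtranclp)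
  show "derives \<Sigma> (p @ u @ q) (p @ v @ q)" if "derives \<Sigma> u v"
    using that unfolding derives_def
    by (induction) (auto intro: deriv_step_context rtranclp.rtrancl_into_rtrancl)
  show "derives \<Sigma> (subst \<theta> u) (subst \<theta> v)" if "derives \<Sigma> u v"
    using that unfolding derives_def
    by (induction) (auto intro: deriv_step_subst rtranclp.rtrancl_into_rtrancl)
qed

lemma derives_base: "(u, v) \<in> \<Sigma> \<Longrightarrow> derives \<Sigma> u v"
  unfolding derives_def deriv_step_def
  by (intro r_into_rtranclp exI[of _ u] exI[of _ v] exI[of _ "[]"] exI[of _ "\<lambda>c. [c]"])
    (simp add: subst_singleton)

lemma (in fully_invariant) derives_le:
  assumes "derives \<Sigma> u v" "\<And>l r. (l, r) \<in> \<Sigma> \<Longrightarrow> l \<approx> r"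
  shows "u \<approx> v"
  using assms(1) unfolding derives_def
proof induction
  case (step v w)
  then obtain l r p q \<theta> where *: "(l, r) \<in> \<Sigma> \<or> (r, l) \<in> \<Sigma>"
    "v = p @ subst \<theta> l @ q" "w = p @ subst \<theta> r @ q"
    unfolding deriv_step_def by blast
  then have "l \<approx> r" using assms(2) sym by blast
  then have "v \<approx> w" using * by (auto intro: context_closed subst_closed)
  with step show ?case using trans by blast
qed simp

lemma derives_mono: "derives \<Sigma> u v \<Longrightarrow> (\<And>l r. (l, r) \<in> \<Sigma> \<Longrightarrow> derives \<Delta> l r) \<Longrightarrow> derives \<Delta> u v"
  using fully_invariant.derives_le[OF derives_fully_invariant] by blast

lemma eval_word_subst:
  assumes M: "monoid M" and \<phi>: "range \<phi> \<subseteq> carrier M"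
  shows "eval_word M \<phi> (subst \<theta> u) = eval_word M (\<lambda>i. eval_word M \<phi> (\<theta> i)) u"
  by (induction u) (use eval_word_append[OF M \<phi>] in auto)

lemma satisfies_fully_invariant:
  assumes M: "monoid M"
  shows "fully_invariant (\<lambda>u v. satisfies M (u, v))"
proof
  fix u v p q and \<theta> :: "nat \<Rightarrow> word"
  assume uv: "satisfies M (u, v)"
  show "satisfies M (p @ u @ q, p @ v @ q)"
    using uv by (auto simp: satisfies_def eval_word_append[OF M])
  show "satisfies M (subst \<theta> u, subst \<theta> v)"
    unfolding satisfies_def
  proof (intro allI impI)
    fix \<phi> :: "nat \<Rightarrow> _" assume \<phi>: "range \<phi> \<subseteq> carrier M"
    then have "range (\<lambda>i. eval_word M \<phi> (\<theta> i)) \<subseteq> carrier M"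
      using eval_word_closed[OF M \<phi>] by auto
    then show "eval_word M \<phi> (fst (subst \<theta> u, subst \<theta> v)) = eval_word M \<phi> (snd (subst \<theta> u, subst \<theta> v))"
      using uv by (simp add: satisfies_def eval_word_subst[OF M \<phi>])
  qed
qed (auto simp: satisfies_def)

lemma derives_sound:
  assumes "M \<in> variety_of \<Sigma>" "derives \<Sigma> u v"
  shows "satisfies M (u, v)"
proof -
  have M: "monoid M" using assms by (simp add: variety_of_def)
  show ?thesis
    by (rule fully_invariant.derives_le[OF satisfies_fully_invariant[OF M] assms(2)])
      (use assms(1) in \<open>auto simp: variety_of_def\<close>)
qed

text \<open>The relatively free monoid of \<open>var \<Sigma>\<close>, carried by chosen representatives of the
  classes of derivable words.\<close>

lemma derives_complete:
  assumes sub: "(variety_of \<Sigma> :: word monoid set) \<subseteq> variety_of \<Delta>" and uv: "(u, v) \<in> \<Delta>"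
  shows "derives \<Sigma> u v"
proof -
  interpret fully_invariant "derives \<Sigma>" by (rule derives_fully_invariant)
  define rep where "rep u = (SOME v. derives \<Sigma> u v)" for u
  have rep: "derives \<Sigma> u (rep u)" for u
    unfolding rep_def by (rule someI[of _ u]) simp
  have rep_eq: "rep u = rep v \<longleftrightarrow> derives \<Sigma> u v" for u v
  proof
    show "rep u = rep v \<Longrightarrow> derives \<Sigma> u v" by (metis rep sym trans)
    show "rep u = rep v" if "derives \<Sigma> u v"
      unfolding rep_def by (rule arg_cong[of _ _ Eps]) (use that sym trans in blast)
  qed
  define M :: "word monoid" where
    "M = \<lparr>carrier = range rep, monoid.mult = (\<lambda>a b. rep (a @ b)), one = rep []\<rparr>"
  have M: "monoid M"
  proof (rule monoidI)
    show "x \<otimes>\<^bsub>M\<^esub> y \<in> carrier M" for x y by (simp add: M_def)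
    show "\<one>\<^bsub>M\<^esub> \<in> carrier M" by (simp add: M_def)
    show "x \<otimes>\<^bsub>M\<^esub> y \<otimes>\<^bsub>M\<^esub> z = x \<otimes>\<^bsub>M\<^esub> (y \<otimes>\<^bsub>M\<^esub> z)" for x y z
    proof -
      have "derives \<Sigma> (rep (x @ y) @ z) ((x @ y) @ z)" by (rule suffix_closed[OF sym[OF rep]])
      moreover have "derives \<Sigma> (x @ (y @ z)) (x @ rep (y @ z))" by (rule prefix_closed[OF rep])
      ultimately have "derives \<Sigma> (rep (x @ y) @ z) (x @ rep (y @ z))"
        using trans by (metis append_assoc)
      then show ?thesis by (simp add: M_def rep_eq)
    qed
    fix x assume "x \<in> carrier M"
    then obtain u where x: "x = rep u" by (auto simp: M_def)
    have "derives \<Sigma> (rep [] @ x) u" "derives \<Sigma> (x @ rep []) u"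
      unfolding x using append_closed[OF sym[OF rep] sym[OF rep], of "[]" u]
        append_closed[OF sym[OF rep] sym[OF rep], of u "[]"] by simp_all
    then show "\<one>\<^bsub>M\<^esub> \<otimes>\<^bsub>M\<^esub> x = x" "x \<otimes>\<^bsub>M\<^esub> \<one>\<^bsub>M\<^esub> = x"
      by (simp_all add: M_def x rep_eq)
  qed
  have ev: "eval_word M \<phi> w = rep (subst \<phi> w)" if "range \<phi> \<subseteq> carrier M" for \<phi> w
  proof (induction w)
    case (Cons a w)
    have "derives \<Sigma> (\<phi> a @ rep (subst \<phi> w)) (\<phi> a @ subst \<phi> w)"
      by (rule prefix_closed[OF sym[OF rep]])
    with Cons show ?case by (simp add: M_def rep_eq)
  qed (simp add: M_def)
  have "satisfies M e" if "e \<in> \<Sigma>" for e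
    using that subst_closed[OF derives_base, of "fst e" "snd e"]
    by (auto simp: satisfies_def ev rep_eq)
  with M sub have "M \<in> variety_of \<Delta>" by (auto simp: variety_of_def)
  with uv have sat: "satisfies M (u, v)" by (auto simp: variety_of_def)
  \<comment> \<open>The generic valuation: each letter goes to its own class, so equal values of two
    words in \<open>M\<close> mean that the words are derivable from each other.\<close>
  define \<phi> where "\<phi> i = rep [i]" for i
  have \<phi>: "range \<phi> \<subseteq> carrier M" by (auto simp: \<phi>_def M_def)
  have \<phi>_subst: "derives \<Sigma> (subst \<phi> w) w" for w
  proof (induction w)
    case (Cons a w)
    then show ?case using append_closed[OF sym[OF rep[of "[a]"]] Cons] by (simp add: \<phi>_def)
  qed simp
  have "derives \<Sigma> (subst \<phi> u) (subst \<phi> v)"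
    using sat \<phi> by (simp add: satisfies_def ev rep_eq)
  then show ?thesis using \<phi>_subst sym trans by meson
qed

text \<open>The relatively free monoid lives on the type \<open>word\<close>;
  \<open>variety_of_subset_transfer\<close> carries the inclusion there, which is where the infinity
  of the type enters.\<close>

lemma variety_of_subset_iff:
  "(variety_of \<Sigma> :: 'a::infinite monoid set) \<subseteq> variety_of \<Delta> \<longleftrightarrow> (\<forall>(u, v)\<in>\<Delta>. derives \<Sigma> u v)"
proof
  assume "(variety_of \<Sigma> :: 'a monoid set) \<subseteq> variety_of \<Delta>"
  then show "\<forall>(u, v)\<in>\<Delta>. derives \<Sigma> u v"
    using derives_complete[OF variety_of_subset_transfer] by blast
next
  assume "\<forall>(u, v)\<in>\<Delta>. derives \<Sigma> u v"
  then show "(variety_of \<Sigma> :: 'a monoid set) \<subseteq> variety_of \<Delta>"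
    using derives_sound by (fastforce simp: variety_of_def)
qed

section \<open>Consequences of the identities of \<open>O\<close>\<close>

locale O_congruence = fully_invariant +
  assumes identities_O: "(u, v) \<in> identities_O \<Longrightarrow> u \<approx> v"
begin

lemma square_commute: "p @ c # c # q \<approx> c # c # p @ q"
proof -
  have "[lx, lx, ly] \<approx> [ly, lx, lx]" by (rule identities_O) (simp add: identities_O_def)
  from suffix_closed[OF subst_closed[OF sym[OF this], of "\<lambda>i. if i = lx then [c] else p"], of q]
  show ?thesis by (simp add: lx_def ly_def)
qed

lemma triple: "p @ c # q @ c # r @ c # s \<approx> p @ c # c # q @ r @ s"
proof -
  have "[lx, ly, lx, lz 0, lx] \<approx> [lx, lx, ly, lz 0]" by (rule identities_O) (simp add: identities_O_def)
  from context_closed[OF subst_closed[OF this, of "\<lambda>i. if i = lx then [c] else if i = ly then q else r"], of p s]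
  show ?thesis by (simp add: lx_def ly_def lz_def)
qed

lemma sigma1: "p @ c # d # q @ c # r @ d # s \<approx> p @ d # c # q @ c # r @ d # s"
proof -
  have "fst sigma1 \<approx> snd sigma1" by (rule identities_O) (simp add: identities_O_def)
  from context_closed[OF subst_closed[OF this, of
    "\<lambda>i. if i = lx then [c] else if i = ly then [d] else if i = lz 0 then q else r"], of p s]
  show ?thesis by (simp add: sigma1_def lx_def ly_def lz_def lt_def)
qed

lemma sigma2: "p @ c # q @ d # r @ c # d # s \<approx> p @ c # q @ d # r @ d # c # s"
proof -
  have "fst sigma2 \<approx> snd sigma2" by (rule identities_O) (simp add: identities_O_def)
  from context_closed[OF subst_closed[OF this, of
    "\<lambda>i. if i = lx then [c] else if i = ly then [d] else if i = lt 0 then q else r"], of p s]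
  show ?thesis by (simp add: sigma2_def lx_def ly_def lz_def lt_def)
qed

text \<open>The letters recur in \<open>s\<close> in one of two orders. \<open>sigma1\<close>
  handles one of them; read backwards with \<open>c\<close> and \<open>d\<close> exchanged, it
  handles the other.\<close>

lemma swap_first:
  assumes "c \<in> set s" "d \<in> set s"
  shows "p @ c # d # s \<approx> p @ d # c # s"
proof (cases "c = d")
  case False
  from assms(1) obtain s1 s2 where s: "s = s1 @ c # s2" by (auto dest: split_list)
  with assms(2) False have "d \<in> set s1 \<or> d \<in> set s2" by auto
  then show ?thesis
  proof
    assume "d \<in> set s1"
    then obtain q r where "s1 = q @ d # r" by (auto dest: split_list)
    then show ?thesis using sym[OF sigma1[of p d c q r s2]] by (simp add: s)
  next
    assume "d \<in> set s2"
    then obtain q r where "s2 = q @ d # r" by (auto dest: split_list)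
    then show ?thesis using sigma1[of p c d s1 q r] by (simp add: s)
  qed
qed simp

lemma swap_second:
  assumes "c \<in> set p" "d \<in> set p"
  shows "p @ c # d # s \<approx> p @ d # c # s"
proof (cases "c = d")
  case False
  from assms(1) obtain s1 s2 where s: "p = s1 @ c # s2" by (auto dest: split_list)
  with assms(2) False have "d \<in> set s1 \<or> d \<in> set s2" by auto
  then show ?thesis
  proof
    assume "d \<in> set s1"
    then obtain q r where "s1 = q @ d # r" by (auto dest: split_list)
    then show ?thesis using sym[OF sigma2[of q d r c s2 s]] by (simp add: s)
  next
    assume "d \<in> set s2"
    then obtain q r where "s2 = q @ d # r" by (auto dest: split_list)
    then show ?thesis using sigma2[of s1 c q d r s] by (simp add: s)
  qed
qed simp

text \<open>With an empty first gap, \<open>triple\<close> says that an occurrence behind a square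
  is absorbed by it.\<close>

lemma square_absorb: "c # c # p @ q \<approx> c # c # p @ filter (\<lambda>d. d \<noteq> c) q"
proof (induction q arbitrary: p)
  case (Cons d q)
  show ?case
  proof (cases "d = c")
    case True
    have "c # c # p @ c # q \<approx> c # c # p @ q" using triple[of "[]" c "[]" p q] by simp
    also have "\<dots> \<approx> c # c # p @ filter (\<lambda>d. d \<noteq> c) q" by (rule Cons)
    finally show ?thesis using True by simp
  next
    case False
    then show ?thesis using Cons[of "p @ [d]"] by simp
  qed
qed simp

lemma pull_square: "p @ c # c # q \<approx> c # c # filter (\<lambda>d. d \<noteq> c) (p @ q)"
  by (rule trans[OF square_commute square_absorb[of c "[]" "p @ q", unfolded append_Nil]])

text \<open>Letters with at least three occurrences thus carry no positional information, and normal
  forms only have to deal with at most two.\<close>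

lemma pull_triple:
  assumes "count_list u c \<ge> 3"
  shows "u \<approx> c # c # filter (\<lambda>d. d \<noteq> c) u"
proof -
  have cu: "c \<in> set u" using assms count_notin by fastforce
  have split: "\<exists>a b. w = a @ c # b \<and> c \<notin> set a" if "c \<in> set w" for w
    using that by (meson split_list_first)
  obtain p u1 where u1: "u = p @ c # u1" "c \<notin> set p" using split[OF cu] by blast
  then have "c \<in> set u1" using assms by (cases "c \<in> set u1") auto
  then obtain q u2 where u2: "u1 = q @ c # u2" "c \<notin> set q" using split by blast
  with u1 have "c \<in> set u2" using assms by (cases "c \<in> set u2") auto
  then obtain r s where u3: "u2 = r @ c # s" "c \<notin> set r" using split by blast
  have "u \<approx> p @ c # c # q @ r @ s" unfolding u1 u2 u3 by (rule triple)
  also have "\<dots> \<approx> c # c # filter (\<lambda>d. d \<noteq> c) (p @ q @ r @ s)" by (rule pull_square)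
  also have "filter (\<lambda>d. d \<noteq> c) (p @ q @ r @ s) = filter (\<lambda>d. d \<noteq> c) u"
    by (simp add: u1 u2 u3)
  finally show ?thesis .
qed

end

section \<open>Words determined by the order of their occurrences\<close>

text \<open>The last \<open>c\<close> is compared with the first \<open>d\<close>. For letters that
  occur twice this is the order of a second and a first occurrence, which swaps by
  \<open>sigma1\<close> and \<open>sigma2\<close> cannot change; for distinct letters that occur
  once it is their ordinary order.\<close>

primrec before :: "'a list \<Rightarrow> 'a \<Rightarrow> 'a \<Rightarrow> bool" where
  "before [] c d = True"
| "before (e # u) c d = (if e = d then c \<notin> set (e # u) else before u c d)"

lemma before_append:
  "before (p @ u) c d = (if d \<in> set p then before p c d \<and> c \<notin> set u else before u c d)"
  by (induction p) auto

lemma before_filter: "P c \<Longrightarrow> P d \<Longrightarrow> before (filter P u) c d = before u c d"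
  by (induction u) auto

lemma before_notin: "c \<notin> set u \<Longrightarrow> before u c d"
  by (induction u) auto

lemma set_iff_count_list: "c \<in> set u \<longleftrightarrow> 0 < count_list u c"
  using count_list_0_iff by (metis gr0I less_numeral_extra(3))

declare count_notin [simp del] \<comment> \<open>loops together with \<open>set_iff_count_list\<close>\<close>

lemma count_list_filter: "count_list (filter P u) c = (if P c then count_list u c else 0)"
  by (induction u) auto

text \<open>
  \<open>D\<close> is the set of letters that occur twice. A pair of letters is needed if their relative order
  is an invariant: without \<open>strict\<close>, a second and a first occurrence commute as well.
\<close>

definition needed :: "bool \<Rightarrow> 'a set \<Rightarrow> 'a \<Rightarrow> 'a \<Rightarrow> bool" where
  "needed strict D c d \<longleftrightarrow> strict \<or> c \<notin> D \<or> d \<notin> D"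

text \<open>The three alternatives are the contexts in which \<open>sigma2\<close>,
  \<open>sigma1\<close> and \<open>sigma3\<close>, in this order, exchange neighbours.\<close>

definition swappable :: "bool \<Rightarrow> 'a set \<Rightarrow> 'a list \<Rightarrow> 'a \<Rightarrow> 'a \<Rightarrow> 'a list \<Rightarrow> bool" where
  "swappable strict D p c d s \<longleftrightarrow> c \<noteq> d \<and>
     (c \<in> set p \<and> d \<in> set p \<or> c \<in> set s \<and> d \<in> set s \<or>
      \<not> strict \<and> c \<in> D \<and> d \<in> D \<and> (c \<in> set p \<and> d \<in> set s \<or> d \<in> set p \<and> c \<in> set s))"

lemma before_swap:
  assumes "swappable strict D p c d s" "needed strict D a b"
  shows "before (p @ c # d # s) a b = before (p @ d # c # s) a b"
  using assms by (auto simp: swappable_def needed_def before_append)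

text \<open>
  If \<open>h\<close> comes next in \<open>p h u\<close> while \<open>d\<close> precedes \<open>h\<close> in \<open>p x d y\<close>, then these occurrences of
  \<open>d\<close> and \<open>h\<close> commute, as otherwise \<open>before\<close> would tell the two words apart.
\<close>

lemma swappable_head:
  assumes cnt: "\<And>c. count_list (p @ h # u) c = count_list (p @ x @ d # y) c"
    and le2: "\<And>c. count_list (p @ h # u) c \<le> 2"
    and D: "\<And>c. c \<in> D \<longleftrightarrow> count_list (p @ h # u) c = 2"
    and h: "h \<notin> set x" "h \<noteq> d" "h \<in> set y"
    and agree: "\<And>a b. needed strict D a b \<Longrightarrow> a \<in> {h, d} \<Longrightarrow> b \<in> {h, d} \<Longrightarrow> a \<noteq> b \<Longrightarrow>
      before (p @ h # u) a b = before (p @ x @ d # y) a b"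
    and y: "y = y1 @ h # y2"  "h \<notin> set y1"
  shows "swappable strict D (p @ x) d h (y1 @ y2)"
proof -
  have n: "count_list p h + 1 + count_list u h \<le> 2"
    "count_list p d + count_list u d \<le> 2"
    "count_list p h + 1 + count_list u h = count_list p h + 1 + count_list y2 h"
    "count_list p d + count_list u d = count_list p d + (count_list x d + 1 + count_list (y1 @ y2) d)"
    "h \<in> D \<longleftrightarrow> count_list p h + 1 + count_list u h = 2"
    "d \<in> D \<longleftrightarrow> count_list p d + count_list u d = 2"
    using le2[of h] le2[of d] cnt[of h] cnt[of d] D[of h] D[of d] h y
    by (auto simp: count_notin)
  have ag1: "needed strict D h d \<Longrightarrow> before (p @ h # u) h d = before (p @ x @ d # y) h d"
    using agree h by blast
  have ag2: "needed strict D d h \<Longrightarrow> before (p @ h # u) d h = before (p @ x @ d # y) d h"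
    using agree h by blast
  have bn: "h \<notin> set u \<Longrightarrow> before u h d" by (rule before_notin)
  \<comment> \<open>The cases say whether \<open>h\<close> and this \<open>d\<close> are second or
    first occurrences. Equal kinds commute by \<open>sigma2\<close> or \<open>sigma1\<close>; for
    unequal kinds \<open>before\<close> differs in the two words, so the pair cannot be
    needed.\<close>
  consider "h \<in> set p" "d \<in> set (p @ x)" | "h \<in> set p" "d \<notin> set (p @ x)"
    | "h \<notin> set p" "d \<notin> set (p @ x)" | "h \<notin> set p" "d \<in> set (p @ x)" by blast
  then show ?thesis
  proof cases
    case 1
    then show ?thesis using h by (auto simp: swappable_def)
  next
    case 2
    then have *: "h \<notin> set u" "h \<in> D" using n by (auto simp: set_iff_count_list)
    have "before (p @ h # u) h d" using 2 * h bn by (simp add: before_append)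
    moreover have "\<not> before (p @ x @ d # y) h d" using 2 h y by (auto simp: before_append)
    ultimately have "\<not> needed strict D h d" using ag1 by blast
    then have "\<not> strict" "d \<in> D" by (auto simp: needed_def)
    moreover from this have "d \<in> set (y1 @ y2)" using n 2 by (auto simp: set_iff_count_list)
    ultimately show ?thesis using 2 * h by (auto simp: swappable_def)
  next
    case 3
    have "\<not> before (p @ x @ d # y) h d" using 3 h y by (auto simp: before_append)
    show ?thesis
    proof (cases "h \<in> D")
      case False
      then have "h \<notin> set u" using n 3 by (auto simp: set_iff_count_list)
      then have "before (p @ h # u) h d" using 3 h bn by (simp add: before_append)
      moreover have "needed strict D h d" using False by (simp add: needed_def)
      ultimately show ?thesis using ag1 \<open>\<not> before (p @ x @ d # y) h d\<close> by blast
    next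
      case True
      then have hy: "h \<in> set y2" using n 3 by (auto simp: set_iff_count_list)
      show ?thesis
      proof (cases "d \<in> set (y1 @ y2)")
        case True
        then show ?thesis using hy h by (auto simp: swappable_def)
      next
        case False
        then have dD: "d \<notin> D" "d \<in> set u" using 3 n by (auto simp: set_iff_count_list)
        have "before (p @ x @ d # y) d h"
          using 3 h y False by (auto simp: before_append before_notin)
        moreover have "\<not> before (p @ h # u) d h" using 3 h dD by (auto simp: before_append)
        ultimately show ?thesis using ag2 dD by (auto simp: needed_def)
      qed
    qed
  next
    case 4
    then have dn: "d \<notin> set (y1 @ y2)" "d \<in> D" "d \<in> set u" using n by (auto simp: set_iff_count_list)
    have "before (p @ x @ d # y) d h"
      using 4 h y dn by (auto simp: before_append before_notin)
    moreover have "\<not> before (p @ h # u) d h" using 4 h dn by (auto simp: before_append)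
    ultimately have "\<not> needed strict D d h" using ag2 by blast
    then have "\<not> strict" "h \<in> D" by (auto simp: needed_def)
    moreover from this have "h \<in> set y2" using n 4 by (auto simp: set_iff_count_list)
    ultimately show ?thesis using 4 dn h by (auto simp: swappable_def)
  qed
qed

definition same_order :: "bool \<Rightarrow> 'a set \<Rightarrow> 'a list \<Rightarrow> 'a list \<Rightarrow> bool" where
  "same_order strict D u v \<longleftrightarrow>
     (\<forall>c d. needed strict D c d \<longrightarrow> c \<in> set u \<longrightarrow> d \<in> set u \<longrightarrow> c \<noteq> d \<longrightarrow> before u c d = before v c d)"

context O_congruence
begin

text \<open>\<open>h\<close> passes the letters of \<open>v1\<close> from right to left. The needed
  orders are recorded along the way because the sorting argument that uses this lemma continues with
  the resulting word.\<close>

lemma move_to_front: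
  assumes swap: "\<And>p c d s. swappable strict D p c d s \<Longrightarrow> p @ c # d # s \<approx> p @ d # c # s"
    and ok: "\<And>x d y. v1 = x @ d # y \<Longrightarrow> swappable strict D (p @ x) d h (y @ v2)"
  shows "p @ v1 @ h # v2 \<approx> p @ h # v1 @ v2 \<and>
    (\<forall>a b. needed strict D a b \<longrightarrow> before (p @ v1 @ h # v2) a b = before (p @ h # v1 @ v2) a b)"
  using ok
proof (induction v1 arbitrary: v2 rule: rev_induct)
  case (snoc d x)
  have sw: "swappable strict D (p @ x) d h v2" using snoc.prems[of x d "[]"] by simp
  have IH: "p @ x @ h # d # v2 \<approx> p @ h # x @ d # v2 \<and>
    (\<forall>a b. needed strict D a b \<longrightarrow> before (p @ x @ h # d # v2) a b = before (p @ h # x @ d # v2) a b)"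
  proof (rule snoc.IH)
    fix x' d' y assume "x = x' @ d' # y"
    then show "swappable strict D (p @ x') d' h (y @ d # v2)"
      using snoc.prems[of x' d' "y @ [d]"] by simp
  qed
  show ?case
    using trans[OF swap[OF sw]] before_swap[OF sw] IH by simp
qed simp

text \<open>Selection sort: \<open>p\<close> is the part already matched, and the next letter of the
  first word is fetched from the second one, each transposition being allowed by
  \<open>swappable_head\<close>.\<close>

lemma same_order_imp_equiv:
  assumes swap: "\<And>p c d s. swappable strict D p c d s \<Longrightarrow> p @ c # d # s \<approx> p @ d # c # s"
  assumes "\<And>c. count_list (p @ u) c = count_list (p @ v) c"
    and "\<And>c. count_list (p @ u) c \<le> 2"
    and "\<And>c. c \<in> D \<longleftrightarrow> count_list (p @ u) c = 2"
    and "same_order strict D (p @ u) (p @ v)"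
  shows "p @ u \<approx> p @ v"
  using assms(2-)
proof (induction u arbitrary: p v)
  case Nil
  then have "v = []" using count_list_0_iff[of v] by (cases v) (auto simp: fun_eq_iff split: if_splits)
  then show ?case by simp
next
  case (Cons h u)
  have "count_list v h \<noteq> 0" using Cons.prems(1)[of h] by auto
  then have "h \<in> set v" by (meson count_notin)
  then obtain v1 v2 where v: "v = v1 @ h # v2" "h \<notin> set v1" by (meson split_list_first)
  have ok: "swappable strict D (p @ x) d h (y @ v2)" if "v1 = x @ d # y" for x d y
  proof (rule swappable_head[of p h u x d "y @ h # v2"])
    show "count_list (p @ h # u) c = count_list (p @ x @ d # (y @ h # v2)) c" for c
      using Cons.prems(1)[of c] v that by auto
    show "count_list (p @ h # u) c \<le> 2" for c by (rule Cons.prems(2))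
    show "c \<in> D \<longleftrightarrow> count_list (p @ h # u) c = 2" for c by (rule Cons.prems(3))
    show "h \<notin> set x" "h \<noteq> d" "h \<in> set (y @ h # v2)" "h \<notin> set y" using v that by auto
    have "count_list (p @ h # u) d \<noteq> 0" using Cons.prems(1)[of d] v that by auto
    then have "d \<in> set (p @ h # u)" by (meson count_notin)
    show "before (p @ h # u) a b = before (p @ x @ d # (y @ h # v2)) a b"
      if "needed strict D a b" "a \<in> {h, d}" "b \<in> {h, d}" "a \<noteq> b" for a b
    proof -
      have "a \<in> set (p @ h # u)" "b \<in> set (p @ h # u)"
        using that \<open>d \<in> set (p @ h # u)\<close> by auto
      then have "before (p @ h # u) a b = before (p @ v) a b"
        using Cons.prems(4) that unfolding same_order_def by blast
      then show ?thesis using v \<open>v1 = x @ d # y\<close> by simp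
    qed
  qed simp
  have mv: "p @ v \<approx> p @ h # v1 @ v2"
    "needed strict D a b \<Longrightarrow> before (p @ v) a b = before (p @ h # v1 @ v2) a b" for a b
    using move_to_front[OF swap ok] unfolding v by auto
  have "(p @ [h]) @ u \<approx> (p @ [h]) @ (v1 @ v2)"
  proof (rule Cons.IH)
    show "count_list ((p @ [h]) @ u) c = count_list ((p @ [h]) @ v1 @ v2) c" for c
      using Cons.prems(1)[of c] v by (auto split: if_splits)
    show "count_list ((p @ [h]) @ u) c \<le> 2" for c using Cons.prems(2)[of c] by auto
    show "c \<in> D \<longleftrightarrow> count_list ((p @ [h]) @ u) c = 2" for c using Cons.prems(3)[of c] by auto
    show "same_order strict D ((p @ [h]) @ u) ((p @ [h]) @ v1 @ v2)"
      using Cons.prems(4) mv(2) by (auto simp: same_order_def)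
  qed
  then show ?case using trans sym[OF mv(1)] by simp
qed

end

text \<open>
  No two neighbours are both first or both second occurrences of letters from \<open>D\<close>; \<open>A\<close> collects the
  letters already read. Nothing commutes in such a word.
\<close>

fun alternating :: "'a set \<Rightarrow> 'a set \<Rightarrow> 'a list \<Rightarrow> bool" where
  "alternating D A (h # e # s) \<longleftrightarrow>
     \<not> (h \<in> D \<and> e \<in> D \<and> (h \<in> A \<longleftrightarrow> e \<in> A)) \<and> alternating D (insert h A) (e # s)"
| "alternating D A _ \<longleftrightarrow> True"

text \<open>If the words first differ with heads \<open>h\<close> and \<open>d\<close>, then
  \<open>swappable_head\<close> makes these both first or both second occurrences. The letter
  \<open>e\<close> that follows \<open>h\<close> is then of another kind, and its order relative to
  \<open>d\<close> differs in the two words.\<close>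

lemma alternating_rigid:
  assumes "\<And>c. count_list (p @ u) c = count_list (p @ v) c"
    and "\<And>c. count_list (p @ u) c \<le> 2"
    and "\<And>c. c \<in> D \<longleftrightarrow> count_list (p @ u) c = 2"
    and "same_order True D (p @ u) (p @ v)"
    and "alternating D (set p) u"
  shows "u = v"
  using assms
proof (induction u arbitrary: p v)
  case Nil
  then show ?case using count_list_0_iff[of v] by (cases v) (auto simp: fun_eq_iff split: if_splits)
next
  case (Cons h u)
  have "count_list (p @ v) h = count_list (p @ h # u) h" using Cons.prems(1)[of h] by simp
  then have "v \<noteq> []" by (cases v) auto
  then obtain d v' where v: "v = d # v'" by (cases v) auto
  have hd: "h = d"
  proof (rule ccontr)
    assume ne: "h \<noteq> d"
    have cnt: "count_list (p @ h # u) c = count_list (p @ d # v') c" for c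
      using Cons.prems(1)[of c] v by simp
    have hv: "h \<in> set v'" using cnt[of h] ne by (auto simp: set_iff_count_list)
    then obtain y1 y2 where y: "v' = y1 @ h # y2" "h \<notin> set y1" by (meson split_list_first)
    have du: "d \<in> set u" using cnt[of d] ne by (auto simp: set_iff_count_list)
    have bef: "before (p @ h # u) a b = before (p @ d # v') a b"
      if "a \<noteq> b" "a \<in> set (p @ h # u)" "b \<in> set (p @ h # u)" for a b
      using Cons.prems(4) that unfolding same_order_def needed_def v by blast
    have "swappable True D (p @ []) d h (y1 @ y2)"
    proof (rule swappable_head[of p h u "[]" d v'])
      show "count_list (p @ h # u) c = count_list (p @ [] @ d # v') c" for c using cnt by simp
      show "before (p @ h # u) a b = before (p @ [] @ d # v') a b"
        if "needed True D a b" "a \<in> {h, d}" "b \<in> {h, d}" "a \<noteq> b" for a b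
        using bef[of a b] that du by auto
    qed (use Cons.prems(2,3) ne hv y in auto)
    then have kind: "d \<in> set p \<longleftrightarrow> h \<in> set p" "d \<in> D" "h \<in> D"
      using Cons.prems(2,3)[of d] Cons.prems(2,3)[of h] cnt[of d] cnt[of h] ne y
      by (auto simp: swappable_def set_iff_count_list)
    obtain e u' where u: "u = e # u'" using du by (cases u) auto
    have e: "\<not> (e \<in> D \<and> (h \<in> set p \<longleftrightarrow> e \<in> set p))"
      using Cons.prems(5) kind u by simp
    then have ed: "e \<noteq> d" and eh: "e \<noteq> h" using kind by auto
    have du': "d \<in> set u'" using du u ed by auto
    have ev: "e \<in> set v'" using cnt[of e] ed eh u by (auto simp: set_iff_count_list)
    have b1: "before (p @ h # e # u') e d = before (p @ d # v') e d"
      and b2: "before (p @ h # e # u') d e = before (p @ d # v') d e"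
      using bef[of e d] bef[of d e] ed du' u by auto
    have n: "e \<in> D \<longleftrightarrow> count_list p e + 1 + count_list u' e = 2"
      "count_list p e + 1 + count_list u' e \<le> 2"
      "count_list v' e = 1 + count_list u' e"
      "count_list p d + 1 + count_list v' d = 2"
      using Cons.prems(2,3)[of e] Cons.prems(3)[of d] cnt[of e] cnt[of d] ed eh ne u kind by auto
    show False
    proof (cases "d \<in> set p")
      case True
      then have dv: "d \<notin> set v'" using n by (auto simp: set_iff_count_list)
      have "e \<notin> set p"
        using e kind True n by (auto simp: set_iff_count_list)
      then show False using b2 True du' dv ed eh ne by (auto simp: before_append before_notin)
    next
      case False
      have "e \<notin> set u'" using e kind False n by (auto simp: set_iff_count_list)
      then show False using b1 False ev ed eh ne by (auto simp: before_append before_notin)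
    qed
  qed
  have "u = v'"
  proof (rule Cons.IH)
    show "count_list ((p @ [h]) @ u) c = count_list ((p @ [h]) @ v') c" for c
      using Cons.prems(1)[of c] v hd by (auto split: if_splits)
    show "count_list ((p @ [h]) @ u) c \<le> 2" for c using Cons.prems(2)[of c] by auto
    show "c \<in> D \<longleftrightarrow> count_list ((p @ [h]) @ u) c = 2" for c using Cons.prems(3)[of c] by auto
    show "same_order True D ((p @ [h]) @ u) ((p @ [h]) @ v')" using Cons.prems(4) v hd by simp
    show "alternating D (set (p @ [h])) u" using Cons.prems(5) by (cases u) auto
  qed
  then show ?case using v hd by simp
qed

section \<open>The congruences above that of \<open>L\<close>\<close>

definition simple :: "word \<Rightarrow> nat set" where
  "simple u = {c. count_list u c = 1}"

lemma in_simple: "c \<in> simple u \<longleftrightarrow> count_list u c = 1"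
  by (simp add: simple_def)

text \<open>Stated through a restriction to two letters, it passes to restricted identities by
  \<open>filter_closed\<close> and fixes both multiplicities.\<close>

definition encloses :: "word \<Rightarrow> nat \<Rightarrow> nat \<Rightarrow> bool" where
  "encloses u c t \<longleftrightarrow> c \<noteq> t \<and> filter (\<lambda>d. d = c \<or> d = t) u = [c, t, c]"

definition core :: "word \<Rightarrow> nat set" where
  "core u = {c. \<exists>t. encloses u c t}"

lemma encloses_count:
  assumes "encloses u c t"
  shows "count_list u c = 2" "count_list u t = 1"
proof -
  have "count_list (filter (\<lambda>d. d = c \<or> d = t) u) c = count_list u c"
    "count_list (filter (\<lambda>d. d = c \<or> d = t) u) t = count_list u t"
    by (simp_all add: count_list_filter)
  then show "count_list u c = 2" "count_list u t = 1"
    using assms by (auto simp: encloses_def)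
qed

lemma encloses_filter: "P c \<Longrightarrow> P t \<Longrightarrow> encloses (filter P u) c t = encloses u c t"
proof -
  assume "P c" "P t"
  then have "filter (\<lambda>d. d = c \<or> d = t) (filter P u) = filter (\<lambda>d. d = c \<or> d = t) u"
    unfolding filter_filter by (intro filter_cong) auto
  then show ?thesis by (simp add: encloses_def)
qed

lemma core_filter: "core (filter P u) \<subseteq> core u"
proof
  fix c assume "c \<in> core (filter P u)"
  then obtain t where t: "encloses (filter P u) c t" by (auto simp: core_def)
  then have "count_list (filter P u) c = 2" "count_list (filter P u) t = 1"
    using encloses_count by blast+
  then have "P c" "P t" by (auto simp: count_list_filter split: if_splits)
  then show "c \<in> core u" using t encloses_filter by (auto simp: core_def)
qed

lemma core_count: "c \<in> core u \<Longrightarrow> count_list u c = 2"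
  using encloses_count by (auto simp: core_def)

lemma filter_doubleton_eq:
  assumes "filter (\<lambda>d. d \<noteq> t) F = [c, s, c']" "count_list F t = 1"
  shows "F \<in> {[t, c, s, c'], [c, t, s, c'], [c, s, t, c'], [c, s, c', t]}"
proof -
  have "t \<in> set F" using assms(2) by (simp add: set_iff_count_list)
  then obtain a b where F: "F = a @ t # b" by (meson split_list)
  then have "t \<notin> set a" "t \<notin> set b" using assms(2) by (auto simp: set_iff_count_list)
  then have "filter (\<lambda>d. d \<noteq> t) a = a" "filter (\<lambda>d. d \<noteq> t) b = b"
    by (auto simp: filter_id_conv)
  then have "a @ b = [c, s, c']" using assms(1) F by simp
  then have "a = [] \<and> b = [c, s, c'] \<or> a = [c] \<and> b = [s, c'] \<or>
      a = [c, s] \<and> b = [c'] \<or> a = [c, s, c'] \<and> b = []"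
    by (simp add: append_eq_Cons_conv) blast
  then show ?thesis unfolding F by auto
qed

text \<open>The congruences that contain the identities of \<open>L\<close> turn out to be the full relation and
  the five relations \<open>Q 1, \<dots>, Q 5\<close>.\<close>

definition Q :: "nat \<Rightarrow> word \<Rightarrow> word \<Rightarrow> bool" where
  "Q k u v \<longleftrightarrow>
     (1 \<le> k \<longrightarrow> set u = set v) \<and>
     (2 \<le> k \<longrightarrow> simple u = simple v) \<and>
     (3 \<le> k \<longrightarrow> filter (\<lambda>c. c \<in> simple u) u = filter (\<lambda>c. c \<in> simple v) v) \<and>
     (4 \<le> k \<longrightarrow> encloses u = encloses v) \<and>
     (5 \<le> k \<longrightarrow> (\<forall>c\<in>core u. \<forall>d\<in>core u. before u c d = before v c d))"

lemma Q_mono: "Q k u v \<Longrightarrow> j \<le> k \<Longrightarrow> Q j u v"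
  unfolding Q_def by (meson le_trans)

lemma Q_filter_simple:
  assumes "Q 3 u v"
  shows "filter (\<lambda>c. c \<in> simple u) u = filter (\<lambda>c. c \<in> simple v) v"
proof -
  have "(3::nat) \<le> 3 \<longrightarrow> ?thesis" using assms unfolding Q_def by blast
  then show ?thesis by (rule mp) simp
qed

lemma Q_core: "Q 4 u v \<Longrightarrow> core u = core v"
  by (simp add: Q_def core_def)

lemma Q_sym: "Q k u v \<Longrightarrow> Q k v u"
  by (auto simp: Q_def core_def)

lemma Q_before_simple:
  assumes "Q 3 u v" "c \<in> simple u" "d \<in> simple u"
  shows "before u c d = before v c d"
proof -
  have s: "filter (\<lambda>c. c \<in> simple u) u = filter (\<lambda>c. c \<in> simple v) v"
    by (rule Q_filter_simple[OF assms(1)])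
  have "simple u = simple v" using assms(1) unfolding Q_def by simp
  then have v: "c \<in> simple v" "d \<in> simple v" using assms by blast+
  have "before u c d = before (filter (\<lambda>c. c \<in> simple u) u) c d"
    by (rule before_filter[symmetric]) fact+
  also have "\<dots> = before v c d"
    unfolding s by (rule before_filter) fact+
  finally show ?thesis .
qed

lemma enclosing_cases:
  assumes "encloses u c s" "t \<in> simple u" "s \<noteq> t"
  shows "filter (\<lambda>e. e = c \<or> e = s \<or> e = t) u \<in> {[t, c, s, c], [c, t, s, c], [c, s, t, c], [c, s, c, t]}"
    and "c \<noteq> t" "c \<noteq> s"
proof -
  have cnt: "count_list u c = 2" "count_list u s = 1" using encloses_count assms(1) by auto
  then show ne: "c \<noteq> t" "c \<noteq> s" using assms by (auto simp: in_simple)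
  show "filter (\<lambda>e. e = c \<or> e = s \<or> e = t) u \<in> {[t, c, s, c], [c, t, s, c], [c, s, t, c], [c, s, c, t]}"
  proof (rule filter_doubleton_eq)
    have "filter (\<lambda>d. d \<noteq> t) (filter (\<lambda>e. e = c \<or> e = s \<or> e = t) u) = filter (\<lambda>d. d = c \<or> d = s) u"
      unfolding filter_filter using assms ne by (intro filter_cong) auto
    then show "filter (\<lambda>d. d \<noteq> t) (filter (\<lambda>e. e = c \<or> e = s \<or> e = t) u) = [c, s, c]"
      using assms by (simp add: encloses_def)
  qed (use assms in \<open>simp add: count_list_filter in_simple\<close>)
qed

text \<open>The restriction to \<open>c\<close>, \<open>s\<close>, \<open>t\<close> arises by
  inserting \<open>t\<close> into \<open>[c, s, c]\<close>, so four words remain to be checked. This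
  is why \<open>Q\<close> needs no clause for orders between core letters and simple
  letters.\<close>

lemma before_core_simple:
  assumes "encloses u c s" "t \<in> simple u" "s \<noteq> t"
  shows "before u c t \<longleftrightarrow> before u s t \<and> \<not> encloses u c t"
    and "before u t c \<longleftrightarrow> before u t s \<and> \<not> encloses u c t"
proof -
  define F where "F = filter (\<lambda>e. e = c \<or> e = s \<or> e = t) u"
  have F: "F \<in> {[t, c, s, c], [c, t, s, c], [c, s, t, c], [c, s, c, t]}" "c \<noteq> t" "c \<noteq> s"
    using enclosing_cases[OF assms] unfolding F_def by blast+
  have b: "before u a b = before F a b" if "a \<in> {c, s, t}" "b \<in> {c, s, t}" for a b
    unfolding F_def by (rule before_filter[symmetric]) (use that in auto)
  have e: "encloses u c t = encloses F c t"
    unfolding F_def by (rule encloses_filter[symmetric]) auto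
  have "before F c t \<longleftrightarrow> before F s t \<and> \<not> encloses F c t"
    "before F t c \<longleftrightarrow> before F t s \<and> \<not> encloses F c t"
    using F assms(3) by (auto simp: encloses_def)
  then show "before u c t \<longleftrightarrow> before u s t \<and> \<not> encloses u c t"
    "before u t c \<longleftrightarrow> before u t s \<and> \<not> encloses u c t"
    using b[of c t] b[of s t] b[of t c] b[of t s] e by simp_all
qed

lemma before_enclosed:
  assumes "encloses u c t"
  shows "\<not> before u c t" "\<not> before u t c"
proof -
  have "before u a b = before [c, t, c] a b" if "a \<in> {c, t}" "b \<in> {c, t}" for a b
    using before_filter[of "\<lambda>e. e = c \<or> e = t" a b u] that assms by (auto simp: encloses_def)
  from this[of c t] this[of t c] show "\<not> before u c t" "\<not> before u t c"
    using assms by (auto simp: encloses_def)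
qed

lemma Q_before:
  assumes Q: "Q 4 u v" and c: "c \<in> core u" and t: "t \<in> simple u"
  shows "before u c t = before v c t" "before u t c = before v t c"
proof -
  have en: "encloses u = encloses v" and tv: "t \<in> simple v"
    using Q t by (auto simp: Q_def)
  obtain s where s: "encloses u c s" using c by (auto simp: core_def)
  then have su: "s \<in> simple u" using encloses_count by (simp add: in_simple)
  have Q3: "Q 3 u v" using Q Q_mono[of 4 u v 3] by simp
  have "before u c t = before v c t \<and> before u t c = before v t c"
  proof (cases "s = t")
    case True
    then show ?thesis using before_enclosed s en by metis
  next
    case False
    then show ?thesis
      using before_core_simple[OF s t False] before_core_simple[of v c s t] s en tv
        Q_before_simple[OF Q3 su t] Q_before_simple[OF Q3 t su] by simp
  qed
  then show "before u c t = before v c t" "before u t c = before v t c" by auto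
qed

definition squares :: "word \<Rightarrow> word" where
  "squares cs = concat (map (\<lambda>c. [c, c]) cs)"

text \<open>The identity xzxyty \<approx> xzyxty: a second occurrence passes an adjacent first one.
  Its two sides are related by \<open>Q 4\<close> but not by \<open>Q 5\<close>.\<close>

definition sigma3 :: identity where
  "sigma3 = ([0, 2, 0, 1, 3, 1], [0, 2, 1, 0, 3, 1])"

lemma replicate_subst: "subst (\<lambda>i. if i = c then [0] else []) u = replicate (count_list u c) 0"
  by (induction u) auto

lemma distinct_filter_simple: "distinct (filter (\<lambda>c. c \<in> simple u) u)"
proof -
  have "count_list (filter (\<lambda>c. c \<in> simple u) u) c \<le> 1" for c
    by (simp add: count_list_filter in_simple)
  moreover have "(\<And>c. count_list w c \<le> 1) \<Longrightarrow> distinct w" for w :: word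
  proof (induction w)
    case (Cons a w)
    have "count_list w c \<le> 1" for c using Cons.prems[of c] by (auto split: if_splits)
    moreover have "a \<notin> set w" using Cons.prems[of a] by (auto simp: set_iff_count_list)
    ultimately show ?case using Cons.IH by simp
  qed simp
  ultimately show ?thesis by blast
qed

text \<open>The first position at which the lists differ supplies the pair: each letter found there
  comes later in the other list.\<close>

lemma distinct_lists_inversion:
  assumes "distinct u" "distinct v" "set u = set v" "u \<noteq> v"
  shows "\<exists>c d. c \<noteq> d \<and> filter (\<lambda>e. e = c \<or> e = d) u = [c, d] \<and> filter (\<lambda>e. e = c \<or> e = d) v = [d, c]"
  using assms
proof (induction u arbitrary: v)
  case (Cons c u)
  then obtain d v' where v: "v = d # v'" by (cases v) auto
  show ?case
  proof (cases "c = d")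
    case True
    then have "set u = set v'" using Cons.prems v by auto
    with Cons.IH[of v'] Cons.prems v True obtain a b where ab: "a \<noteq> b"
      "filter (\<lambda>e. e = a \<or> e = b) u = [a, b]" "filter (\<lambda>e. e = a \<or> e = b) v' = [b, a]" by auto
    have "set [a, b] \<subseteq> set u" unfolding ab(2)[symmetric] by (rule filter_is_subset)
    then have "a \<noteq> c" "b \<noteq> c" using Cons.prems by auto
    then show ?thesis using ab v True by (intro exI[of _ a] exI[of _ b]) auto
  next
    case False
    have one: "filter (\<lambda>e. e = a \<or> e = b) (b # w) = [b, a]"
      if dw: "distinct (b # w)" and aw: "a \<in> set w" for a b and w :: "'a list"
    proof -
      obtain x y where w: "w = x @ a # y" using aw by (meson split_list)
      then have "filter (\<lambda>e. e = a \<or> e = b) x = []" "filter (\<lambda>e. e = a \<or> e = b) y = []"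
        using dw by (auto simp: filter_empty_conv)
      then show ?thesis using w dw by auto
    qed
    have "d \<in> set u" "c \<in> set v'" using Cons.prems v False by auto
    then have "filter (\<lambda>e. e = d \<or> e = c) (c # u) = [c, d]"
      "filter (\<lambda>e. e = c \<or> e = d) (d # v') = [d, c]"
      using one[of c u d] one[of d v' c] Cons.prems(1,2) v by simp_all
    moreover have "(\<lambda>e. e = d \<or> e = c) = (\<lambda>e. e = c \<or> e = d)" by auto
    ultimately show ?thesis unfolding v using False by (intro exI[of _ c] exI[of _ d]) simp
  qed
qed simp

context O_congruence
begin

lemma replicate_two:
  assumes "2 \<le> k" shows "replicate k c \<approx> [c, c]"
proof (cases "k = 2")
  case True
  then show ?thesis by (simp add: numeral_2_eq_2)
next
  case False
  have "count_list (replicate k c) c = k" by (induction k) auto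
  then show ?thesis using pull_triple[of "replicate k c" c] assms False by simp
qed

text \<open>\<open>P c u\<close> is any condition that lets \<open>c\<close> become a leading
  square. Its stability under the deletion of other letters allows the pulling to be iterated on the
  remainder.\<close>

lemma pull_squares:
  assumes "\<And>c u. P c u \<Longrightarrow> u \<approx> c # c # filter (\<lambda>d. d \<noteq> c) u"
    and "\<And>c d u. P c u \<Longrightarrow> c \<noteq> d \<Longrightarrow> P c (filter (\<lambda>e. e \<noteq> d) u)"
    and "distinct cs" "\<And>c. c \<in> set cs \<Longrightarrow> P c u"
  shows "u \<approx> squares cs @ filter (\<lambda>d. d \<notin> set cs) u"
  using assms(3,4)
proof (induction cs arbitrary: u)
  case (Cons c cs)
  let ?u = "filter (\<lambda>d. d \<noteq> c) u"
  have IH: "?u \<approx> squares cs @ filter (\<lambda>d. d \<notin> set cs) ?u"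
  proof (rule Cons.IH)
    fix b assume b: "b \<in> set cs"
    then have "b \<noteq> c" using Cons.prems(1) by auto
    then show "P b ?u" using assms(2) Cons.prems(2)[of b] b by simp
  qed (use Cons.prems in simp)
  have "u \<approx> [c, c] @ ?u" using assms(1) Cons.prems by simp
  also have "\<dots> \<approx> [c, c] @ squares cs @ filter (\<lambda>d. d \<notin> set cs) ?u"
    by (rule prefix_closed[OF IH])
  also have "filter (\<lambda>d. d \<notin> set cs) ?u = filter (\<lambda>d. d \<notin> set (c # cs)) u"
    unfolding filter_filter by (intro filter_cong) auto
  finally show ?case by (simp add: squares_def)
qed (simp add: squares_def)

lemma Q0_le: "[0] \<approx> [] \<Longrightarrow> u \<approx> v"
proof -
  assume 0: "[0] \<approx> []"
  have "w \<approx> []" for w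
  proof (induction w)
    case (Cons c w)
    have "[c] \<approx> []" using subst_closed[OF 0, of "\<lambda>_. [c]"] by simp
    then show ?case using append_closed[OF _ Cons] by force
  qed simp
  then show "u \<approx> v" using sym trans by blast
qed

lemma Q1_le:
  assumes "[0] \<approx> [0, 0]" "Q 1 u v"
  shows "u \<approx> v"
proof -
  have sq: "[c] \<approx> [c, c]" for c using subst_closed[OF assms(1), of "\<lambda>_. [c]"] by simp
  have nf: "w \<approx> squares (sorted_list_of_set (set w))" for w
  proof -
    have "w \<approx> squares (sorted_list_of_set (set w)) @
        filter (\<lambda>d. d \<notin> set (sorted_list_of_set (set w))) w"
    proof (rule pull_squares[of "\<lambda>c u. c \<in> set u"])
      fix c :: nat and u assume "c \<in> set u"
      then obtain p q where u: "u = p @ c # q" by (meson split_list)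
      have "u \<approx> p @ c # c # q" using context_closed[OF sq, of p c q] u by simp
      also have "\<dots> \<approx> c # c # filter (\<lambda>d. d \<noteq> c) (p @ q)" by (rule pull_square)
      finally show "u \<approx> c # c # filter (\<lambda>d. d \<noteq> c) u" by (simp add: u)
    qed auto
    moreover have "filter (\<lambda>d. d \<notin> set (sorted_list_of_set (set w))) w = []"
      by (simp add: filter_empty_conv)
    ultimately show ?thesis by simp
  qed
  have "set u = set v" using assms(2) by (simp add: Q_def)
  then show ?thesis using trans[OF nf[of u]] sym[OF nf[of v]] by simp
qed

definition repeated_squares :: "word \<Rightarrow> word" where
  "repeated_squares u = squares (sorted_list_of_set (set u - simple u))"

lemma collapse_normal_form:
  assumes "[0, 1, 0] \<approx> [0, 0, 1]"
  shows "u \<approx> repeated_squares u @ filter (\<lambda>c. c \<in> simple u) u"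
proof -
  have "u \<approx> squares (sorted_list_of_set (set u - simple u)) @
      filter (\<lambda>d. d \<notin> set (sorted_list_of_set (set u - simple u))) u"
  proof (rule pull_squares[of "\<lambda>c u. 2 \<le> count_list u c"])
    fix c :: nat and u :: word assume c: "2 \<le> count_list u c"
    then have "c \<in> set u" by (simp add: set_iff_count_list)
    then obtain p u1 where u1: "u = p @ c # u1" "c \<notin> set p" by (meson split_list_first)
    with c have "c \<in> set u1" by (auto simp: set_iff_count_list)
    then obtain q s where s: "u1 = q @ c # s" by (meson split_list)
    have "c # q @ [c] \<approx> c # c # q"
      using subst_closed[OF assms, of "\<lambda>i. if i = 0 then [c] else q"] by simp
    then have "u \<approx> p @ c # c # q @ s" using context_closed[of _ _ p s] u1 s by fastforce
    also have "\<dots> \<approx> c # c # filter (\<lambda>d. d \<noteq> c) (p @ q @ s)" by (rule pull_square)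
    finally show "u \<approx> c # c # filter (\<lambda>d. d \<noteq> c) u" by (simp add: u1 s)
  next
    fix c assume "c \<in> set (sorted_list_of_set (set u - simple u))"
    then show "2 \<le> count_list u c" by (auto simp: set_iff_count_list in_simple)
  qed (auto simp: count_list_filter)
  moreover have "filter (\<lambda>d. d \<notin> set (sorted_list_of_set (set u - simple u))) u =
      filter (\<lambda>c. c \<in> simple u) u"
    by (intro filter_cong) auto
  ultimately show ?thesis by (simp add: repeated_squares_def)
qed

lemma repeated_squares_cong: "Q 2 u v \<Longrightarrow> repeated_squares u = repeated_squares v"
  by (simp add: Q_def repeated_squares_def)

lemma Q3_le:
  assumes "[0, 1, 0] \<approx> [0, 0, 1]" "Q 3 u v"
  shows "u \<approx> v"
proof -
  have "repeated_squares u = repeated_squares v"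
    using Q_mono[OF assms(2), of 2] repeated_squares_cong by simp
  moreover have "filter (\<lambda>c. c \<in> simple u) u = filter (\<lambda>c. c \<in> simple v) v"
    by (rule Q_filter_simple[OF assms(2)])
  ultimately show ?thesis
    using trans[OF collapse_normal_form[OF assms(1), of u]] sym[OF collapse_normal_form[OF assms(1), of v]]
    by simp
qed

lemma commutative_equiv:
  assumes "[0, 1] \<approx> [1, 0]" "distinct u" "distinct v" "set u = set v"
  shows "u \<approx> v"
  using assms(2-)
proof (induction u arbitrary: v)
  case (Cons c u)
  then obtain p q where v: "v = p @ c # q" by (metis list.set_intros(1) split_list)
  have "c # p \<approx> p @ [c]"
    using subst_closed[OF assms(1), of "\<lambda>i. if i = 0 then [c] else p"] by simp
  then have v': "c # p @ q \<approx> v" using suffix_closed[of "c # p" "p @ [c]" q] v by simp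
  have "u \<approx> p @ q" using Cons.prems v by (intro Cons.IH) auto
  then have "c # u \<approx> c # p @ q" using prefix_closed[of u "p @ q" "[c]"] by simp
  then show ?case using v' trans by blast
qed simp

lemma Q2_le:
  assumes "[0, 1] \<approx> [1, 0]" "Q 2 u v"
  shows "u \<approx> v"
proof -
  have "[0, 1, 0] \<approx> [0, 0, 1]" using prefix_closed[OF sym[OF assms(1)], of "[0]"] by simp
  note nf = collapse_normal_form[OF this]
  have "filter (\<lambda>c. c \<in> simple u) u \<approx> filter (\<lambda>c. c \<in> simple v) v"
    using assms(2) by (intro commutative_equiv[OF assms(1)] distinct_filter_simple) (auto simp: Q_def)
  then have "repeated_squares u @ filter (\<lambda>c. c \<in> simple u) u \<approx>
      repeated_squares v @ filter (\<lambda>c. c \<in> simple v) v"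
    using repeated_squares_cong[OF assms(2)] prefix_closed by simp
  then show ?thesis using trans[OF nf trans[OF _ sym[OF nf]]] by blast
qed

lemma swap_sigma3:
  assumes "fst sigma3 \<approx> snd sigma3" "c \<in> set p" "d \<in> set s"
  shows "p @ c # d # s \<approx> p @ d # c # s"
proof -
  obtain p1 p2 where p: "p = p1 @ c # p2" using assms(2) by (meson split_list)
  obtain s1 s2 where s: "s = s1 @ d # s2" using assms(3) by (meson split_list)
  show ?thesis
    using context_closed[OF subst_closed[OF assms(1), of
      "\<lambda>i. if i = 0 then [c] else if i = 1 then [d] else if i = 2 then p2 else s1"], of p1 s2]
    by (simp add: sigma3_def p s)
qed

lemma swappable_equiv:
  assumes "swappable strict D p c d s" "\<not> strict \<Longrightarrow> fst sigma3 \<approx> snd sigma3"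
  shows "p @ c # d # s \<approx> p @ d # c # s"
  using assms swap_first[of c s d p] swap_second[of c p d s] swap_sigma3[of c p d s]
    sym[OF swap_sigma3[of d p c s]]
  by (auto simp: swappable_def)

text \<open>Two levels in one argument. Repeated letters outside the core become leading squares;
  what is left has core letters twice and simple letters once and is sorted by
  \<open>same_order_imp_equiv\<close>, where \<open>sigma3\<close> supplies the additional swaps
  that are available without \<open>strict\<close>.\<close>

lemma Q_normal_form_le:
  assumes collapse: "\<And>c u. 2 \<le> count_list u c \<Longrightarrow> c \<notin> core u \<Longrightarrow> u \<approx> c # c # filter (\<lambda>d. d \<noteq> c) u"
    and s3: "\<not> strict \<Longrightarrow> fst sigma3 \<approx> snd sigma3"
    and Q: "Q (if strict then 5 else 4) u v"
  shows "u \<approx> v"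
proof -
  have Q4: "Q 4 u v" using Q Q_mono[of 5 u v 4] by (auto split: if_splits)
  define A where "A w = core w \<union> simple w" for w
  have nf: "w \<approx> squares (sorted_list_of_set (set w - A w)) @ filter (\<lambda>d. d \<in> A w) w" for w
  proof -
    have "w \<approx> squares (sorted_list_of_set (set w - A w)) @
        filter (\<lambda>d. d \<notin> set (sorted_list_of_set (set w - A w))) w"
    proof (rule pull_squares[of "\<lambda>c u. 2 \<le> count_list u c \<and> c \<notin> core u"])
      fix c assume "c \<in> set (sorted_list_of_set (set w - A w))"
      then show "2 \<le> count_list w c \<and> c \<notin> core w"
        by (auto simp: A_def set_iff_count_list in_simple)
    next
      fix c d :: nat and u :: word assume "2 \<le> count_list u c \<and> c \<notin> core u" "c \<noteq> d"
      then show "2 \<le> count_list (filter (\<lambda>e. e \<noteq> d) u) c \<and> c \<notin> core (filter (\<lambda>e. e \<noteq> d) u)"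
        using core_filter by (auto simp: count_list_filter)
    qed (auto intro: collapse)
    moreover have "filter (\<lambda>d. d \<notin> set (sorted_list_of_set (set w - A w))) w =
        filter (\<lambda>d. d \<in> A w) w"
      by (intro filter_cong) auto
    ultimately show ?thesis by simp
  qed
  have A: "A u = A v" using Q4 Q_core[OF Q4] by (simp add: A_def Q_def)
  have set_eq: "set u = set v" using Q4 by (simp add: Q_def)
  let ?u = "filter (\<lambda>d. d \<in> A u) u" and ?v = "filter (\<lambda>d. d \<in> A u) v"
  have cnt: "count_list ?u c = (if c \<in> core u then 2 else if c \<in> simple u then 1 else 0)" for c
    using core_count[of c u] by (auto simp: count_list_filter A_def in_simple)
  have cntv: "count_list ?v c = (if c \<in> core v then 2 else if c \<in> simple v then 1 else 0)" for c
    using core_count[of c v] unfolding A by (auto simp: count_list_filter A_def in_simple)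
  have "[] @ ?u \<approx> [] @ ?v"
  proof (rule same_order_imp_equiv[where strict = strict and D = "core u"])
    show "count_list ([] @ ?u) c = count_list ([] @ ?v) c" for c
      using cnt cntv Q4 Q_core[OF Q4] by (simp add: Q_def)
    show "count_list ([] @ ?u) c \<le> 2" for c using cnt by simp
    show "c \<in> core u \<longleftrightarrow> count_list ([] @ ?u) c = 2" for c using cnt by simp
    show "p @ c # d # s \<approx> p @ d # c # s" if "swappable strict (core u) p c d s" for p c d s
      using swappable_equiv[OF that s3] .
    have "before ?u c d = before ?v c d"
      if n: "needed strict (core u) c d" "c \<in> A u" "d \<in> A u" for c d
    proof -
      have "before ?u c d = before u c d" "before ?v c d = before v c d"
        by (rule before_filter; rule n)+
      moreover have "before u c d = before v c d"
      proof (cases "c \<in> core u \<and> d \<in> core u")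
        case True
        then have strict using n by (simp add: needed_def)
        then show ?thesis using True Q by (simp add: Q_def)
      next
        \<comment> \<open>An order that involves a simple letter is already fixed by
          \<open>Q 4\<close>.\<close>
        case False
        then show ?thesis using n Q_before[OF Q4] Q_before_simple[OF Q_mono[OF Q4]]
          by (auto simp: A_def)
      qed
      ultimately show ?thesis by simp
    qed
    then show "same_order strict (core u) ([] @ ?u) ([] @ ?v)"
      by (auto simp: same_order_def)
  qed
  then have uv: "?u \<approx> ?v" by simp
  have "u \<approx> squares (sorted_list_of_set (set u - A u)) @ ?u" by (rule nf)
  also have "\<dots> \<approx> squares (sorted_list_of_set (set u - A u)) @ ?v" by (rule prefix_closed[OF uv])
  also have "\<dots> \<approx> v" using sym[OF nf[of v]] A set_eq by simp
  finally show ?thesis .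
qed

section \<open>Identities forced by a violated clause of \<open>Q\<close>\<close>

lemma not_Q1:
  assumes "u \<approx> v" "set u \<noteq> set v"
  shows "[0] \<approx> []"
proof -
  have main: "[0] \<approx> []" if uv: "u \<approx> v" and c: "c \<in> set u" "c \<notin> set v" for u v c
  proof -
    let ?k = "count_list u c"
    have k: "0 < ?k" using c by (simp add: set_iff_count_list)
    have e: "replicate ?k 0 \<approx> []"
      using subst_closed[OF uv, of "\<lambda>i. if i = c then [0] else []"] c
      by (simp add: replicate_subst count_notin)
    \<comment> \<open>Doubling makes the exponent at least two, as \<open>replicate_two\<close>
      requires, even if \<open>c\<close> occurs only once.\<close>
    then have "replicate (?k + ?k) 0 \<approx> []"
      using append_closed[OF e e] by (simp add: replicate_add)
    moreover have "replicate (?k + ?k) 0 \<approx> [0, 0]" using k by (intro replicate_two) simp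
    ultimately have sq: "[0, 0] \<approx> []" using sym trans by blast
    \<comment> \<open>With x^2 trivial, x \<approx> x^3 \<approx> x^2 collapses to the empty
      word.\<close>
    have "[0] \<approx> [0, 0, 0]" using prefix_closed[OF sym[OF sq], of "[0]"] by simp
    also have "\<dots> \<approx> [0, 0]" using replicate_two[of 3 0] by (simp add: numeral_3_eq_3)
    also note sq
    finally show ?thesis .
  qed
  from assms(2) obtain c where "c \<in> set u \<and> c \<notin> set v \<or> c \<in> set v \<and> c \<notin> set u" by blast
  then show ?thesis using main[OF assms(1)] main[OF sym[OF assms(1)]] by blast
qed

lemma not_Q2:
  assumes "u \<approx> v" "set u = set v" "simple u \<noteq> simple v"
  shows "[0] \<approx> [0, 0]"
proof -
  have main: "[0] \<approx> [0, 0]" if uv: "u \<approx> v" and c: "count_list u c = 1" "count_list v c \<noteq> 1"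
    and s: "set u = set v" for u v c
  proof -
    have "c \<in> set v" using c s by (auto simp: set_iff_count_list)
    then have "2 \<le> count_list v c" using c by (simp add: set_iff_count_list)
    moreover have "[0] \<approx> replicate (count_list v c) 0"
      using subst_closed[OF uv, of "\<lambda>i. if i = c then [0] else []"] c
      by (simp add: replicate_subst)
    ultimately show ?thesis using replicate_two trans by blast
  qed
  from assms(3) obtain c where
    "count_list u c = 1 \<and> count_list v c \<noteq> 1 \<or> count_list v c = 1 \<and> count_list u c \<noteq> 1"
    unfolding simple_def by blast
  then show ?thesis using main[OF assms(1)] main[OF sym[OF assms(1)]] assms(2) by blast
qed

lemma not_Q3:
  assumes "u \<approx> v" "Q 2 u v" "\<not> Q 3 u v"
  shows "[0, 1] \<approx> [1, 0]"
proof -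
  have s: "simple u = simple v" "set u = set v" using assms(2) by (auto simp: Q_def)
  have "filter (\<lambda>c. c \<in> simple u) u \<noteq> filter (\<lambda>c. c \<in> simple v) v"
    using assms by (auto simp: Q_def)
  then obtain c d where cd: "c \<noteq> d"
    "filter (\<lambda>e. e = c \<or> e = d) (filter (\<lambda>c. c \<in> simple u) u) = [c, d]"
    "filter (\<lambda>e. e = c \<or> e = d) (filter (\<lambda>c. c \<in> simple v) v) = [d, c]"
    using distinct_lists_inversion[OF distinct_filter_simple distinct_filter_simple, of u v] s by auto
  have "filter (\<lambda>c. c \<in> simple u) u \<approx> filter (\<lambda>c. c \<in> simple v) v"
    unfolding s(1) by (rule filter_closed[OF assms(1)])
  from filter_closed[OF this, of "\<lambda>e. e = c \<or> e = d"] cd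
  have "[c, d] \<approx> [d, c]" by simp
  from subst_closed[OF this, of "\<lambda>i. if i = c then [0] else [1]"] cd(1)
  show ?thesis by simp
qed

lemma not_Q4:
  assumes "u \<approx> v" "Q 3 u v" "\<not> Q 4 u v"
  shows "[0, 1, 0] \<approx> [0, 0, 1]"
proof -
  have main: "[0, 1, 0] \<approx> [0, 0, 1]"
    if uv: "u \<approx> v" and s: "simple u = simple v" "set u = set v"
      and e: "encloses u c t" "\<not> encloses v c t" for u v c t
  proof -
    have ct: "c \<noteq> t" using e by (simp add: encloses_def)
    let ?P = "\<lambda>d. d = c \<or> d = t"
    let ?w = "filter ?P v"
    have w: "[c, t, c] \<approx> ?w" using filter_closed[OF uv, of ?P] e by (simp add: encloses_def)
    have cu: "count_list u c = 2" "count_list u t = 1" using encloses_count e by auto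
    then have vt: "count_list v t = 1" using s unfolding simple_def by blast
    have "c \<in> set u" "c \<notin> simple v"
      using cu s by (auto simp: set_iff_count_list in_simple[of c u] simp flip: s)
    then have vc: "2 \<le> count_list v c" using s by (auto simp: set_iff_count_list in_simple)
    have "t \<in> set ?w" using vt by (simp add: set_iff_count_list)
    then obtain a b where ab: "?w = a @ t # b" by (meson split_list)
    have "count_list ?w t = 1" using vt by (simp add: count_list_filter)
    then have "t \<notin> set a" "t \<notin> set b" using ab by (auto simp: set_iff_count_list)
    moreover have "set ?w \<subseteq> {c, t}" by auto
    ultimately have "set a \<subseteq> {c}" "set b \<subseteq> {c}" using ab by auto
    then obtain i j where ij: "a = replicate i c" "b = replicate j c"
      by (meson replicate_eqI singletonD subsetD)
    have cr: "count_list (replicate k c) c = k" for k by (induction k) auto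
    have "count_list ?w c = count_list v c" by (simp add: count_list_filter)
    then have ijc: "i + j = count_list v c" using ab ij ct cr by auto
    have fw: "filter (\<lambda>d. d \<noteq> c) ?w = [t]" using ab ij ct by simp
    \<comment> \<open>The restriction of \<open>v\<close> consists of \<open>i\<close> letters
      \<open>c\<close>, then \<open>t\<close>, then \<open>j\<close> letters \<open>c\<close>, with
      \<open>i + j\<close> at least two. Three occurrences are pulled out; with two, the only
      arrangement without an adjacent pair would be the excluded \<open>[c, t, c]\<close>.\<close>
    have "?w \<approx> [c, c, t]"
    proof (cases "3 \<le> count_list v c")
      case True
      then have "3 \<le> count_list ?w c" by (simp add: count_list_filter)
      from pull_triple[OF this] show ?thesis unfolding fw .
    next
      case False
      then have "i + j = 2" using vc ijc by simp
      moreover have "\<not> (i = 1 \<and> j = 1)" using e(2) ct ab ij by (auto simp: encloses_def)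
      ultimately consider "i = 2" "j = 0" | "i = 0" "j = 2" by linarith
      then show ?thesis
      proof cases
        case 1
        then show ?thesis using ab ij by (simp add: numeral_2_eq_2)
      next
        case 2
        then have "?w = [t] @ [c, c]" using ab ij by (simp add: numeral_2_eq_2)
        then show ?thesis using square_commute[of "[t]" c "[]"] by simp
      qed
    qed
    then have "[c, t, c] \<approx> [c, c, t]" using w trans by blast
    from subst_closed[OF this, of "\<lambda>i. if i = c then [0] else [1]"] ct
    show ?thesis by simp
  qed
  have s: "simple u = simple v" "set u = set v" using assms(2) by (auto simp: Q_def)
  have "encloses u \<noteq> encloses v" using assms by (auto simp: Q_def)
  then obtain c t where "encloses u c t \<and> \<not> encloses v c t \<or> encloses v c t \<and> \<not> encloses u c t"
    unfolding fun_eq_iff by blast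
  then show ?thesis using main[OF assms(1)] main[OF sym[OF assms(1)]] s by blast
qed

end

lemma before_imp_split:
  assumes "before u c d" "d \<in> set u"
  obtains p q where "u = p @ q" "d \<notin> set p" "c \<notin> set q"
proof -
  obtain p q where pq: "u = p @ d # q" "d \<notin> set p" using assms(2) by (meson split_list_first)
  then have "c \<notin> set (d # q)" using assms(1) by (auto simp: before_append)
  with pq that show ?thesis by blast
qed

lemma append_eq_triple_left: "a @ b = [c, t, d] \<Longrightarrow> d \<notin> set b \<Longrightarrow> a = [c, t, d] \<and> b = []"
  by (auto simp: append_eq_Cons_conv)

lemma append_eq_triple_right: "a @ b = [c, t, d] \<Longrightarrow> c \<notin> set a \<Longrightarrow> a = [] \<and> b = [c, t, d]"
  by (auto simp: append_eq_Cons_conv)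

lemma append_eq_triple_mid:
  "a @ b = [c, t, d] \<Longrightarrow> t \<notin> set b \<Longrightarrow> d \<in> set b \<Longrightarrow> c \<noteq> t \<Longrightarrow> a = [c, t] \<and> b = [d]"
  by (auto simp: append_eq_Cons_conv)

lemma before_self: "c \<in> set u \<Longrightarrow> \<not> before u c c"
  by (induction u) auto

context O_congruence
begin

text \<open>Restrict to \<open>c\<close>, \<open>d\<close> and simple letters \<open>t\<close>,
  \<open>s\<close> enclosed by them. If all \<open>c\<close> precede all \<open>d\<close> in
  \<open>u\<close>, this gives ctcdsd. In \<open>v\<close>, \<open>Q 4\<close> keeps
  \<open>t\<close> before \<open>d\<close> and \<open>c\<close> before \<open>s\<close>, so a
  violation leaves only ctdcsd: the two sides of \<open>sigma3\<close> up to renaming.\<close>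

lemma not_Q5:
  assumes "u \<approx> v" "Q 4 u v" "\<not> Q 5 u v"
  shows "fst sigma3 \<approx> snd sigma3"
proof -
  have main: "fst sigma3 \<approx> snd sigma3"
    if uv: "u \<approx> v" and Q4: "Q 4 u v" and core: "c \<in> core u" "d \<in> core u"
      and bu: "before u c d" and bv: "\<not> before v c d" for u v c d
  proof -
    obtain t s where ts: "encloses u c t" "encloses u d s" using core by (auto simp: core_def)
    then have tsv: "encloses v c t" "encloses v d s" using Q4 by (auto simp: Q_def)
    have cnt: "count_list u c = 2" "count_list u d = 2" "count_list u t = 1" "count_list u s = 1"
      using ts encloses_count by auto
    have "c \<in> set u" "d \<in> set u" using cnt by (auto simp: set_iff_count_list)
    then have du: "d \<in> set u" and dv: "d \<in> set v" using Q4 by (auto simp: Q_def)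
    have cd: "c \<noteq> d" using before_self[OF du] bu by auto
    have ne: "c \<noteq> t" "d \<noteq> s" "c \<noteq> s" "d \<noteq> t" using cnt by auto
    have sim: "t \<in> simple u" "s \<in> simple u" using cnt by (auto simp: in_simple)
    let ?A = "\<lambda>e. e = c \<or> e = t" and ?B = "\<lambda>e. e = d \<or> e = s"
    let ?C = "\<lambda>e. e = c \<or> e = t \<or> e = d \<or> e = s"
    obtain p q where pq: "u = p @ q" "d \<notin> set p" "c \<notin> set q"
      using before_imp_split[OF bu du] .
    have "filter ?A p @ filter ?A q = [c, t, c]" "c \<notin> set (filter ?A q)"
      using ts pq by (auto simp: encloses_def)
    note append_eq_triple_left[OF this]
    then have A: "filter ?A p = [c, t, c]" "filter ?A q = []" by - (erule conjunct1, erule conjunct2)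
    have "filter ?B p @ filter ?B q = [d, s, d]" "d \<notin> set (filter ?B p)"
      using ts pq by (auto simp: encloses_def)
    note append_eq_triple_right[OF this]
    then have B: "filter ?B p = []" "filter ?B q = [d, s, d]" by - (erule conjunct1, erule conjunct2)
    have tq: "t \<notin> set q" using A(2) by (auto simp: filter_empty_conv)
    have sp: "s \<notin> set p" using B(1) by (auto simp: filter_empty_conv)
    have "t \<in> set (filter ?A p)" unfolding A by simp
    then have tns: "t \<noteq> s" using sp by auto
    have "filter ?C p = filter ?A p" using pq sp by (intro filter_cong) auto
    moreover have "filter ?C q = filter ?B q" using pq tq by (intro filter_cong) auto
    ultimately have Cu: "filter ?C u = [c, t, c, d, s, d]" using A B pq by simp
    have "before u t d" "before u c s"
      using pq sp tq by (auto simp: before_append before_notin)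
    then have b: "before v t d" "before v c s"
      using Q_before[OF Q4 core(1) sim(2)] Q_before[OF Q4 core(2) sim(1)] by auto
    obtain p q where pq: "v = p @ q" "d \<notin> set p" "t \<notin> set q"
      using before_imp_split[OF b(1) dv] .
    have cq: "c \<in> set q" using bv pq before_notin[of c q d] by (auto simp: before_append)
    have "filter ?B p @ filter ?B q = [d, s, d]" "d \<notin> set (filter ?B p)"
      using tsv pq by (auto simp: encloses_def)
    note append_eq_triple_right[OF this]
    then have B: "filter ?B p = []" "filter ?B q = [d, s, d]" by - (erule conjunct1, erule conjunct2)
    have sp: "s \<notin> set p" using B(1) by (auto simp: filter_empty_conv)
    have "c \<in> set (filter ?A q)" "t \<notin> set (filter ?A q)" using cq pq by auto
    moreover have "filter ?A p @ filter ?A q = [c, t, c]" using tsv pq by (auto simp: encloses_def)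
    ultimately have "filter ?A p = [c, t] \<and> filter ?A q = [c]"
      using append_eq_triple_mid ne(1) by metis
    then have A: "filter ?A p = [c, t]" "filter ?A q = [c]"
      by - (erule conjunct1, erule conjunct2)
    \<comment> \<open>\<open>G\<close> arises by inserting the second \<open>c\<close> into
      \<open>[d, s, d]\<close>; being before \<open>s\<close> but not before both \<open>d\<close>
      determines the place.\<close>
    define G where "G = filter (\<lambda>e. e = c \<or> e = d \<or> e = s) q"
    have "filter (\<lambda>e. e \<noteq> c) G = filter ?B q"
      unfolding G_def filter_filter using ne cd by (intro filter_cong) auto
    moreover have "count_list G c = count_list (filter ?A q) c"
      by (simp add: G_def count_list_filter)
    ultimately have G: "G \<in> {[c, d, s, d], [d, c, s, d], [d, s, c, d], [d, s, d, c]}"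
      using A B by (intro filter_doubleton_eq) auto
    have bG: "before G a e = before q a e" if "a \<in> {c, d, s}" "e \<in> {c, d, s}" for a e
      unfolding G_def by (rule before_filter) (use that in auto)
    have "before G c s" "\<not> before G c d"
      using bG[of c s] bG[of c d] b(2) bv pq sp by (auto simp: before_append)
    then have G: "G = [d, c, s, d]" using G cd ne by auto
    have "filter ?C p = filter ?A p" using pq sp by (intro filter_cong) auto
    moreover have "filter ?C q = G" unfolding G_def using pq by (intro filter_cong) auto
    ultimately have Cv: "filter ?C v = [c, t, d, c, s, d]" using A G pq by simp
    have "[c, t, c, d, s, d] \<approx> [c, t, d, c, s, d]" using filter_closed[OF uv, of ?C] Cu Cv by simp
    from subst_closed[OF this, of
        "\<lambda>i. if i = c then [0] else if i = d then [1] else if i = t then [2] else [3]"]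
    show ?thesis using ne cd tns by (simp add: sigma3_def)
  qed
  obtain c d where cd: "c \<in> core u" "d \<in> core u" "before u c d \<noteq> before v c d"
    using assms by (auto simp: Q_def)
  then have "c \<in> core v" "d \<in> core v" using Q_core[OF assms(2)] by auto
  then show ?thesis
    using main[OF assms(1,2)] main[OF sym[OF assms(1)] Q_sym[OF assms(2)]] cd by blast
qed

text \<open>At the first violated level, the forced identity already generates a relation that
  contains both sides of \<open>sigma3\<close>. Nothing beyond the identities of \<open>O\<close>
  enters, so this applies to varieties outside \<open>L\<close>.\<close>

lemma sigma3_cases:
  assumes "u \<approx> v" "\<not> Q 5 u v"
  shows "fst sigma3 \<approx> snd sigma3"
proof -
  have Q3: "Q 3 (fst sigma3) (snd sigma3)"
    by (auto simp: Q_def sigma3_def simple_def insert_commute)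
  consider "set u \<noteq> set v" | "set u = set v" "simple u \<noteq> simple v" | "Q 2 u v" "\<not> Q 3 u v"
    | "Q 3 u v" "\<not> Q 4 u v" | "Q 4 u v" "\<not> Q 5 u v"
    using assms(2) Q_def[of 2 u v] by auto
  then show ?thesis
  proof cases
    case 1
    then show ?thesis using not_Q1[OF assms(1)] Q0_le by blast
  next
    case 2
    then show ?thesis using not_Q2[OF assms(1)] Q1_le Q_mono[OF Q3, of 1] by simp
  next
    case 3
    then show ?thesis using not_Q3[OF assms(1)] Q2_le Q_mono[OF Q3, of 2] by simp
  next
    case 4
    then show ?thesis using not_Q4[OF assms(1)] Q3_le[OF _ Q3] by simp
  next
    case 5
    then show ?thesis using not_Q5[OF assms(1)] by simp
  qed
qed

end

text \<open>\<open>collapse\<close> is the combined effect of all w_n identities: a repeated letter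
  that does not enclose a simple letter as the word ctc may be turned into a square in
  front.\<close>

locale L_congruence = O_congruence +
  assumes collapse: "2 \<le> count_list u c \<Longrightarrow> c \<notin> core u \<Longrightarrow> u \<approx> c # c # filter (\<lambda>d. d \<noteq> c) u"
begin

lemma Q_Suc_cases:
  assumes "\<And>u v. u \<approx> v \<Longrightarrow> Q k u v" "\<not> (\<forall>u v. u \<approx> v \<longrightarrow> Q (Suc k) u v)" "k < 5" "Q k u v"
  shows "u \<approx> v"
proof -
  obtain a b where ab: "a \<approx> b" "\<not> Q (Suc k) a b" "Q k a b" using assms(1,2) by blast
  consider "k = 0" | "k = 1" | "k = 2" | "k = 3" | "k = 4" using assms(3) by linarith
  then show ?thesis
  proof cases
    case 1
    then show ?thesis using not_Q1[OF ab(1)] ab Q0_le by (auto simp: Q_def)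
  next
    case 2
    then show ?thesis using not_Q2[OF ab(1)] ab Q1_le assms(4) by (auto simp: Q_def)
  next
    case 3
    then show ?thesis using not_Q3[OF ab(1)] ab Q2_le assms(4) by (simp add: eval_nat_numeral)
  next
    case 4
    then show ?thesis using not_Q4[OF ab(1)] ab Q3_le assms(4) by (simp add: eval_nat_numeral)
  next
    case 5
    then show ?thesis using not_Q5[OF ab(1)] ab Q_normal_form_le[OF collapse, of False] assms(4)
      by (simp add: eval_nat_numeral)
  qed
qed

text \<open>Climb from the full relation \<open>Q 0\<close>: a congruence inside \<open>Q k\<close>
  either lies inside \<open>Q (Suc k)\<close> or contains the identity that makes it equal to
  \<open>Q k\<close>. At level 5 the normal form gives equality.\<close>

lemma eq_Q: "\<exists>k. \<forall>u v. u \<approx> v \<longleftrightarrow> Q k u v"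
proof -
  have "(\<exists>j<k. \<forall>u v. u \<approx> v \<longleftrightarrow> Q j u v) \<or> (\<forall>u v. u \<approx> v \<longrightarrow> Q k u v)" if "k \<le> 5" for k
    using that
  proof (induction k)
    case 0
    show ?case by (simp add: Q_def)
  next
    case (Suc k)
    then show ?case using Q_Suc_cases[of k] less_Suc_eq[of _ k] by (metis Suc_le_lessD Suc_leD)
  qed
  from this[of 5] show ?thesis using Q_normal_form_le[OF collapse, of True] by simp blast
qed

end

section \<open>Collapsing repeated letters\<close>

text \<open>
  The letter \<open>x\<close> is \<open>0\<close>, and the simple letter \<open>t\<^sub>i\<close> next to \<open>z\<^sub>i\<close> is the successor of \<open>z\<^sub>i\<close>.
  Up to renaming, a pair of permutations is a pair of orders \<open>cs\<close>, \<open>ds\<close> of the outer letters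
  \<open>z\<^sub>i\<close> against a list \<open>ps\<close> of the pairs between the two occurrences of \<open>x\<close>.
\<close>

definition pre :: "word \<Rightarrow> word" where
  "pre cs = concat (map (\<lambda>c. [c, Suc c]) cs)"

definition mid :: "(nat \<times> nat) list \<Rightarrow> word" where
  "mid ps = concat (map (\<lambda>(a, b). [a, b]) ps)"

definition suf :: "word \<Rightarrow> word" where
  "suf ds = concat (map (\<lambda>d. [Suc d, d]) ds)"

lemma pre_simps [simp]: "pre [] = []" "pre (c # cs) = c # Suc c # pre cs" "pre (cs @ cs') = pre cs @ pre cs'"
  by (auto simp: pre_def)

lemma mid_simps [simp]: "mid [] = []" "mid ((a, b) # ps) = a # b # mid ps" "mid (ps @ ps') = mid ps @ mid ps'"
  by (auto simp: mid_def)

lemma suf_simps [simp]: "suf [] = []" "suf (c # cs) = Suc c # c # suf cs" "suf (cs @ cs') = suf cs @ suf cs'"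
  by (auto simp: suf_def)

text \<open>One occurrence of every letter of \<open>A\<close> is marked; the gap behind it will be
  the value of the letter t_i next to z_i. This makes \<open>p\<close>, up to \<open>p0\<close>, an
  instance of the prefix of w_n. The mirror image follows.\<close>

lemma split_at_letters_left:
  assumes "A \<subseteq> set p"
  shows "\<exists>cs qs p0. distinct cs \<and> set cs = A \<and> length qs = length cs \<and>
    p = p0 @ concat (map2 (\<lambda>c q. c # q) cs qs)"
  using assms
proof (induction p arbitrary: A)
  case (Cons l p)
  show ?case
  proof (cases "l \<in> A")
    case True
    have "A - {l} \<subseteq> set p" using Cons.prems by auto
    from Cons.IH[OF this] obtain cs qs p0 where "distinct cs" "set cs = A - {l}"
      "length qs = length cs" "p = p0 @ concat (map2 (\<lambda>c q. c # q) cs qs)" by blast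
    moreover from True have "insert l (A - {l}) = A" by (rule insert_Diff)
    ultimately show ?thesis
      by (intro exI[of _ "l # cs"] exI[of _ "p0 # qs"] exI[of _ "[]"]) simp
  next
    case False
    then have "A \<subseteq> set p" using Cons.prems by auto
    from Cons.IH[OF this] obtain cs qs p0 where "distinct cs" "set cs = A"
      "length qs = length cs" "p = p0 @ concat (map2 (\<lambda>c q. c # q) cs qs)" by blast
    then show ?thesis by (intro exI[of _ cs] exI[of _ qs] exI[of _ "l # p0"]) simp
  qed
qed simp

lemma split_at_letters_right:
  assumes "A \<subseteq> set s"
  shows "\<exists>ds rs s0. distinct ds \<and> set ds = A \<and> length rs = length ds \<and>
    s = concat (map2 (\<lambda>r d. r @ [d]) rs ds) @ s0"
  using assms
proof (induction s arbitrary: A)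
  case (Cons l s)
  show ?case
  proof (cases "A = {}")
    case True
    then show ?thesis by (intro exI[of _ "[]"] exI[of _ "l # s"]) simp
  next
    case ne: False
    show ?thesis
    proof (cases "l \<in> A")
      case True
      have "A - {l} \<subseteq> set s" using Cons.prems by auto
      from Cons.IH[OF this] obtain ds rs s0 where "distinct ds" "set ds = A - {l}"
        "length rs = length ds" "s = concat (map2 (\<lambda>r d. r @ [d]) rs ds) @ s0" by blast
      moreover from True have "insert l (A - {l}) = A" by (rule insert_Diff)
      ultimately show ?thesis
        by (intro exI[of _ "l # ds"] exI[of _ "[] # rs"] exI[of _ s0]) simp
    next
      case False
      then have "A \<subseteq> set s" using Cons.prems by auto
      from Cons.IH[OF this] obtain ds rs s0 where *: "distinct ds" "set ds = A"
        "length rs = length ds" "s = concat (map2 (\<lambda>r d. r @ [d]) rs ds) @ s0" by blast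
      then obtain d ds' r rs' where "ds = d # ds'" "rs = r # rs'"
        using ne by (cases ds; cases rs) auto
      then show ?thesis using *
        by (intro exI[of _ ds] exI[of _ "(l # r) # rs'"] exI[of _ s0]) simp
    qed
  qed
qed simp

lemma distinct_count_list: "distinct q \<Longrightarrow> count_list q d \<le> 1"
  by (induction q) (auto simp: count_notin)

lemma distinct_same_set_permutation:
  assumes "distinct as" "distinct cs" "set as = set cs"
  obtains \<pi> where "\<pi> permutes {1..length as}" "\<And>i. i < length as \<Longrightarrow> as ! i = cs ! (\<pi> (Suc i) - 1)"
    "\<And>i. i < length as \<Longrightarrow> 1 \<le> \<pi> (Suc i) \<and> \<pi> (Suc i) \<le> length as"
proof -
  have len: "length as = length cs" using assms by (metis distinct_card)
  have "mset as = mset cs" using assms set_eq_iff_mset_eq_distinct by blast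
  then obtain f where f: "f permutes {..<length cs}" "permute_list f cs = as"
    by (metis mset_eq_permutation)
  \<comment> \<open>Positions in lists start at 0, the permutations of the identities act on
    \<open>{1..n}\<close>; hence the shift by one.\<close>
  define \<pi> where "\<pi> i = (if i = 0 then 0 else Suc (f (i - 1)))" for i
  have inv: "\<pi> permutes {1..length as}"
  proof (rule bij_imp_permutes)
    have b: "bij_betw f {..<length as} {..<length as}" using f len permutes_imp_bij by metis
    show "bij_betw \<pi> {1..length as} {1..length as}"
    proof (rule bij_betwI')
      fix x y assume "x \<in> {1..length as}" "y \<in> {1..length as}"
      then show "(\<pi> x = \<pi> y) = (x = y)" using f(1)
        by (auto simp: \<pi>_def permutes_def dest: permutes_inj[OF f(1), THEN injD])
    next
      fix x assume "x \<in> {1..length as}"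
      then show "\<pi> x \<in> {1..length as}"
        using bij_betwE[OF b] by (auto simp: \<pi>_def Suc_le_eq)
    next
      fix y assume y: "y \<in> {1..length as}"
      then have "y - 1 \<in> f ` {..<length as}" using b by (auto simp: bij_betw_def)
      then obtain x where "x < length as" "f x = y - 1" by auto
      then show "\<exists>x\<in>{1..length as}. y = \<pi> x"
        using y by (intro bexI[of _ "Suc x"]) (auto simp: \<pi>_def)
    qed
    show "x \<notin> {1..length as} \<Longrightarrow> \<pi> x = x" for x
      using permutes_not_in[OF f(1), of "x - 1"] len by (auto simp: \<pi>_def)
  qed
  have "as ! i = cs ! (\<pi> (Suc i) - 1)" if "i < length as" for i
    using f(2) that len by (auto simp: \<pi>_def permute_list_def)
  moreover have "1 \<le> \<pi> (Suc i) \<and> \<pi> (Suc i) \<le> length as" if "i < length as" for i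
    using permutes_in_image[OF inv, of "Suc i"] that by auto
  ultimately show ?thesis using that inv by blast
qed

lemma subst_concat: "subst \<theta> (concat ws) = concat (map (subst \<theta>) ws)"
  by (induction ws) auto

lemma map2_conv_upt:
  "length xs = n \<Longrightarrow> length ys = n \<Longrightarrow> map2 f xs ys = map (\<lambda>i. f (xs ! i) (ys ! i)) [0..<n]"
  by (rule nth_equalityI) auto

context fully_invariant
begin

definition w_identities :: "nat \<Rightarrow> bool" where
  "w_identities n \<longleftrightarrow>
     (\<forall>\<pi> \<tau>. \<pi> permutes {1..n} \<longrightarrow> \<tau> permutes {1..n} \<longrightarrow> word_w n \<pi> \<tau> \<approx> word_w' n \<pi> \<tau>)"

text \<open>The form in which w_n identities are used: any context with one component of each pair
  to the left and the other to the right. The letters t_i absorb whatever stands between the chosen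
  occurrences.\<close>

lemma w_identity_apply:
  assumes w: "w_identities n" and len: "length ps = n"
    and dist: "distinct (map fst ps)" "distinct (map snd ps)"
    and sub: "set (map fst ps) \<subseteq> set p" "set (map snd ps) \<subseteq> set s"
  shows "p @ c # mid ps @ c # s \<approx> p @ c # c # mid ps @ s"
proof -
  obtain cs qs p0 where cs: "distinct cs" "set cs = set (map fst ps)" "length qs = length cs"
    and p: "p = p0 @ concat (map2 (\<lambda>c q. c # q) cs qs)"
    using split_at_letters_left[OF sub(1)] by blast
  obtain ds rs s0 where ds: "distinct ds" "set ds = set (map snd ps)" "length rs = length ds"
    and s: "s = concat (map2 (\<lambda>r d. r @ [d]) rs ds) @ s0"
    using split_at_letters_right[OF sub(2)] by blast
  obtain \<pi> where \<pi>: "\<pi> permutes {1..n}" "\<And>i. i < n \<Longrightarrow> fst (ps ! i) = cs ! (\<pi> (Suc i) - 1)"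
    "\<And>i. i < n \<Longrightarrow> 1 \<le> \<pi> (Suc i) \<and> \<pi> (Suc i) \<le> n"
    using distinct_same_set_permutation[OF dist(1) cs(1) cs(2)[symmetric]] len by auto
  obtain \<tau> where \<tau>: "\<tau> permutes {1..n}" "\<And>i. i < n \<Longrightarrow> snd (ps ! i) = ds ! (\<tau> (Suc i) - 1)"
    "\<And>i. i < n \<Longrightarrow> 1 \<le> \<tau> (Suc i) \<and> \<tau> (Suc i) \<le> n"
    using distinct_same_set_permutation[OF dist(2) ds(1) ds(2)[symmetric]] len by auto
  have lens: "length cs = n" "length qs = n" "length ds = n" "length rs = n"
    using cs ds dist len by (metis distinct_card length_map)+
  \<comment> \<open>\<open>l div 2 - 1\<close> recovers the index \<open>i\<close> from both
    \<open>lz i\<close> and \<open>lt i\<close>, and parity tells these apart. Indices up to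
    \<open>n\<close> belong to the prefix, larger ones to the suffix.\<close>
  define \<theta> where "\<theta> l = (if l = 0 then [c] else
    let i = l div 2 - 1 in
      if even l then (if i \<le> n then [cs ! (i - 1)] else [ds ! (i - n - 1)])
      else (if i \<le> n then qs ! (i - 1) else rs ! (i - n - 1)))" for l
  have \<theta>: "\<theta> (lz i) = (if i \<le> n then [cs ! (i - 1)] else [ds ! (i - n - 1)])"
    "\<theta> (lt i) = (if i \<le> n then qs ! (i - 1) else rs ! (i - n - 1))" "\<theta> lx = [c]" for i
  proof -
    have "lt i div 2 = Suc i" "odd (lt i)" by (auto simp: lt_def)
    then show "\<theta> (lt i) = (if i \<le> n then qs ! (i - 1) else rs ! (i - n - 1))"
      by (auto simp: \<theta>_def lt_def Let_def)
  qed (auto simp: \<theta>_def lz_def lx_def Let_def)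
  have up: "[1..<n + 1] = map Suc [0..<n]" "[n + 1..<2 * n + 1] = map (\<lambda>i. n + Suc i) [0..<n]"
    by (simp add: map_Suc_upt del: upt_Suc) (rule nth_equalityI; simp del: upt_Suc)
  have pre: "subst \<theta> (concat (map (\<lambda>i. [lz i, lt i]) [1..<n + 1])) = concat (map2 (\<lambda>c q. c # q) cs qs)"
    unfolding map2_conv_upt[OF lens(1,2)] subst_concat up
    by (rule arg_cong[of _ _ concat]) (simp add: \<theta> comp_def)
  have suf: "subst \<theta> (concat (map (\<lambda>i. [lt i, lz i]) [n + 1..<2 * n + 1])) =
      concat (map2 (\<lambda>r d. r @ [d]) rs ds)"
    unfolding map2_conv_upt[OF lens(4,3)] subst_concat up
    by (rule arg_cong[of _ _ concat]) (simp add: \<theta> comp_def)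
  have ps: "ps = map (\<lambda>i. (fst (ps ! i), snd (ps ! i))) [0..<n]"
    using len by (auto intro: nth_equalityI)
  have "subst \<theta> (concat (map (\<lambda>i. [lz (\<pi> i), lz (n + \<tau> i)]) [1..<n + 1])) =
      concat (map (\<lambda>i. [fst (ps ! i), snd (ps ! i)]) [0..<n])"
    unfolding subst_concat up
    by (rule arg_cong[of _ _ concat]) (use \<pi>(2,3) \<tau>(2,3) in \<open>force simp: \<theta>\<close>)
  also have "\<dots> = mid ps" by (subst (3) ps) (simp add: mid_def comp_def case_prod_beta)
  finally have mid: "subst \<theta> (concat (map (\<lambda>i. [lz (\<pi> i), lz (n + \<tau> i)]) [1..<n + 1])) = mid ps" .
  have "word_w n \<pi> \<tau> \<approx> word_w' n \<pi> \<tau>" using w \<pi> \<tau> by (simp add: w_identities_def)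
  from context_closed[OF subst_closed[OF this, of \<theta>], of p0 s0] show ?thesis
    unfolding word_w_def word_w'_def subst_simps pre suf mid p s by (simp add: \<theta>)
qed

text \<open>
  Each letter of \<open>q\<close> is paired with a fresh letter, so that \<open>w_identity_apply\<close> fits; the fresh
  letters are deleted afterwards.
\<close>

lemma fresh_gap:
  assumes w: "w_identities (length q)" and q: "distinct q" "set q \<subseteq> set p \<union> set s"
  shows "p @ c # q @ c # s \<approx> p @ c # c # q @ s"
proof -
  obtain N where N: "\<And>l. l \<in> set (p @ c # q @ s) \<Longrightarrow> l < N"
    by (meson finite_nat_set_iff_bounded List.finite_set)
  define ps where "ps = map (\<lambda>l. if l \<in> set p then (l, N + l) else (N + l, l)) q"
  define F where "F = map (\<lambda>l. N + l) q"
  have ne: "N + l \<noteq> l'" if "l' \<in> set q" for l l' using N[of l'] that by auto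
  have dist: "distinct (map fst ps)" "distinct (map snd ps)"
    using q(1) ne by (auto simp: ps_def distinct_map inj_on_def split: if_splits) 
  \<comment> \<open>A letter found in \<open>p\<close> needs its fresh partner on the right, any
    other one needs it on the left; \<open>F\<close> on both sides serves both.\<close>
  have "(F @ p) @ c # mid ps @ c # (s @ F) \<approx> (F @ p) @ c # c # mid ps @ (s @ F)"
  proof (rule w_identity_apply[OF w _ dist])
    show "set (map fst ps) \<subseteq> set (F @ p)" "set (map snd ps) \<subseteq> set (s @ F)"
      using q(2) by (auto simp: ps_def F_def)
  qed (simp add: ps_def)
  moreover define \<theta> where "\<theta> l = (if l < N then [l] else [])" for l
  ultimately have "subst \<theta> ((F @ p) @ c # mid ps @ c # (s @ F)) \<approx>
      subst \<theta> ((F @ p) @ c # c # mid ps @ (s @ F))" by (intro subst_closed)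
  moreover have "subst \<theta> w = w" if "set w \<subseteq> set (p @ c # q @ s)" for w
    using that N by (intro subst_id) (auto simp: \<theta>_def)
  from this[of p] this[of s] have "subst \<theta> p = p" "subst \<theta> s = s" by auto
  moreover have "subst \<theta> F = []" by (simp add: F_def subst_def \<theta>_def comp_def)
  moreover have "subst \<theta> (mid ps) = q"
  proof -
    have "\<forall>l\<in>set q. l < N" using N by auto
    then show ?thesis unfolding ps_def
      by (induction q) (auto simp: \<theta>_def)
  qed
  moreover have "\<theta> c = [c]" using N by (simp add: \<theta>_def)
  ultimately show ?thesis by simp
qed

end

context O_congruence
begin

text \<open>A further \<open>c\<close> in the gap is handled by \<open>triple\<close>, and a gap of
  distinct letters by \<open>fresh_gap\<close>. The remaining obstacle is a letter that occurs twice
  inside the gap, which has a shorter gap of its own.\<close>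

lemma gap_collapse:
  assumes w: "\<And>n. w_identities n" and "\<And>d. d \<in> set q \<Longrightarrow> 2 \<le> count_list (p @ c # q @ c # s) d"
  shows "p @ c # q @ c # s \<approx> p @ c # c # q @ s"
  using assms(2)
proof (induction "length q" arbitrary: p c q s rule: less_induct)
  case less
  consider "c \<in> set q" | "\<not> distinct q" | "c \<notin> set q" "distinct q" by blast
  then show ?case
  proof cases
    case 1
    then obtain q1 q2 where q: "q = q1 @ c # q2" by (meson split_list)
    have "p @ c # q1 @ c # q2 @ c # s \<approx> p @ c # c # q1 @ q2 @ s" by (rule triple)
    also have "\<dots> \<approx> p @ c # c # q1 @ c # q2 @ s"
      using sym[OF triple[of p c "[]" q1 "q2 @ s"]] by simp
    finally show ?thesis by (simp add: q)
  next
    case 2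
    then obtain q1 d q2 q3 where q: "q = q1 @ [d] @ q2 @ [d] @ q3"
      using not_distinct_decomp by blast
    \<comment> \<open>\<open>a\<close> turns \<open>d\<close> into a square, which moves out of the
      way; \<open>m\<close> closes the gap of \<open>c\<close>, now shorter by two letters; after
      the square has moved back, \<open>b\<close> undoes the effect of \<open>a\<close>.\<close>
    have a: "(p @ c # q1) @ d # q2 @ d # (q3 @ c # s) \<approx> (p @ c # q1) @ d # d # q2 @ (q3 @ c # s)"
      using less.prems q by (intro less.hyps) (auto simp: Suc_le_eq)
    have b: "(p @ c # c # q1) @ d # q2 @ d # (q3 @ s) \<approx> (p @ c # c # q1) @ d # d # q2 @ (q3 @ s)"
      using less.prems q by (intro less.hyps) force+
    have m: "(d # d # p) @ c # (q1 @ q2 @ q3) @ c # s \<approx> (d # d # p) @ c # c # (q1 @ q2 @ q3) @ s"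
      using less.prems q by (intro less.hyps) force+
    have "p @ c # q @ c # s \<approx> (p @ c # q1) @ d # d # (q2 @ q3 @ c # s)" using a by (simp add: q)
    also have "\<dots> \<approx> d # d # (p @ c # q1) @ (q2 @ q3 @ c # s)" by (rule square_commute)
    also have "\<dots> \<approx> d # d # (p @ c # c # q1) @ (q2 @ q3 @ s)" using m by simp
    also have "\<dots> \<approx> (p @ c # c # q1) @ d # d # (q2 @ q3 @ s)" by (rule sym[OF square_commute])
    also have "\<dots> \<approx> p @ c # c # q @ s" using sym[OF b] by (simp add: q)
    finally show ?thesis .
  next
    case 3
    have "set q \<subseteq> set p \<union> set s"
    proof
      fix d assume d: "d \<in> set q"
      have "count_list q d \<le> 1" by (rule distinct_count_list[OF 3(2)])
      moreover have "d \<noteq> c" using d 3 by auto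
      then have "2 \<le> count_list p d + count_list q d + count_list s d"
        using less.prems[OF d] by (auto split: if_splits)
      ultimately have "0 < count_list p d + count_list s d" by linarith
      then show "d \<in> set p \<union> set s" by (auto simp: set_iff_count_list)
    qed
    then show ?thesis using fresh_gap[OF w] 3 by blast
  qed
qed

text \<open>If \<open>c\<close> occurs exactly twice and is not in the core, then no letter between
  its occurrences is simple, since it would be enclosed. So \<open>gap_collapse\<close>
  applies.\<close>

lemma L_congruenceI:
  assumes w: "\<And>n. w_identities n"
  shows "L_congruence (\<approx>)"
proof
  fix u c assume c: "2 \<le> count_list u c" "c \<notin> core u"
  show "u \<approx> c # c # filter (\<lambda>d. d \<noteq> c) u"
  proof (cases "3 \<le> count_list u c")
    case True
    then show ?thesis by (rule pull_triple)
  next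
    case False
    have "c \<in> set u" using c by (simp add: set_iff_count_list)
    then obtain p u1 where u1: "u = p @ c # u1" "c \<notin> set p" by (meson split_list_first)
    with c have "c \<in> set u1" by (auto simp: set_iff_count_list)
    then obtain q s where s: "u1 = q @ c # s" "c \<notin> set q" by (meson split_list_first)
    then have cs: "c \<notin> set s" using False u1 by (auto simp: set_iff_count_list)
    have "p @ c # q @ c # s \<approx> p @ c # c # q @ s"
    proof (rule gap_collapse[OF w])
      fix d assume d: "d \<in> set q"
      then obtain q1 q2 where q: "q = q1 @ d # q2" by (meson split_list)
      have dc: "d \<noteq> c" using d s by auto
      show "2 \<le> count_list (p @ c # q @ c # s) d"
      proof (rule ccontr)
        assume "\<not> 2 \<le> count_list (p @ c # q @ c # s) d"
        then have "d \<notin> set p" "d \<notin> set q1" "d \<notin> set q2" "d \<notin> set s"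
          using q dc by (auto simp: set_iff_count_list)
        then have "filter (\<lambda>e. e = c \<or> e = d) p = []" "filter (\<lambda>e. e = c \<or> e = d) s = []"
          "filter (\<lambda>e. e = c \<or> e = d) q1 = []" "filter (\<lambda>e. e = c \<or> e = d) q2 = []"
          using u1 s cs q by (auto simp: filter_empty_conv)
        then have "encloses u c d" using dc u1 s q by (simp add: encloses_def)
        then show False using c by (auto simp: core_def)
      qed
    qed
    also have "\<dots> \<approx> c # c # filter (\<lambda>d. d \<noteq> c) (p @ q @ s)" by (rule pull_square)
    finally show ?thesis by (simp add: u1 s)
  qed
qed

end

lemma derives_O_congruence: "(\<And>u v. (u, v) \<in> identities_O \<Longrightarrow> derives \<Sigma> u v) \<Longrightarrow> O_congruence (derives \<Sigma>)"
  using derives_fully_invariant by (simp add: O_congruence_def O_congruence_axioms_def)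

lemma derives_L_congruence:
  assumes "\<And>u v. (u, v) \<in> identities_L \<Longrightarrow> derives \<Sigma> u v"
  shows "L_congruence (derives \<Sigma>)"
proof -
  interpret O_congruence "derives \<Sigma>"
    by (rule derives_O_congruence) (use assms in \<open>simp add: identities_L_def\<close>)
  have "w_identities n" for n
    unfolding w_identities_def using assms unfolding identities_L_def by blast
  then show ?thesis by (rule L_congruenceI)
qed

section \<open>The words \<open>w\<^sub>n(\<pi>, \<tau>)\<close>\<close>

definition w_word :: "word \<Rightarrow> (nat \<times> nat) list \<Rightarrow> word \<Rightarrow> word" where
  "w_word cs ps ds = pre cs @ 0 # mid ps @ 0 # suf ds"

definition w_word' :: "word \<Rightarrow> (nat \<times> nat) list \<Rightarrow> word \<Rightarrow> word" where
  "w_word' cs ps ds = pre cs @ 0 # 0 # mid ps @ suf ds"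

text \<open>Evenness keeps the letters z_i apart from their successors t_i; positivity keeps them
  apart from \<open>x\<close>.\<close>

locale w_data =
  fixes cs :: word and ps :: "(nat \<times> nat) list" and ds :: word
  assumes distinct: "distinct cs" "distinct ds" "distinct (map fst ps)" "distinct (map snd ps)"
    and disjoint: "set cs \<inter> set ds = {}"
    and sets: "set (map fst ps) = set cs" "set (map snd ps) = set ds"
    and even_letter: "c \<in> set cs \<union> set ds \<Longrightarrow> even c"
    and pos_letter: "c \<in> set cs \<union> set ds \<Longrightarrow> 0 < c"

lemma set_pre: "set (pre cs) = set cs \<union> Suc ` set cs"
  by (induction cs) auto

lemma set_suf: "set (suf cs) = set cs \<union> Suc ` set cs"
  by (induction cs) auto

lemma set_mid: "set (mid ps) = set (map fst ps) \<union> set (map snd ps)"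
  by (auto simp: mid_def case_prod_beta)

lemma count_pre: "count_list (pre cs) l = count_list cs l + count_list (map Suc cs) l"
  by (induction cs) auto

lemma count_suf: "count_list (suf cs) l = count_list cs l + count_list (map Suc cs) l"
  by (induction cs) auto

lemma count_mid: "count_list (mid ps) l = count_list (map fst ps) l + count_list (map snd ps) l"
  by (induction ps) auto

lemma count_list_distinct: "distinct xs \<Longrightarrow> count_list xs l = (if l \<in> set xs then 1 else 0)"
  by (induction xs) (auto simp: count_notin)

text \<open>A cut inside a pair would make \<open>y\<close> start with a second component.\<close>

lemma mid_split_hd:
  assumes "mid ps = x @ y" "y \<noteq> []" "hd y \<notin> set (map snd ps)"
  shows "\<exists>p1 p2. ps = p1 @ p2 \<and> x = mid p1 \<and> y = mid p2"
  using assms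
proof (induction ps arbitrary: x)
  case (Cons ab ps)
  obtain a b where ab: "ab = (a, b)" by (cases ab)
  consider "x = []" | "x = [a]" "y = b # mid ps" | x' where "x = a # b # x'" "mid ps = x' @ y"
    using Cons.prems(1) ab by (auto simp: Cons_eq_append_conv)
  then show ?case
  proof cases
    case 1
    then show ?thesis using Cons.prems by (intro exI[of _ "[]"] exI[of _ "ab # ps"]) simp
  next
    case 2
    then show ?thesis using Cons.prems ab by simp
  next
    case 3
    then obtain p1 p2 where "ps = p1 @ p2" "x' = mid p1" "y = mid p2"
      using Cons.IH[of x'] Cons.prems by auto
    then show ?thesis using 3 ab by (intro exI[of _ "ab # p1"] exI[of _ p2]) simp
  qed
qed simp

lemma mid_split_last:
  assumes "mid ps = x @ y" "x \<noteq> []" "last x \<notin> set (map fst ps)"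
  shows "\<exists>p1 p2. ps = p1 @ p2 \<and> x = mid p1 \<and> y = mid p2"
  using assms
proof (induction ps arbitrary: x)
  case (Cons ab ps)
  obtain a b where ab: "ab = (a, b)" by (cases ab)
  consider "x = [a]" | x' where "x = a # b # x'" "mid ps = x' @ y"
    using Cons.prems(1,2) ab by (auto simp: Cons_eq_append_conv)
  then show ?case
  proof cases
    case 1
    then show ?thesis using Cons.prems ab by simp
  next
    case 2
    show ?thesis
    proof (cases "x' = []")
      case True
      then show ?thesis using 2 ab by (intro exI[of _ "[ab]"] exI[of _ ps]) simp
    next
      case False
      then obtain p1 p2 where "ps = p1 @ p2" "x' = mid p1" "y = mid p2"
        using Cons.IH[of x'] Cons.prems 2 by auto
      then show ?thesis using 2 ab by (intro exI[of _ "ab # p1"] exI[of _ p2]) simp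
    qed
  qed
qed simp

lemma pre_factor: "pre cs = x @ y @ z \<Longrightarrow> set y \<inter> Suc ` set cs = {} \<Longrightarrow> length y \<le> 1"
proof (induction cs arbitrary: x)
  case (Cons c cs)
  consider "x = []" | "x = [c]" | x' where "x = c # Suc c # x'" "pre cs = x' @ y @ z"
    using Cons.prems(1) by (auto simp: Cons_eq_append_conv)
  then show ?case
    using Cons.prems Cons.IH by cases (auto simp: Cons_eq_append_conv)
qed simp

lemma suf_factor: "suf cs = x @ y @ z \<Longrightarrow> set y \<inter> Suc ` set cs = {} \<Longrightarrow> length y \<le> 1"
proof (induction cs arbitrary: x)
  case (Cons c cs)
  consider "x = []" | "x = [Suc c]" | x' where "x = Suc c # c # x'" "suf cs = x' @ y @ z"
    using Cons.prems(1) by (auto simp: Cons_eq_append_conv)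
  then show ?case
  proof cases
    case 2
    then have y: "y @ z = c # suf cs" using Cons.prems by simp
    show ?thesis
    proof (cases cs)
      case Nil
      then show ?thesis using y by (auto simp: append_eq_Cons_conv)
    next
      case (Cons c' cs')
      then show ?thesis using y \<open>set y \<inter> Suc ` set (c # cs) = {}\<close>
        by (auto simp: append_eq_Cons_conv)
    qed
  qed (use Cons.prems Cons.IH in \<open>auto simp: Cons_eq_append_conv\<close>)
qed simp

lemma alternating_Cons:
  "h \<notin> D \<Longrightarrow> alternating D A (h # s) \<longleftrightarrow> alternating D (insert h A) s"
  by (cases s) auto

lemma alternating_pre:
  "Suc ` set cs \<inter> D = {} \<Longrightarrow>
    alternating D A (pre cs @ s) \<longleftrightarrow> alternating D (A \<union> set (pre cs)) s"
proof (induction cs arbitrary: A)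
  case (Cons c cs)
  have "alternating D A (pre (c # cs) @ s) \<longleftrightarrow> alternating D (insert (Suc c) (insert c A)) (pre cs @ s)"
    using Cons.prems by (simp add: alternating_Cons)
  also have "\<dots> \<longleftrightarrow> alternating D (insert (Suc c) (insert c A) \<union> set (pre cs)) s"
    using Cons.prems by (intro Cons.IH) auto
  also have "insert (Suc c) (insert c A) \<union> set (pre cs) = A \<union> set (pre (c # cs))" by auto
  finally show ?case .
qed simp

lemma alternating_suf: "Suc ` set ds \<inter> D = {} \<Longrightarrow> alternating D A (suf ds)"
proof (induction ds arbitrary: A)
  case (Cons d ds)
  then show ?case by (cases ds) (auto simp: alternating_Cons)
qed simp

text \<open>First components lie in \<open>A\<close>, so they are second occurrences here, while
  second components are first occurrences; in \<open>mid ps\<close> the two kinds take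
  turns.\<close>

lemma alternating_mid:
  assumes "set (map fst ps) \<subseteq> A" "set (map snd ps) \<inter> A = {}"
    "set (map fst ps) \<inter> set (map snd ps) = {}" "distinct (map snd ps)"
    "s = [] \<or> hd s \<notin> D" "\<And>A. alternating D A s"
  shows "alternating D A (mid ps @ s)"
  using assms(1-4)
proof (induction ps arbitrary: A)
  case Nil
  show ?case using assms(6) by simp
next
  case (Cons ab ps)
  obtain a b where ab: "ab = (a, b)" by (cases ab)
  have IH: "alternating D (insert b (insert a A)) (mid ps @ s)"
    using Cons.prems ab by (intro Cons.IH) auto
  show ?case
  proof (cases "mid ps @ s")
    case Nil
    then show ?thesis using Cons.prems ab by auto
  next
    case (Cons e u)
    have "\<not> (b \<in> D \<and> e \<in> D \<and> (b \<in> insert a A \<longleftrightarrow> e \<in> insert a A))"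
    proof (cases ps)
      case Nil
      then show ?thesis using Cons assms(5) by auto
    next
      case (Cons ab' ps')
      then show ?thesis using \<open>mid ps @ s = e # u\<close> Cons.prems ab by (cases ab') auto
    qed
    then show ?thesis using IH Cons Cons.prems ab by simp
  qed
qed

lemma split_first_unique:
  "a @ x # b = a' @ x # b' \<Longrightarrow> x \<notin> set a \<Longrightarrow> x \<notin> set a' \<Longrightarrow> a' = a \<and> b' = b"
  by (auto simp: append_eq_append_conv2 Cons_eq_append_conv append_eq_Cons_conv)

lemma filter_count_list_empty: "count_list u a = 0 \<Longrightarrow> count_list u b = 0 \<Longrightarrow> filter (\<lambda>d. d = a \<or> d = b) u = []"
  by (auto simp: filter_empty_conv set_iff_count_list)

context w_data
begin

lemmas w_data_simps = distinct(1,2) disjoint sets distinct(3,4) even_letter pos_letter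

lemma Suc_notin: "c \<in> set cs \<union> set ds \<Longrightarrow> Suc c \<notin> set cs \<union> set ds"
  using w_data_simps(8) by (metis even_Suc)

lemma count_w:
  "count_list (pre cs) l = (if l \<in> set cs \<union> Suc ` set cs then 1 else 0)"
  "count_list (suf ds) l = (if l \<in> set ds \<union> Suc ` set ds then 1 else 0)"
  "count_list (mid ps) l = (if l \<in> set cs \<union> set ds then 1 else 0)"
proof -
  note d = count_list_distinct
  show "count_list (pre cs) l = (if l \<in> set cs \<union> Suc ` set cs then 1 else 0)"
    using Suc_notin by (auto simp: count_pre d w_data_simps distinct_map)
  show "count_list (suf ds) l = (if l \<in> set ds \<union> Suc ` set ds then 1 else 0)"
    using Suc_notin by (auto simp: count_suf d w_data_simps distinct_map)
  show "count_list (mid ps) l = (if l \<in> set cs \<union> set ds then 1 else 0)"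
    using w_data_simps(3) unfolding count_mid d[OF w_data_simps(6)] d[OF w_data_simps(7)]
      w_data_simps(4,5) by auto
qed

lemma set_w_parts: "set (pre cs) = set cs \<union> Suc ` set cs" "set (suf ds) = set ds \<union> Suc ` set ds"
  "set (mid ps) = set cs \<union> set ds"
  using w_data_simps(4,5) by (simp_all only: set_pre set_suf set_mid)

text \<open>The word w_n with \<open>x\<close> deleted. Every z_i encloses its successor and is thus
  in the core; by \<open>Q5_core_part\<close>, no other word is related to this one by
  \<open>Q 5\<close>.\<close>

definition "core_part = pre cs @ mid ps @ suf ds"

lemma count_core_part:
  "count_list core_part l =
     (if l \<in> set cs \<union> set ds then 2 else if l \<in> Suc ` (set cs \<union> set ds) then 1 else 0)"
proof -
  have "l \<in> set cs \<union> set ds \<Longrightarrow> l \<notin> Suc ` (set cs \<union> set ds)" using Suc_notin by auto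
  moreover have "l \<in> Suc ` set cs \<Longrightarrow> l \<notin> Suc ` set ds" using w_data_simps(3) by auto
  ultimately show ?thesis
    using w_data_simps(3) by (auto simp: core_part_def count_w)
qed

lemma set_core_part: "set core_part = (set cs \<union> set ds) \<union> Suc ` (set cs \<union> set ds)"
  by (auto simp: core_part_def set_w_parts)

lemma zero_notin_core_part: "0 \<notin> set core_part"
  using w_data_simps(9) by (auto simp: set_core_part)

lemma core_core_part: "core core_part = set cs \<union> set ds"
proof (rule Set.set_eqI)
  fix c
  show "c \<in> core core_part \<longleftrightarrow> c \<in> set cs \<union> set ds"
  proof
    assume "c \<in> core core_part"
    then have "count_list core_part c = 2" by (rule core_count)
    then show "c \<in> set cs \<union> set ds" by (auto simp: count_core_part split: if_splits)
  next
    let ?P = "\<lambda>d. d = c \<or> d = Suc c"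
    assume c: "c \<in> set cs \<union> set ds"
    then have "c \<in> set (mid ps)" by (simp add: set_w_parts)
    then obtain m1 m2 where m: "mid ps = m1 @ c # m2" by (meson split_list)
    have "count_list (mid ps) c = 1" "count_list (mid ps) (Suc c) = 0"
      using c Suc_notin[OF c] by (auto simp: count_w)
    then have fm: "filter ?P (mid ps) = [c]"
      using filter_count_list_empty[of m1 c "Suc c"] filter_count_list_empty[of m2 c "Suc c"]
      by (simp add: m)
    have "filter ?P core_part = [c, Suc c, c]"
    proof (cases "c \<in> set cs")
      case True
      then obtain c1 c2 where cs: "cs = c1 @ c # c2" by (meson split_list)
      have "count_list (pre cs) c = 1" "count_list (pre cs) (Suc c) = 1"
        using True by (auto simp: count_w)
      then have "filter ?P (pre cs) = [c, Suc c]"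
        using filter_count_list_empty[of "pre c1" c "Suc c"] filter_count_list_empty[of "pre c2" c "Suc c"]
        by (simp add: cs)
      moreover have "filter ?P (suf ds) = []"
        using True Suc_notin[of c] Suc_notin w_data_simps(3) by (intro filter_count_list_empty) (auto simp: count_w)
      ultimately show ?thesis by (simp add: core_part_def fm)
    next
      case False
      then have d: "c \<in> set ds" using c by auto
      then obtain d1 d2 where ds: "ds = d1 @ c # d2" by (meson split_list)
      have "count_list (suf ds) c = 1" "count_list (suf ds) (Suc c) = 1"
        using d by (auto simp: count_w)
      then have "filter ?P (suf ds) = [Suc c, c]"
        using filter_count_list_empty[of "suf d1" c "Suc c"] filter_count_list_empty[of "suf d2" c "Suc c"]
        by (simp add: ds)
      moreover have "filter ?P (pre cs) = []"
        using False d Suc_notin[of c] Suc_notin w_data_simps(3) by (intro filter_count_list_empty) (auto simp: count_w)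
      ultimately show ?thesis by (simp add: core_part_def fm)
    qed
    then have "encloses core_part c (Suc c)" by (simp add: encloses_def)
    then show "c \<in> core core_part" by (auto simp: core_def)
  qed
qed

lemma simple_core_part: "simple core_part = Suc ` (set cs \<union> set ds)"
  using Suc_notin by (auto simp: simple_def count_core_part)

lemma alternating_core_part: "alternating (set cs \<union> set ds) {} core_part"
proof -
  let ?D = "set cs \<union> set ds"
  have S: "Suc ` set cs \<inter> ?D = {}" "Suc ` set ds \<inter> ?D = {}" using Suc_notin by auto
  have "suf ds = [] \<or> hd (suf ds) \<notin> ?D" using Suc_notin by (cases ds) auto
  then have "alternating ?D (set (pre cs)) (mid ps @ suf ds)"
    using S w_data_simps(3-7) alternating_suf[OF S(2)] Suc_notin
    by (intro alternating_mid) (simp_all only: set_w_parts, auto)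
  then show ?thesis using alternating_pre[OF S(1)] by (simp add: core_part_def)
qed

lemma Q5_core_part:
  assumes Q: "Q 5 core_part v"
  shows "v = core_part"
proof -
  have Q4: "Q 4 core_part v" using Q Q_mono by simp
  have setv: "set v = set core_part" "simple v = simple core_part" using Q4 by (auto simp: Q_def)
  have core: "core v = core core_part" using Q_core[OF Q4] by simp
  have "count_list ([] @ core_part) c = count_list ([] @ v) c" for c
  proof -
    consider "c \<in> core core_part" | "c \<in> simple core_part" | "c \<notin> set core_part"
      unfolding core_core_part simple_core_part set_core_part by blast
    then show ?thesis
    proof cases
      case 1
      then show ?thesis using core core_count by auto
    next
      case 2
      then show ?thesis using setv by (metis append_Nil in_simple)
    next
      case 3
      then show ?thesis using setv by (simp add: count_notin)
    qed
  qed
  moreover have "same_order True (set cs \<union> set ds) ([] @ core_part) ([] @ v)"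
    unfolding same_order_def append_Nil
  proof (intro allI impI)
    fix c d assume "c \<in> set core_part" "d \<in> set core_part"
    then have "c \<in> core core_part \<union> simple core_part" "d \<in> core core_part \<union> simple core_part"
      unfolding core_core_part simple_core_part set_core_part by auto
    moreover have "Q 3 core_part v" using Q Q_mono by simp
    moreover have "\<forall>c\<in>core core_part. \<forall>d\<in>core core_part. before core_part c d = before v c d"
      using Q by (simp add: Q_def)
    ultimately show "before core_part c d = before v c d"
      using Q_before[OF Q4] Q_before_simple by blast
  qed
  moreover have "alternating (set cs \<union> set ds) (set []) core_part"
    using alternating_core_part by simp
  moreover have "count_list ([] @ core_part) c \<le> 2"
    "c \<in> set cs \<union> set ds \<longleftrightarrow> count_list ([] @ core_part) c = 2" for c
    by (simp_all add: count_core_part)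
  ultimately show ?thesis
    using alternating_rigid[of "[]" core_part v "set cs \<union> set ds"] by blast
qed

text \<open>No letter occurs twice within the prefix or within the suffix. As the head of
  \<open>q\<close> has occurred before and its last letter recurs, both ends lie in the middle part,
  the head being a first component and the last letter a second one, so both cuts respect the
  pairs.\<close>

lemma gap_location:
  assumes U: "core_part = p @ q @ s" and q: "q \<noteq> []" "hd q \<in> set p" "last q \<in> set s"
    and E: "set q \<subseteq> set cs \<union> set ds"
  shows "\<exists>p1 p2 p3. ps = p1 @ p2 @ p3 \<and> p = pre cs @ mid p1 \<and> q = mid p2 \<and> s = mid p3 @ suf ds"
proof -
  have hE: "hd q \<in> set cs \<union> set ds" "last q \<in> set cs \<union> set ds" using E q(1) hd_in_set[of q] last_in_set[of q] by blast+
  have le1: "count_list (pre cs) l \<le> 1" "count_list (suf ds) l \<le> 1" "count_list (mid ps) l \<le> 1" for l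
    by (simp_all add: count_w)
  have two: "\<not> (l \<in> set x \<and> l \<in> set y)" if "count_list (x @ y) l \<le> 1" for l and x y :: word
    using that by (auto simp: set_iff_count_list)
  have "p @ (q @ s) = pre cs @ (mid ps @ suf ds)" using U by (simp add: core_part_def)
  then obtain us where "p = pre cs @ us \<and> us @ q @ s = mid ps @ suf ds \<or>
      p @ us = pre cs \<and> q @ s = us @ mid ps @ suf ds"
    unfolding append_eq_append_conv2 by blast
  moreover have "us = []" if "p @ us = pre cs" "q @ s = us @ mid ps @ suf ds"
  proof (rule ccontr)
    assume "us \<noteq> []"
    then have "hd q = hd us" using that q(1) by (metis hd_append2)
    then show False using two[of p us "hd q"] le1(1) that q(2) \<open>us \<noteq> []\<close> by auto
  qed
  ultimately obtain us where us: "p = pre cs @ us" "(us @ q) @ s = mid ps @ suf ds" by force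
  then obtain ws where "us @ q = mid ps @ ws \<and> ws @ s = suf ds \<or>
      us @ q @ ws = mid ps \<and> s = ws @ suf ds"
    unfolding append_eq_append_conv2 by auto
  moreover have "ws = []" if "us @ q = mid ps @ ws" "ws @ s = suf ds"
  proof (rule ccontr)
    assume "ws \<noteq> []"
    then have "last q = last ws" using that(1) q(1) by (metis last_appendR)
    then show False using two[of ws s "last q"] le1(2) that q(3) \<open>ws \<noteq> []\<close> by auto
  qed
  ultimately obtain ws where ws: "us @ q @ ws = mid ps" "s = ws @ suf ds" by force
  have h: "hd q \<in> set cs"
  proof (rule ccontr)
    assume "hd q \<notin> set cs"
    then have "hd q \<notin> set (pre cs)" using hE Suc_notin by (auto simp: set_w_parts)
    then have "hd q \<in> set us" using q(2) us(1) by simp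
    moreover have "hd q \<in> set (q @ ws)" using q(1) by simp
    ultimately show False using two[of us "q @ ws"] le1(3) ws(1) by metis
  qed
  have l: "last q \<in> set ds"
  proof (rule ccontr)
    assume "last q \<notin> set ds"
    then have "last q \<notin> set (suf ds)" using hE Suc_notin by (auto simp: set_w_parts)
    then have "last q \<in> set ws" using q(3) ws(2) by simp
    moreover have "last q \<in> set (us @ q)" using q(1) by simp
    ultimately show False using two[of "us @ q" ws] le1(3) ws(1) by (metis append_assoc)
  qed
  have "hd (q @ ws) \<notin> set (map snd ps)" using h q(1) w_data_simps(3,5) by auto
  then obtain p1 p2' where p1: "ps = p1 @ p2'" "us = mid p1" "q @ ws = mid p2'"
    using mid_split_hd[of ps us "q @ ws"] ws(1) q(1) by auto
  have "last q \<notin> set (map fst p2')" using l w_data_simps(3,4) p1(1) by auto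
  then obtain p2 p3 where "p2' = p2 @ p3" "q = mid p2" "ws = mid p3"
    using mid_split_last[of p2' q ws] p1(3) q(1) by auto
  then show ?thesis using p1 us ws by (intro exI[of _ p1] exI[of _ p2] exI[of _ p3]) simp
qed

lemma filter_w_word: "filter (\<lambda>c. c \<noteq> 0) (w_word cs ps ds) = core_part"
proof -
  have "filter (\<lambda>c. c \<noteq> 0) core_part = core_part"
    using zero_notin_core_part by (metis (mono_tags, lifting) filter_id_conv)
  then show ?thesis by (simp add: w_word_def core_part_def)
qed

text \<open>Any repeated letter other than \<open>x\<close> encloses a simple letter, so
  \<open>x\<close> is the only one whose span contains repeated letters alone.\<close>

lemma w_word_split_unique:
  assumes "w_word cs ps ds = A @ (c # Y) @ c # Z"
    and twice: "\<And>e. e \<in> set (c # Y) \<Longrightarrow> 2 \<le> count_list (w_word cs ps ds) e"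
  shows "c = 0" "A = pre cs" "Y = mid ps" "Z = suf ds"
proof -
  have z: "0 \<notin> set (pre cs)" "0 \<notin> set (mid ps)" "0 \<notin> set (suf ds)"
    using zero_notin_core_part by (auto simp: core_part_def)
  have cnt: "count_list (w_word cs ps ds) e = (if e = 0 then 2 else count_list core_part e)" for e
    using z by (auto simp: w_word_def core_part_def count_notin)
  have c0: "c = 0"
  proof (rule ccontr)
    assume c: "c \<noteq> 0"
    have "2 \<le> count_list core_part c" using twice[of c] c cnt by simp
    then have "c \<in> core core_part" by (auto simp: count_core_part core_core_part split: if_splits)
    then obtain t where t: "encloses core_part c t" by (auto simp: core_def)
    have t0: "t \<noteq> 0" using encloses_count(2)[OF t] zero_notin_core_part
      by (metis count_notin zero_neq_one)
    have "encloses (filter (\<lambda>c. c \<noteq> 0) (w_word cs ps ds)) c t" unfolding filter_w_word by (rule t)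
    then have "encloses (w_word cs ps ds) c t"
      using encloses_filter[of "\<lambda>c. c \<noteq> 0" c t "w_word cs ps ds"] c t0 by blast
    then have ct: "c \<noteq> t" "filter (\<lambda>d. d = c \<or> d = t) (A @ (c # Y) @ c # Z) = [c, t, c]"
      using assms(1) by (auto simp: encloses_def)
    then have "t \<in> set Y"
      by (auto simp: append_eq_Cons_conv Cons_eq_append_conv filter_empty_conv filter_eq_Cons_iff)
    then have "2 \<le> count_list (w_word cs ps ds) t" using twice by simp
    then show False using encloses_count[OF t] t0 cnt by simp
  qed
  have "count_list (w_word cs ps ds) 0 = count_list A 0 + count_list Y 0 + count_list Z 0 + 2"
    using assms(1) c0 by simp
  then have "0 \<notin> set A" "0 \<notin> set Y" "0 \<notin> set Z" using cnt[of 0] by (auto simp: set_iff_count_list)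
  moreover have "pre cs @ 0 # mid ps @ 0 # suf ds = A @ 0 # Y @ 0 # Z"
    using assms(1) c0 by (simp add: w_word_def)
  ultimately have "A = pre cs \<and> Y = mid ps \<and> Z = suf ds"
    using z by (blast dest: split_first_unique)
  then show "c = 0" "A = pre cs" "Y = mid ps" "Z = suf ds" using c0 by auto
qed

end

section \<open>Words equivalent to w_n\<close>

context O_congruence
begin

lemma move_square: "p @ q @ c # c # s \<approx> p @ c # c # q @ s"
  using prefix_closed[OF square_commute[of q c s], of p] by simp

text \<open>A first occurrence at the left end of the gap recurs later, as does \<open>x\<close>, so
  \<open>swap_first\<close> moves it out. The process stops at a second occurrence, as
  \<open>gap_location\<close> requires; \<open>strip_right\<close> is dual.\<close>

lemma strip_left:
  assumes "\<And>d. d \<in> set q \<Longrightarrow> 2 \<le> count_list (p @ q @ s) d"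
  shows "\<exists>b q'. q = b @ q' \<and> (q' = [] \<or> hd q' \<in> set (p @ b)) \<and> p @ x # q @ x # s \<approx> (p @ b) @ x # q' @ x # s"
  using assms
proof (induction q arbitrary: p)
  case Nil
  show ?case by simp
next
  case (Cons d q)
  show ?case
  proof (cases "d \<in> set p")
    case True
    then show ?thesis by (intro exI[of _ "[]"] exI[of _ "d # q"]) simp
  next
    case False
    then have "d \<in> set (q @ x # s)" using Cons.prems[of d] by (auto simp: set_iff_count_list)
    then have sw: "p @ x # d # (q @ x # s) \<approx> p @ d # x # (q @ x # s)" by (intro swap_first) auto
    obtain b q' where *: "q = b @ q'" "q' = [] \<or> hd q' \<in> set ((p @ [d]) @ b)"
      "(p @ [d]) @ x # q @ x # s \<approx> ((p @ [d]) @ b) @ x # q' @ x # s"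
      using Cons.IH[of "p @ [d]"] Cons.prems by force
    then show ?thesis using trans[OF sw, of "((p @ [d]) @ b) @ x # q' @ x # s"]
      by (intro exI[of _ "d # b"] exI[of _ q']) auto
  qed
qed

lemma strip_right:
  assumes "\<And>d. d \<in> set q \<Longrightarrow> 2 \<le> count_list (p @ q @ s) d"
  shows "\<exists>q' a. q = q' @ a \<and> (q' = [] \<or> last q' \<in> set (a @ s)) \<and> p @ x # q @ x # s \<approx> p @ x # q' @ x # (a @ s)"
  using assms
proof (induction q arbitrary: s rule: rev_induct)
  case Nil
  show ?case by simp
next
  case (snoc d q)
  show ?case
  proof (cases "d \<in> set s")
    case True
    then show ?thesis by (intro exI[of _ "q @ [d]"] exI[of _ "[]"]) simp
  next
    case False
    then have "d \<in> set (p @ x # q)" using snoc.prems[of d] by (auto simp: set_iff_count_list)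
    then have sw: "(p @ x # q) @ d # x # s \<approx> (p @ x # q) @ x # d # s" by (intro swap_second) auto
    obtain q' a where *: "q = q' @ a" "q' = [] \<or> last q' \<in> set (a @ (d # s))"
      "p @ x # q @ x # (d # s) \<approx> p @ x # q' @ x # (a @ (d # s))"
      using snoc.IH[of "d # s"] snoc.prems by force
    then show ?thesis using trans[of "(p @ x # q) @ d # x # s" "(p @ x # q) @ x # d # s"] sw
      by (intro exI[of _ q'] exI[of _ "a @ [d]"]) auto
  qed
qed

text \<open>The first \<open>x\<close> passes \<open>a\<close>, a second occurrence, by
  \<open>sigma3\<close>, and then \<open>b\<close>, a letter that recurs like \<open>x\<close>, by
  \<open>swap_first\<close>.\<close>

lemma sigma3_mid:
  assumes s3: "fst sigma3 \<approx> snd sigma3"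
    and "set (map fst ps) \<subseteq> set p" "set (map snd ps) \<subseteq> set s"
  shows "p @ x # mid ps @ x # s \<approx> p @ mid ps @ x # x # s"
  using assms(2,3)
proof (induction ps arbitrary: p)
  case (Cons ab ps)
  obtain a b where ab: "ab = (a, b)" by (cases ab)
  let ?Y = "mid ps @ x # s"
  have "p @ x # a # (b # ?Y) \<approx> p @ a # x # (b # ?Y)"
    using Cons.prems ab by (intro sym[OF swap_sigma3[OF s3]]) auto
  also have "\<dots> \<approx> (p @ [a, b]) @ x # ?Y"
    using swap_first[of x ?Y b "p @ [a]"] Cons.prems ab by simp
  also have "\<dots> \<approx> (p @ [a, b]) @ mid ps @ x # x # s"
    using Cons.prems ab by (intro Cons.IH) auto
  finally show ?case using ab by simp
qed simp

lemma sigma3_w_word: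
  assumes "fst sigma3 \<approx> snd sigma3" "w_data cs ps ds"
  shows "w_word cs ps ds \<approx> w_word' cs ps ds"
proof -
  interpret w_data cs ps ds by fact
  have "w_word cs ps ds \<approx> pre cs @ mid ps @ 0 # 0 # suf ds"
    unfolding w_word_def by (rule sigma3_mid[OF assms(1)]) (simp_all only: sets set_w_parts, auto)
  also have "\<dots> \<approx> w_word' cs ps ds" unfolding w_word'_def by (rule move_square)
  finally show ?thesis .
qed

text \<open>Without \<open>sigma3\<close> all identities lie in \<open>Q 5\<close>, so
  \<open>v\<close> differs from w_n only in the placement of \<open>x\<close>. Enclosure is
  preserved, so with exactly two occurrences of \<open>x\<close> its span contains no simple
  letters; stripping both ends turns it into a block of whole pairs.\<close>

lemma w_word_isoterm_or_shrink:
  assumes s3: "\<not> fst sigma3 \<approx> snd sigma3" and data: "w_data cs ps ds"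
    and ps: "ps \<noteq> []"
    and v: "w_word cs ps ds \<approx> v" "v \<noteq> w_word cs ps ds"
  shows "\<exists>p1 p2 p3. ps = p1 @ p2 @ p3 \<and> (p1 \<noteq> [] \<or> p3 \<noteq> []) \<and>
    w_word cs ps ds \<approx> pre cs @ mid p1 @ 0 # mid p2 @ 0 # mid p3 @ suf ds"
proof -
  interpret w: w_data cs ps ds by (rule data)
  have Q: "Q 5 a b" if "a \<approx> b" for a b using sigma3_cases[OF that] s3 by blast
  let ?w = "w_word cs ps ds" and ?U = "w.core_part"
  have "Q 5 ?U (filter (\<lambda>c. c \<noteq> 0) v)"
    using Q[OF filter_closed[OF v(1), of "\<lambda>c. c \<noteq> 0"]] by (simp only: w.filter_w_word)
  then have v0: "filter (\<lambda>c. c \<noteq> 0) v = ?U" by (rule w.Q5_core_part)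
  have Q4: "Q 4 ?w v" using Q[OF v(1)] Q_mono by simp
  \<comment> \<open>An adjacent pair of \<open>x\<close> commutes with everything, so it counts as
    the empty span with \<open>p1 = ps\<close>.\<close>
  have all: ?thesis if "?w \<approx> P @ 0 # 0 # S" "P @ S = ?U" for P S
  proof -
    have "?w \<approx> P @ 0 # 0 # S" by fact
    also have "\<dots> \<approx> 0 # 0 # ?U" using square_commute[of P 0 S] that(2) by simp
    also have "\<dots> \<approx> (pre cs @ mid ps) @ 0 # 0 # suf ds"
      using sym[OF square_commute[of "pre cs @ mid ps" 0 "suf ds"]] by (simp add: w.core_part_def)
    finally show ?thesis using ps by (intro exI[of _ ps] exI[of _ "[]"]) simp
  qed
  have "set v = set ?w" "simple v = simple ?w" using Q4 by (simp_all add: Q_def)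
  moreover have "0 \<in> set ?w" "0 \<notin> simple ?w" by (auto simp: w_word_def in_simple)
  ultimately have "0 \<in> set v" "count_list v 0 \<noteq> 1" by (auto simp: in_simple)
  then have v2: "2 \<le> count_list v 0" by (simp add: set_iff_count_list)
  show ?thesis
  proof (cases "3 \<le> count_list v 0")
    case True
    have "?w \<approx> [] @ 0 # 0 # ?U" using trans[OF v(1) pull_triple[OF True]] v0 by simp
    then show ?thesis by (rule all) simp
  next
    case False
    obtain p v1 where v1: "v = p @ 0 # v1" "0 \<notin> set p" using \<open>0 \<in> set v\<close> by (meson split_list_first)
    then have "0 \<in> set v1" using v2 by (auto simp: set_iff_count_list)
    then obtain q s where qs: "v1 = q @ 0 # s" "0 \<notin> set q" by (meson split_list_first)
    then have "0 \<notin> set s" using False v1 by (auto simp: set_iff_count_list)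
    then have "filter (\<lambda>c. c \<noteq> 0) p = p" "filter (\<lambda>c. c \<noteq> 0) q = q" "filter (\<lambda>c. c \<noteq> 0) s = s"
      using v1 qs by (metis (mono_tags, lifting) filter_id_conv)+
    then have U: "?U = p @ q @ s" using v0 v1 qs by simp
    have v': "v = p @ 0 # q @ 0 # s" using v1 qs by simp
    have qE: "set q \<subseteq> set cs \<union> set ds"
    proof
      fix d assume d: "d \<in> set q"
      show "d \<in> set cs \<union> set ds"
      proof (rule ccontr)
        assume dE: "d \<notin> set cs \<union> set ds"
        have "count_list ?U d \<le> 1" using dE w.count_core_part by simp
        then have dn: "d \<notin> set p" "d \<notin> set s" "count_list q d = 1"
          using d U by (auto simp: set_iff_count_list)
        obtain q1 q2 where q: "q = q1 @ d # q2" using d by (meson split_list)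
        then have dq: "d \<notin> set q1" "d \<notin> set q2" using dn(3) by (auto simp: set_iff_count_list)
        have d0: "d \<noteq> 0" using d qs(2) by metis
        let ?P = "\<lambda>e. e = 0 \<or> e = d"
        have none: "filter ?P x = []" if "0 \<notin> set x" "d \<notin> set x" for x :: word
          using that unfolding filter_empty_conv by blast
        have "filter ?P p = []" "filter ?P q1 = []" "filter ?P q2 = []" "filter ?P s = []"
          using dn dq v1(2) qs(2) q \<open>0 \<notin> set s\<close> by (auto intro!: none)
        then have "encloses v 0 d" using d0 v1 qs q by (simp add: encloses_def)
        then have "encloses ?w 0 d" using Q4 by (simp add: Q_def)
        moreover have "d \<notin> set (mid ps)" "0 \<notin> set (mid ps)"
          using dE w.zero_notin_core_part by (auto simp: w.set_w_parts w.core_part_def)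
        then have "filter (\<lambda>e. e = 0 \<or> e = d) (mid ps) = []" by (rule none[rotated])
        ultimately have "filter (\<lambda>e. e = 0 \<or> e = d) (pre cs) @ 0 # 0 # filter (\<lambda>e. e = 0 \<or> e = d) (suf ds)
            = [0, d, 0]" by (simp add: encloses_def w_word_def)
        then show False using d0 by (auto simp: append_eq_Cons_conv)
      qed
    qed
    have cnt: "2 \<le> count_list (p @ q @ s) d" if "d \<in> set q" for d
      using that qE w.count_core_part[of d] U by auto
    obtain b q1 where b: "q = b @ q1" "q1 = [] \<or> hd q1 \<in> set (p @ b)"
      "p @ 0 # q @ 0 # s \<approx> (p @ b) @ 0 # q1 @ 0 # s"
      using strip_left[OF cnt, of 0] by blast
    have "2 \<le> count_list ((p @ b) @ q1 @ s) d" if "d \<in> set q1" for d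
      using cnt[of d] that b(1) by simp
    from strip_right[OF this, of 0] obtain q2 a where a: "q1 = q2 @ a" "q2 = [] \<or> last q2 \<in> set (a @ s)"
      "(p @ b) @ 0 # q1 @ 0 # s \<approx> (p @ b) @ 0 # q2 @ 0 # (a @ s)"
      by blast
    have w2: "?w \<approx> (p @ b) @ 0 # q2 @ 0 # (a @ s)" using v(1) v' trans b(3) a(3) by blast
    have U2: "?U = (p @ b) @ q2 @ (a @ s)" using U a(1) b(1) by simp
    show ?thesis
    proof (cases "q2 = []")
      case True
      then show ?thesis using all[of "p @ b" "a @ s"] w2 U2 by simp
    next
      case False
      then have "hd q2 \<in> set (p @ b)" using a(1) b(2) by auto
      moreover have "last q2 \<in> set (a @ s)" using a(2) False by auto
      moreover have "set q2 \<subseteq> set cs \<union> set ds" using qE a(1) b(1) by auto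
      ultimately obtain p1 p2 p3 where loc: "ps = p1 @ p2 @ p3" "p @ b = pre cs @ mid p1"
        "q2 = mid p2" "a @ s = mid p3 @ suf ds"
        using w.gap_location[OF U2 False] by blast
      have "p1 \<noteq> [] \<or> p3 \<noteq> []"
      proof (rule ccontr)
        assume "\<not> (p1 \<noteq> [] \<or> p3 \<noteq> [])"
        then have e: "p @ b = pre cs" "a @ s = suf ds" using loc by auto
        \<comment> \<open>The prefix ends in a simple letter, which cannot come from the gap; hence
          nothing was stripped.\<close>
        have "b = []"
        proof (rule ccontr)
          assume "b \<noteq> []"
          then have "last b = last (pre cs)" using e(1) by (metis last_appendR)
          moreover have "cs \<noteq> []" using e(1) \<open>b \<noteq> []\<close> by auto
          then have "last (pre cs) = Suc (last cs)" by (induction cs rule: rev_induct) auto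
          moreover have "last b \<in> set q" using \<open>b \<noteq> []\<close> b(1) by simp
          ultimately show False using qE w.Suc_notin[of "last cs"] \<open>cs \<noteq> []\<close> by auto
        qed
        moreover have "a = []"
        proof (rule ccontr)
          assume "a \<noteq> []"
          then have "hd a = hd (suf ds)" using e(2) by (metis hd_append2)
          moreover have "ds \<noteq> []" using e(2) \<open>a \<noteq> []\<close> by auto
          then have "hd (suf ds) = Suc (hd ds)" by (cases ds) auto
          moreover have "hd a \<in> set q" using \<open>a \<noteq> []\<close> a(1) b(1) by simp
          ultimately show False using qE w.Suc_notin[of "hd ds"] \<open>ds \<noteq> []\<close> by auto
        qed
        ultimately have "v = ?w"
          using v' e loc a(1) b(1) \<open>\<not> (p1 \<noteq> [] \<or> p3 \<noteq> [])\<close> by (simp add: w_word_def)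
        then show False using v(2) by simp
      qed
      then show ?thesis using loc w2 by (intro exI[of _ p1] exI[of _ p2] exI[of _ p3]) simp
    qed
  qed
qed

text \<open>The shorter span is closed by an identity of its own lower level, and the square then
  moves to its place in \<open>w_word'\<close>.\<close>

lemma close_shrunk:
  assumes data: "w_data cs ps ds" and w: "\<And>k. k < length ps \<Longrightarrow> w_identities k"
    and q: "ps = q1 @ q2 @ q3" "length q2 < length ps"
    and w_word: "w_word cs ps ds \<approx> pre cs @ mid q1 @ 0 # mid q2 @ 0 # mid q3 @ suf ds"
  shows "w_word cs ps ds \<approx> w_word' cs ps ds"
proof -
  interpret w: w_data cs ps ds by (rule data)
  have sub: "set (map fst q2) \<subseteq> set cs" "set (map snd q2) \<subseteq> set ds"
    unfolding w.sets[symmetric] q(1) by auto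
  note w_word
  also have "pre cs @ mid q1 @ 0 # mid q2 @ 0 # mid q3 @ suf ds \<approx>
      (pre cs @ mid q1) @ 0 # 0 # mid q2 @ (mid q3 @ suf ds)"
    using w_identity_apply[OF w[OF q(2)] HOL.refl, of "pre cs @ mid q1" "mid q3 @ suf ds" 0]
      w.distinct(3,4) sub q(1) by (auto simp: w.set_w_parts)
  also have "\<dots> \<approx> w_word' cs ps ds"
    using move_square[of "pre cs" "mid q1" 0 "mid q2 @ mid q3 @ suf ds"] by (simp add: w_word'_def q(1))
  finally show ?thesis .
qed

end

section \<open>Instances of one w_n word inside another\<close>

lemma subst_parts_id:
  "(\<And>c. c \<in> set cs \<Longrightarrow> \<theta> c = [c] \<and> \<theta> (Suc c) = [Suc c]) \<Longrightarrow> subst \<theta> (pre cs) = pre cs"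
  "(\<And>c. c \<in> set cs \<Longrightarrow> \<theta> c = [c] \<and> \<theta> (Suc c) = [Suc c]) \<Longrightarrow> subst \<theta> (suf cs) = suf cs"
  by (induction cs) auto

lemma subst_mid_id:
  "(\<And>a b. (a, b) \<in> set ps \<Longrightarrow> \<theta> a = [a] \<and> \<theta> b = [b]) \<Longrightarrow> subst \<theta> (mid ps) = mid ps"
proof (induction ps)
  case (Cons x ps)
  obtain a b where x: "x = (a, b)" by (cases x)
  have "\<theta> a = [a] \<and> \<theta> b = [b]" "subst \<theta> (mid ps) = mid ps"
    using Cons.prems x by (auto intro: Cons.IH)
  then show ?case using x by simp
qed simp

lemma subst_mid_remove:
  assumes "\<And>a b. (a, b) \<in> set qs \<Longrightarrow> (a, b) = (M, N) \<or> \<theta> a = [a] \<and> \<theta> b = [b]"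
    "\<theta> M = []" "\<theta> N = []"
  shows "subst \<theta> (mid qs) = mid (filter (\<lambda>x. x \<noteq> (M, N)) qs)"
  using assms(1)
proof (induction qs)
  case (Cons x qs)
  have IH: "subst \<theta> (mid qs) = mid (filter (\<lambda>x. x \<noteq> (M, N)) qs)"
    by (rule Cons.IH) (use Cons.prems in auto)
  obtain a b where x: "x = (a, b)" by (cases x)
  show ?case
  proof (cases "x = (M, N)")
    case True
    then show ?thesis using IH assms(2,3) by simp
  next
    case False
    then have "\<theta> a = [a] \<and> \<theta> b = [b]" using Cons.prems x by auto
    then show ?thesis using IH False x by simp
  qed
qed simp

text \<open>Values of length at most one whose total length is that of \<open>zs\<close> must all
  have length one and can be compared letter by letter.\<close>

lemma subst_singletons:
  assumes "subst \<theta> zs = zs" "\<And>z. z \<in> set zs \<Longrightarrow> length (\<theta> z) \<le> 1" "z \<in> set zs"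
  shows "\<theta> z = [z]"
  using assms
proof (induction zs)
  case (Cons y zs)
  have le: "length (subst \<theta> us) \<le> length us" if "set us \<subseteq> set (y # zs)" for us
    using that
  proof (induction us)
    case (Cons u us)
    then have "length (\<theta> u) \<le> 1" "length (subst \<theta> us) \<le> length us"
      using \<open>\<And>z. z \<in> set (y # zs) \<Longrightarrow> length (\<theta> z) \<le> 1\<close> by auto
    then show ?case by simp
  qed simp
  have "length (\<theta> y) \<le> 1" "length (subst \<theta> zs) \<le> length zs"
    using Cons.prems(2) le[of zs] by auto
  moreover have "length (\<theta> y) + length (subst \<theta> zs) = Suc (length zs)"
    using arg_cong[OF Cons.prems(1), of length] by simp
  ultimately have "length (\<theta> y) = 1" by linarith
  then obtain e where "\<theta> y = [e]" by (auto simp: length_Suc_conv)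
  then have "\<theta> y = [y]" "subst \<theta> zs = zs" using Cons.prems(1) by auto
  then show ?case using Cons by auto
qed simp

lemma subseq_subst_pre:
  assumes "\<And>c. c \<in> set cs \<Longrightarrow> \<theta> c = [c]" "set cs \<subseteq> E"
  shows "subseq cs (filter (\<lambda>l. l \<in> E) (subst \<theta> (pre cs)))"
  using assms
proof (induction cs)
  case (Cons c cs)
  have "subseq cs (filter (\<lambda>l. l \<in> E) (subst \<theta> (pre cs)))" using Cons by auto
  then have "subseq cs (filter (\<lambda>l. l \<in> E) (\<theta> (Suc c)) @ filter (\<lambda>l. l \<in> E) (subst \<theta> (pre cs)))"
    by (rule subseq_drop_many)
  then show ?case using Cons.prems by simp
qed simp

context w_data
begin

lemma two_in_w_word:
  assumes "w_word cs ps ds = x @ y" "e \<in> set x" "e \<in> set y"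
  shows "2 \<le> count_list (w_word cs ps ds) e"
  using assms by (auto simp: set_iff_count_list)

lemma Suc_not_twice:
  assumes "c \<in> set cs \<union> set ds" shows "\<not> 2 \<le> count_list (w_word cs ps ds) (Suc c)"
proof -
  have "count_list (w_word cs ps ds) (Suc c) = count_list core_part (Suc c)"
    by (simp add: w_word_def core_part_def)
  also have "\<dots> \<le> 1" using Suc_notin[OF assms] by (simp add: count_core_part)
  finally show ?thesis by simp
qed

text \<open>A nonempty value of \<open>x\<close> would create a span of repeated letters, hence the
  span of \<open>x\<close> itself. This fixes all letters of the middle part, so \<open>cs'\<close>
  would be a subsequence of \<open>cs\<close> of equal length.\<close>

lemma w_word_not_instance:
  assumes cs': "distinct cs'" "set cs' = set cs" "cs' \<noteq> cs" and ps: "ps \<noteq> []"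
    and inst: "w_word cs ps ds = p @ subst \<theta> (w_word cs' ps ds) @ q"
  shows "\<theta> 0 = []"
proof (rule ccontr)
  assume "\<theta> 0 \<noteq> []"
  then obtain c X where X: "\<theta> 0 = c # X" by (cases "\<theta> 0") auto
  let ?A = "p @ subst \<theta> (pre cs')" and ?M = "subst \<theta> (mid ps)" and ?S = "subst \<theta> (suf ds)"
  have ds: "ds \<noteq> []" using ps sets(2) by auto
  have w: "w_word cs ps ds = ?A @ (c # X @ ?M) @ c # (X @ ?S @ q)"
    using inst X by (simp add: w_word_def)
  have twice: "2 \<le> count_list (w_word cs ps ds) e" if e: "e \<in> set (c # X @ ?M)" for e
  proof (cases "e \<in> set (c # X)")
    case True
    show ?thesis
      by (rule two_in_w_word[of "?A @ c # X" "?M @ c # (X @ ?S @ q)"]) (use w in simp, use True in auto)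
  next
    case False
    then obtain z where z: "z \<in> set (mid ps)" "e \<in> set (\<theta> z)" using e by (auto simp: subst_def)
    then have "z \<in> set cs' \<or> z \<in> set ds" using cs'(2) by (simp add: set_w_parts)
    then show ?thesis
    proof
      assume "z \<in> set cs'"
      then have "e \<in> set ?A" using z by (auto simp: subst_def set_pre)
      from this e show ?thesis
        by (intro two_in_w_word[of ?A "(c # X @ ?M) @ c # (X @ ?S @ q)"]) (use w in simp, auto)
    next
      assume "z \<in> set ds"
      then have "e \<in> set ?S" using z by (auto simp: subst_def set_suf)
      from this e show ?thesis
        by (intro two_in_w_word[of "?A @ (c # X @ ?M)" "c # (X @ ?S @ q)"]) (use w in simp, auto)
    qed
  qed
  note u = w_word_split_unique[OF w twice]
  \<comment> \<open>Otherwise the suffix would start with a letter of \<open>X\<close>, which occurs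
    twice, whereas its first letter is simple.\<close>
  have "X = []"
  proof (rule ccontr)
    assume "X \<noteq> []"
    then have "hd X = hd (suf ds)" using u(4) by (metis hd_append2)
    also have "\<dots> = Suc (hd ds)" using ds by (cases ds) auto
    finally have "2 \<le> count_list (w_word cs ps ds) (Suc (hd ds))"
      using twice[of "hd X"] hd_in_set[OF \<open>X \<noteq> []\<close>] by (metis UnCI list.set_intros(2) set_append)
    then show False using Suc_not_twice[of "hd ds"] ds by simp
  qed
  then have M: "?M = mid ps" and S: "?S @ q = suf ds" and A: "p @ subst \<theta> (pre cs') = pre cs"
    using u by auto
  \<comment> \<open>The value also occurs in the prefix or in the suffix. Every other letter there
    is a successor, and the middle part contains none.\<close>
  have "length (\<theta> z) \<le> 1" if z: "z \<in> set (mid ps)" for z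
  proof -
    have "set (\<theta> z) \<subseteq> set ?M" using z by (auto simp: subst_def)
    then have no_Suc: "set (\<theta> z) \<inter> Suc ` (set cs \<union> set ds) = {}"
      unfolding M set_w_parts using Suc_notin by auto
    have "z \<in> set cs' \<or> z \<in> set ds" using z cs'(2) by (simp add: set_w_parts)
    then show ?thesis
    proof
      assume "z \<in> set cs'"
      then obtain x y where "cs' = x @ z # y" by (meson split_list)
      then have "pre cs = (p @ subst \<theta> (pre x)) @ \<theta> z @ (\<theta> (Suc z) @ subst \<theta> (pre y))"
        using A by simp
      then show ?thesis by (rule pre_factor) (use no_Suc in auto)
    next
      assume "z \<in> set ds"
      then obtain x y where "ds = x @ z # y" by (meson split_list)
      then have "suf ds = (subst \<theta> (suf x) @ \<theta> (Suc z)) @ \<theta> z @ (subst \<theta> (suf y) @ q)"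
        using S by simp
      then show ?thesis by (rule suf_factor) (use no_Suc in auto)
    qed
  qed
  then have single: "\<theta> z = [z]" if "z \<in> set (mid ps)" for z
    using subst_singletons[OF M] that by blast
  have "subseq cs' (filter (\<lambda>l. l \<in> set cs) (subst \<theta> (pre cs')))"
    using cs'(2) single by (intro subseq_subst_pre) (auto simp: set_w_parts)
  then have "subseq cs' (filter (\<lambda>l. l \<in> set cs) (pre cs))"
    unfolding A[symmetric] filter_append by (rule subseq_drop_many)
  moreover have "filter (\<lambda>l. l \<in> set cs) (pre xs) = xs" if "set xs \<subseteq> set cs" for xs
    using that
  proof (induction xs)
    case (Cons x xs)
    then have "Suc x \<notin> set cs" using Suc_notin by auto
    then show ?case using Cons by simp
  qed simp
  ultimately have "subseq cs' cs" by simp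
  moreover have "length cs' = length cs" using cs'(1,2) distinct(1) by (metis distinct_card)
  ultimately show False using cs'(3) subseq_same_length by blast
qed

text \<open>Here the value of \<open>x\<close> is repeated without a gap, so the middle part would
  also be an initial segment of the suffix, which starts with a simple letter.\<close>

lemma w_word'_not_instance:
  assumes ps: "ps \<noteq> []" and inst: "w_word cs ps ds = p @ subst \<theta> (w_word' cs' ps ds) @ q"
  shows "\<theta> 0 = []"
proof (rule ccontr)
  assume "\<theta> 0 \<noteq> []"
  then obtain c X where X: "\<theta> 0 = c # X" by (cases "\<theta> 0") auto
  let ?A = "p @ subst \<theta> (pre cs')" and ?Z = "subst \<theta> (mid ps) @ subst \<theta> (suf ds) @ q"
  have w: "w_word cs ps ds = ?A @ (c # X) @ c # (X @ ?Z)"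
    using inst X by (simp add: w_word'_def)
  have twice: "2 \<le> count_list (w_word cs ps ds) e" if e: "e \<in> set (c # X)" for e
    by (rule two_in_w_word[of "?A @ c # X" "c # X @ ?Z"]) (use w in simp, use e in auto)
  have "suf ds = mid ps @ ?Z" using w_word_split_unique(3,4)[OF w twice] by metis
  moreover obtain a b ps' where ab: "ps = (a, b) # ps'" using ps by (cases ps) auto
  ultimately have "hd (suf ds) = a" by (metis append_Cons list.sel(1) mid_simps(2))
  moreover have "ds \<noteq> []" using ps sets(2) by auto
  then have "hd (suf ds) = Suc (hd ds)" by (cases ds) auto
  moreover have "a \<in> set cs" using sets(1) ab by auto
  ultimately show False using Suc_notin[of "hd ds"] \<open>ds \<noteq> []\<close> by auto
qed

end

text \<open>
  The pair \<open>(N, M)\<close> doubles \<open>(a, b)\<close>: deleting \<open>(N, M)\<close>, or deleting \<open>(a, b)\<close> and renaming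
  \<open>(N, M)\<close> to it, both lead back to the original word.
\<close>

locale w_extension = w_data cs "(a, b) # ps'" ds for cs a b ps' ds +
  fixes N M :: nat and c1 c2 d1 d2 CS DS
  assumes fresh: "even N" "even M" "0 < N" "0 < M" "N \<noteq> M" "N \<notin> set cs \<union> set ds" "M \<notin> set cs \<union> set ds"
    and cs: "cs = c1 @ a # c2" and ds: "ds = d1 @ b # d2"
    and CS: "CS = c1 @ a # N # c2 \<or> CS = c1 @ N # a # c2" and DS: "DS = d1 @ b # M # d2"
begin

abbreviation "ps \<equiv> (a, b) # ps'"
abbreviation "PS \<equiv> (a, b) # (N, M) # ps'"

lemma extension_data: "w_data CS PS DS"
proof
  have s: "set CS = insert N (set cs)" "set DS = insert M (set ds)"
    using CS DS cs ds by auto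
  show "set CS \<inter> set DS = {}" using s fresh disjoint by auto
  show "distinct CS" "distinct DS" using CS DS distinct(1,2) cs ds fresh by auto
  show "set (map fst PS) = set CS" "set (map snd PS) = set DS" using s sets by auto
  have "N \<notin> set (map fst ps)" "M \<notin> set (map snd ps)" unfolding sets using fresh by auto
  then show "distinct (map fst PS)" "distinct (map snd PS)" using distinct(3,4) by auto
  show "even c" "0 < c" if "c \<in> set CS \<union> set DS" for c
    using that s fresh even_letter pos_letter by auto
qed

lemma ab: "a \<in> set cs" "b \<in> set ds" "a \<noteq> b"
  using sets disjoint by auto

definition delete :: "nat \<Rightarrow> word" where
  "delete l = (if l \<in> {N, Suc N, M, Suc M} then [] else [l])"

definition merge :: "nat \<Rightarrow> word" where
  "merge l = (if l \<in> {a, Suc a, b, Suc b} then [] else if l = N then [a] else if l = Suc N then [Suc a]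
    else if l = M then [b] else if l = Suc M then [Suc b] else [l])"

lemma parity: "c \<in> set cs \<union> set ds \<Longrightarrow> c \<noteq> N \<and> c \<noteq> M \<and> c \<noteq> Suc N \<and> c \<noteq> Suc M \<and> Suc c \<noteq> N \<and> Suc c \<noteq> M"
  using even_letter fresh by fastforce

lemma delete_old: "c \<in> set cs \<union> set ds \<Longrightarrow> delete c = [c] \<and> delete (Suc c) = [Suc c]"
  using parity by (auto simp: delete_def)

lemma delete_new: "delete N = []" "delete (Suc N) = []" "delete M = []" "delete (Suc M) = []" "delete 0 = [0]"
  using fresh by (auto simp: delete_def)

lemma merge_old:
  assumes "c \<in> set cs \<union> set ds" "c \<noteq> a" "c \<noteq> b"
  shows "merge c = [c] \<and> merge (Suc c) = [Suc c]"
proof -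
  have "c \<noteq> Suc a" "c \<noteq> Suc b" "Suc c \<noteq> a" "Suc c \<noteq> b"
    using even_letter[of c] even_letter[of a] even_letter[of b] assms(1) ab(1,2) by auto
  then show ?thesis using parity[OF assms(1)] assms by (auto simp: merge_def)
qed

lemma merge_new: "merge a = []" "merge (Suc a) = []" "merge b = []" "merge (Suc b) = []" "merge 0 = [0]"
  "merge N = [a]" "merge (Suc N) = [Suc a]" "merge M = [b]" "merge (Suc M) = [Suc b]"
proof -
  have "N \<noteq> a" "N \<noteq> b" "N \<noteq> Suc a" "N \<noteq> Suc b" "Suc N \<noteq> a" "Suc N \<noteq> b"
    "M \<noteq> a" "M \<noteq> b" "M \<noteq> Suc a" "M \<noteq> Suc b" "Suc M \<noteq> a" "Suc M \<noteq> b"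
    "M \<noteq> Suc N" "0 < a" "0 < b"
    using parity[of a] parity[of b] ab fresh pos_letter by auto
  then show "merge a = []" "merge (Suc a) = []" "merge b = []" "merge (Suc b) = []" "merge 0 = [0]"
    "merge N = [a]" "merge (Suc N) = [Suc a]" "merge M = [b]" "merge (Suc M) = [Suc b]"
    using fresh by (auto simp: merge_def)
qed

lemma delete_parts: "subst delete (pre CS) = pre cs" "subst delete (suf DS) = suf ds"
proof -
  have "subst delete (pre c1) = pre c1" "subst delete (pre c2) = pre c2"
    "subst delete (suf d1) = suf d1" "subst delete (suf d2) = suf d2"
    by (rule subst_parts_id; use cs ds delete_old in auto)+
  then show "subst delete (pre CS) = pre cs" "subst delete (suf DS) = suf ds"
    using CS DS cs ds delete_new delete_old ab by auto
qed

lemma merge_parts: "subst merge (pre CS) = pre cs" "subst merge (suf DS) = suf ds"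
proof -
  have "merge c = [c] \<and> merge (Suc c) = [Suc c]" if "c \<in> set (c1 @ c2 @ d1 @ d2)" for c
    using that merge_old[of c] cs ds distinct(1,2) disjoint by auto
  then have "subst merge (pre c1) = pre c1" "subst merge (pre c2) = pre c2"
    "subst merge (suf d1) = suf d1" "subst merge (suf d2) = suf d2"
    by (auto intro!: subst_parts_id)
  then show "subst merge (pre CS) = pre cs" "subst merge (suf DS) = suf ds"
    using CS DS cs ds merge_new by auto
qed

lemma pairs: "(c, d) \<in> set ps' \<Longrightarrow> c \<in> set cs \<and> d \<in> set ds \<and> c \<noteq> a \<and> d \<noteq> b \<and> c \<noteq> b \<and> d \<noteq> a"
proof -
  assume p: "(c, d) \<in> set ps'"
  then have "c \<in> set (map fst ps')" "d \<in> set (map snd ps')" by force+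
  then have "c \<in> set (map fst ps)" "d \<in> set (map snd ps)" "c \<noteq> a" "d \<noteq> b"
    using distinct(3,4) by auto
  then show ?thesis unfolding sets using ab disjoint by auto
qed

lemma delete_mid: "set qs \<subseteq> set PS \<Longrightarrow> subst delete (mid qs) = mid (filter (\<lambda>x. x \<noteq> (N, M)) qs)"
  using pairs delete_old ab delete_new by (intro subst_mid_remove) auto

lemma filter_pairs: "filter (\<lambda>x. x \<noteq> (N, M)) ps' = ps'"
  using pairs[of N M] fresh by (auto simp: filter_id_conv)

lemma merge_mid: "set qs \<subseteq> set ps' \<Longrightarrow> subst merge (mid qs) = mid qs"
  using pairs merge_old by (intro subst_mid_id) blast

end

context O_congruence
begin

text \<open>Any other word equivalent to the doubled one shortens its span. Removing one of the two
  copies must then shorten the span in the original word, where the lower levels yield the failing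
  identity.\<close>

lemma extension_isoterm:
  assumes ext: "w_extension cs a b ps' ds N M c1 c2 d1 d2 CS DS"
    and w: "\<And>k. k < length ((a, b) # ps') \<Longrightarrow> w_identities k"
    and no: "\<not> w_word cs ((a, b) # ps') ds \<approx> w_word' cs ((a, b) # ps') ds"
    and v: "w_word CS ((a, b) # (N, M) # ps') DS \<approx> v"
  shows "v = w_word CS ((a, b) # (N, M) # ps') DS"
proof (rule ccontr)
  assume ne: "v \<noteq> w_word CS ((a, b) # (N, M) # ps') DS"
  interpret E: w_extension cs a b ps' ds N M c1 c2 d1 d2 CS DS by (rule ext)
  let ?PS = "(a, b) # (N, M) # ps'" and ?ps = "(a, b) # ps'"
  have data: "w_data cs ?ps ds" by unfold_locales
  have "\<not> fst sigma3 \<approx> snd sigma3" using sigma3_w_word[OF _ data] no by blast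
  then obtain p1 p2 p3 where p: "?PS = p1 @ p2 @ p3" "p1 \<noteq> [] \<or> p3 \<noteq> []"
    and sh: "w_word CS ?PS DS \<approx> pre CS @ mid p1 @ 0 # mid p2 @ 0 # mid p3 @ suf DS"
    using w_word_isoterm_or_shrink[OF _ E.extension_data _ v ne] by auto
  let ?f = "filter (\<lambda>x. x \<noteq> (N, M))"
  have sub: "set p1 \<subseteq> set ?PS" "set p2 \<subseteq> set ?PS" "set p3 \<subseteq> set ?PS" "set ?PS \<subseteq> set ?PS"
    unfolding p(1) by auto
  have aN: "(a, b) \<noteq> (N, M)" using E.parity[of a] E.ab by auto
  have fps: "?f ?PS = ?ps" using E.filter_pairs aN by simp
  have del: "w_word cs ?ps ds \<approx> pre cs @ mid (?f p1) @ 0 # mid (?f p2) @ 0 # mid (?f p3) @ suf ds"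
    using subst_closed[OF sh, of E.delete] sub
    unfolding w_word_def subst_simps E.delete_parts E.delete_new
      E.delete_mid[OF sub(1)] E.delete_mid[OF sub(2)] E.delete_mid[OF sub(3)] E.delete_mid[OF sub(4)] fps
    by simp
  have ps: "?ps = ?f p1 @ ?f p2 @ ?f p3" using fps unfolding p(1) filter_append by simp
  \<comment> \<open>Deleting \<open>(N, M)\<close> suffices if \<open>(a, b)\<close> has left the
    span. If only the right end was shortened, this may restore the full span, namely for
    \<open>p3 = [(N, M)]\<close>, so \<open>merge\<close> is used there.\<close>
  consider "p1 \<noteq> []" | "p1 = []" "p2 = []" | r where "p1 = []" "p2 = (a, b) # r" "p3 \<noteq> []" "r @ p3 = (N, M) # ps'"
    using p by (auto simp: Cons_eq_append_conv)
  then show False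
  proof cases
    case 1
    then obtain r where "p1 = (a, b) # r" using p(1) by (auto simp: Cons_eq_append_conv)
    then have "?f p1 \<noteq> []" using aN by simp
    then have "length (?f p2) < length ?ps" using arg_cong[OF ps, of length] by simp
    then show False using close_shrunk[OF data w ps _ del] no by blast
  next
    case 2
    then have "length (?f p2) < length ?ps" by simp
    then show False using close_shrunk[OF data w ps _ del] no by blast
  next
    case 3
    obtain q2 q3 where q: "?ps = q2 @ q3" "length q2 < length ?ps"
      "subst E.merge (mid r) = mid q2" "subst E.merge (mid p3) = mid q3"
    proof (cases r)
      case Nil
      then show ?thesis
        using that[of "[]" ?ps] 3 E.merge_new E.merge_mid[of ps'] by simp
    next
      case (Cons x r')
      then have "x = (N, M)" "ps' = r' @ p3" using 3 by auto
      then show ?thesis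
        using that[of "(a, b) # r'" p3] 3 E.merge_new E.merge_mid[of r'] E.merge_mid[of p3] Cons by simp
    qed
    have "subst E.merge (w_word CS ?PS DS) = w_word cs ?ps ds"
      using E.merge_mid[of ps'] by (simp add: w_word_def E.merge_parts E.merge_new)
    moreover have "subst E.merge (pre CS @ mid p1 @ 0 # mid p2 @ 0 # mid p3 @ suf DS) =
        pre cs @ mid [] @ 0 # mid q2 @ 0 # mid q3 @ suf ds"
      using 3(1,2) q(3,4) by (simp add: E.merge_parts E.merge_new)
    ultimately have "w_word cs ?ps ds \<approx> pre cs @ mid [] @ 0 # mid q2 @ 0 # mid q3 @ suf ds"
      using subst_closed[OF sh, of E.merge] by metis
    then show False using close_shrunk[OF data w _ q(2), of "[]" q3] q(1) no by simp
  qed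
qed

end

section \<open>Subvarieties of \<open>O\<close>\<close>

lemma derives_w_word:
  assumes "w_data cs ps ds"
  shows "derives identities_L (w_word cs ps ds) (w_word' cs ps ds)"
proof -
  interpret w_data cs ps ds by fact
  interpret fully_invariant "derives identities_L" by (rule derives_fully_invariant)
  have "w_identities (length ps)"
    unfolding w_identities_def by (auto simp: identities_L_def intro!: derives_base)
  then show ?thesis
    unfolding w_word_def w_word'_def
    by (rule w_identity_apply[OF _ HOL.refl distinct(3,4)]) (simp_all only: sets set_w_parts, auto)
qed

lemma word_w_data:
  assumes \<pi>: "\<pi> permutes {1..n}" and \<tau>: "\<tau> permutes {1..n}"
  shows "\<exists>cs ps ds. w_data cs ps ds \<and> length ps = n \<and> word_w n \<pi> \<tau> = w_word cs ps ds \<and> word_w' n \<pi> \<tau> = w_word' cs ps ds"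
proof -
  define cs where "cs = map lz [1..<n + 1]"
  define ps where "ps = map (\<lambda>i. (lz (\<pi> i), lz (n + \<tau> i))) [1..<n + 1]"
  define ds where "ds = map lz [n + 1..<2 * n + 1]"
  have inj: "inj lz" by (auto simp: inj_def lz_def)
  have inj_add: "inj (\<lambda>i. n + i)" by (simp add: inj_def)
  have I: "set [1..<n + 1] = {1..n}" by auto
  have I': "set [n + 1..<2 * n + 1] = {n + 1..<2 * n + 1}" by (rule set_upt)
  have img: "\<pi> ` {1..n} = {1..n}" "\<tau> ` {1..n} = {1..n}" using \<pi> \<tau> permutes_image by blast+
  have shift: "(\<lambda>i. n + i) ` {1..n} = {n + 1..<2 * n + 1}"
    by (simp add: image_add_atLeastAtMost atLeastLessThanSuc_atLeastAtMost mult_2)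
  have fst: "map fst ps = map (lz \<circ> \<pi>) [1..<n + 1]" and snd: "map snd ps = map (lz \<circ> (\<lambda>i. n + i) \<circ> \<tau>) [1..<n + 1]"
    by (simp_all add: ps_def comp_def)
  have "w_data cs ps ds"
  proof
    show "distinct cs" "distinct ds"
      using inj by (auto simp: cs_def ds_def distinct_map inj_on_def)
    show "set (map fst ps) = set cs"
      unfolding fst cs_def set_map I image_comp[symmetric] img ..
    show "set (map snd ps) = set ds"
      unfolding snd ds_def set_map I image_comp[symmetric] img shift I' ..
    show "distinct (map fst ps)"
      unfolding fst distinct_map
      by (intro conjI distinct_upt inj_on_subset[OF inj_compose[OF inj permutes_inj[OF \<pi>]]]) simp
    show "distinct (map snd ps)"
      unfolding snd distinct_map
      by (intro conjI distinct_upt inj_on_subset[OF inj_compose[OF inj_compose[OF inj inj_add] permutes_inj[OF \<tau>]]]) simp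
    show "set cs \<inter> set ds = {}" by (auto simp: cs_def ds_def lz_def)
    show "even c" "0 < c" if "c \<in> set cs \<union> set ds" for c
      using that by (auto simp: cs_def ds_def lz_def)
  qed
  moreover have lt: "lt i = Suc (lz i)" for i by (simp add: lt_def lz_def)
  have "word_w n \<pi> \<tau> = w_word cs ps ds" "word_w' n \<pi> \<tau> = w_word' cs ps ds"
    by (simp_all add: word_w_def word_w'_def w_word_def w_word'_def pre_def mid_def suf_def cs_def ps_def ds_def
        comp_def lt lx_def del: upt_Suc)
  moreover have "length ps = n" by (simp add: ps_def del: upt_Suc)
  ultimately show ?thesis by blast
qed

text \<open>The new identity applies to the word only with \<open>x\<close> sent to the empty word,
  and then its two sides have the same value.\<close>

lemma isoterm_insert:
  assumes data: "w_data cs ps ds" and ps: "ps \<noteq> []"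
    and cs': "distinct cs'" "set cs' = set cs" "cs' \<noteq> cs"
    and iso: "\<And>v. derives \<Sigma> (w_word cs ps ds) v \<Longrightarrow> v = w_word cs ps ds"
    and v: "derives (insert (w_word cs' ps ds, w_word' cs' ps ds) \<Sigma>) (w_word cs ps ds) v"
  shows "v = w_word cs ps ds"
  using v unfolding derives_def
proof induction
  case (step u v)
  interpret w_data cs ps ds by (rule data)
  let ?w = "w_word cs ps ds"
  have u: "?w = u" using step.IH by simp
  from step.hyps(2) obtain l r p q \<theta> where
    lr: "(l, r) \<in> insert (w_word cs' ps ds, w_word' cs' ps ds) \<Sigma> \<or> (r, l) \<in> insert (w_word cs' ps ds, w_word' cs' ps ds) \<Sigma>"
    and uv: "?w = p @ subst \<theta> l @ q" "v = p @ subst \<theta> r @ q"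
    unfolding deriv_step_def u by blast
  have eq: "subst \<theta> (w_word cs' ps ds) = subst \<theta> (w_word' cs' ps ds)" if "\<theta> 0 = []"
    using that by (simp add: w_word_def w_word'_def)
  consider "(l, r) \<in> \<Sigma> \<or> (r, l) \<in> \<Sigma>" | "l = w_word cs' ps ds" "r = w_word' cs' ps ds" | "l = w_word' cs' ps ds" "r = w_word cs' ps ds"
    using lr by blast
  then show ?case
  proof cases
    case 1
    then have "deriv_step \<Sigma> ?w v" using uv unfolding deriv_step_def by blast
    then show ?thesis using iso by (simp add: derives_def r_into_rtranclp)
  next
    case 2
    then show ?thesis using w_word_not_instance[OF cs' ps] eq uv by metis
  next
    case 3
    then show ?thesis using w_word'_not_instance[OF ps] eq uv by metis
  qed
qed simp

text \<open>The last conclusion keeps the variety obtained by adding \<open>e1\<close> outside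
  \<open>L\<close>: inside \<open>L\<close> it would satisfy \<open>e2\<close>.\<close>

lemma incomparable_identities:
  assumes O: "\<And>u v. (u, v) \<in> identities_O \<Longrightarrow> derives \<Sigma> u v"
    and not_L: "\<not> (\<forall>(u, v)\<in>identities_L. derives \<Sigma> u v)"
  obtains e1 e2 where
    "\<not> derives (insert e1 \<Sigma>) (fst e2) (snd e2)" "\<not> derives (insert e2 \<Sigma>) (fst e1) (snd e1)"
    "derives identities_L (fst e2) (snd e2)"
proof -
  interpret O_congruence "derives \<Sigma>" by (rule derives_O_congruence[OF O])
  have "\<exists>n. \<not> w_identities n"
    using not_L O unfolding w_identities_def identities_L_def by fast
  then obtain n where n: "\<not> w_identities n" "\<And>k. k < n \<Longrightarrow> w_identities k"
    using exists_least_iff[of "\<lambda>n. \<not> w_identities n"] by blast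
  then obtain \<pi> \<tau> where "\<pi> permutes {1..n}" "\<tau> permutes {1..n}"
    "\<not> derives \<Sigma> (word_w n \<pi> \<tau>) (word_w' n \<pi> \<tau>)" unfolding w_identities_def by blast
  then obtain cs ps ds where data: "w_data cs ps ds" "length ps = n"
    and no: "\<not> derives \<Sigma> (w_word cs ps ds) (w_word' cs ps ds)" using word_w_data by metis
  interpret w_data cs ps ds by (rule data(1))
  \<comment> \<open>At level 0 both sides are xx, so a failing identity has a pair to
    double.\<close>
  have "ps \<noteq> []"
  proof
    assume "ps = []"
    then have "w_word cs ps ds = w_word' cs ps ds" by (simp add: w_word_def w_word'_def)
    then show False using no by simp
  qed
  then obtain a b ps' where ps: "ps = (a, b) # ps'" by (metis list.exhaust surj_pair)
  have "a \<in> set cs" "b \<in> set ds" using sets ps by auto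
  then obtain c1 c2 d1 d2 where cs: "cs = c1 @ a # c2" and ds: "ds = d1 @ b # d2"
    by (meson split_list)
  obtain K where K: "\<And>c. c \<in> set cs \<union> set ds \<Longrightarrow> c < K"
    by (meson finite_Un finite_nat_set_iff_bounded List.finite_set)
  \<comment> \<open>Even, positive, distinct and larger than all letters in use.\<close>
  define N M where "N = 2 * K + 2" and "M = 2 * K + 4"
  define PS where "PS = (a, b) # (N, M) # ps'"
  define DS where "DS = d1 @ b # M # d2"
  define C1 C2 where "C1 = c1 @ a # N # c2" and "C2 = c1 @ N # a # c2"
  have fresh: "N \<notin> set cs \<union> set ds" "M \<notin> set cs \<union> set ds"
    using K[of N] K[of M] unfolding N_def M_def by linarith+
  have ext: "w_extension cs a b ps' ds N M c1 c2 d1 d2 C DS" if "C = C1 \<or> C = C2" for C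
  proof -
    have "w_data cs ((a, b) # ps') ds" using data(1) ps by simp
    then show ?thesis
      using that fresh cs ds unfolding w_extension_def w_extension_axioms_def C1_def C2_def DS_def
      by (simp add: N_def M_def)
  qed
  have iso: "v = w_word C PS DS" if "C = C1 \<or> C = C2" "derives \<Sigma> (w_word C PS DS) v" for C v
    using extension_isoterm[OF ext[OF that(1)]] n(2) no that(2) data(2) unfolding ps PS_def by blast
  have ext_data: "w_data C PS DS" if "C = C1 \<or> C = C2" for C
    using w_extension.extension_data[OF ext[OF that]] by (simp add: PS_def)
  have dist: "distinct C1" "distinct C2" by (rule w_data.distinct(1)[OF ext_data], simp)+
  have "a \<noteq> N" using fresh \<open>a \<in> set cs\<close> by auto
  then have C: "set C1 = set C2" "C1 \<noteq> C2" by (auto simp: C1_def C2_def)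
  have ne: "w_word' C PS DS \<noteq> w_word C PS DS" for C
  proof -
    have "a \<noteq> 0" using pos_letter \<open>a \<in> set cs\<close> by auto
    then show ?thesis by (simp add: w_word_def w_word'_def PS_def)
  qed
  have PS: "PS \<noteq> []" by (simp add: PS_def)
  show ?thesis
  proof
    show "\<not> derives (insert (w_word C1 PS DS, w_word' C1 PS DS) \<Sigma>) (fst (w_word C2 PS DS, w_word' C2 PS DS)) (snd (w_word C2 PS DS, w_word' C2 PS DS))"
      using isoterm_insert[OF ext_data PS dist(1) C iso] ne by auto
    show "\<not> derives (insert (w_word C2 PS DS, w_word' C2 PS DS) \<Sigma>) (fst (w_word C1 PS DS, w_word' C1 PS DS)) (snd (w_word C1 PS DS, w_word' C1 PS DS))"
      using isoterm_insert[OF ext_data PS dist(2) C[symmetric] iso] ne by auto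
    show "derives identities_L (fst (w_word C2 PS DS, w_word' C2 PS DS)) (snd (w_word C2 PS DS, w_word' C2 PS DS))"
      using derives_w_word[OF ext_data] by simp
  qed
qed

text \<open>Each subvariety corresponds to a level of \<open>Q\<close>, and the levels are nested by
  \<open>Q_mono\<close>.\<close>

lemma chain_below_L:
  fixes Y :: "'a::infinite monoid set"
  assumes "monoid_variety Y" "Y \<subseteq> variety_L"
  shows "chain_variety Y"
proof -
  have "V \<subseteq> W \<or> W \<subseteq> V" if V_W: "V \<in> subvarieties Y" "W \<in> subvarieties Y" for V W
  proof -
    obtain \<Sigma> \<Delta> where V: "V = variety_of \<Sigma>" and W: "W = variety_of \<Delta>"
      using V_W unfolding subvarieties_def monoid_variety_def by blast
    have "V \<subseteq> variety_of identities_L" "W \<subseteq> variety_of identities_L"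
      using V_W assms(2) by (auto simp: subvarieties_def variety_L_def)
    then have "L_congruence (derives \<Sigma>)" "L_congruence (derives \<Delta>)"
      unfolding V W variety_of_subset_iff by (auto intro!: derives_L_congruence)
    then obtain j k where j: "\<And>u v. derives \<Sigma> u v \<longleftrightarrow> Q j u v" and k: "\<And>u v. derives \<Delta> u v \<longleftrightarrow> Q k u v"
      using L_congruence.eq_Q by metis
    have "derives \<Sigma> u v" if "j \<le> k" "(u, v) \<in> \<Delta>" for u v
      using derives_base[OF that(2)] Q_mono[OF _ that(1)] unfolding j k by blast
    then have "V \<subseteq> W" if "j \<le> k"
      unfolding V W variety_of_subset_iff using that by auto
    moreover have "derives \<Delta> u v" if "k \<le> j" "(u, v) \<in> \<Sigma>" for u v
      using derives_base[OF that(2)] Q_mono[OF _ that(1)] unfolding j k by blast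
    then have "W \<subseteq> V" if "k \<le> j"
      unfolding V W variety_of_subset_iff using that by auto
    ultimately show ?thesis by linarith
  qed
  then show ?thesis using assms(1) by (simp add: chain_variety_def chain_subset_def)
qed

lemma non_chain_outside_L:
  fixes Y :: "'a::infinite monoid set"
  assumes Y: "monoid_variety Y" "Y \<subseteq> variety_O" "\<not> Y \<subseteq> variety_L"
  obtains W where "W \<in> subvarieties Y" "W \<noteq> Y" "\<not> W \<subseteq> variety_L" "\<not> chain_variety Y"
proof -
  obtain \<Sigma> where \<Sigma>: "Y = variety_of \<Sigma>" using Y by (auto simp: monoid_variety_def)
  have O: "derives \<Sigma> u v" if "(u, v) \<in> identities_O" for u v
    using Y(2) that unfolding \<Sigma> variety_O_def variety_of_subset_iff by blast
  have not_L: "\<not> (\<forall>(u, v)\<in>identities_L. derives \<Sigma> u v)"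
    using Y(3) unfolding \<Sigma> variety_L_def variety_of_subset_iff .
  obtain e1 e2 where e: "\<not> derives (insert e1 \<Sigma>) (fst e2) (snd e2)"
    "\<not> derives (insert e2 \<Sigma>) (fst e1) (snd e1)" "derives identities_L (fst e2) (snd e2)"
    using incomparable_identities[OF O not_L] .
  let ?V = "\<lambda>e. variety_of (insert e \<Sigma>) :: 'a monoid set"
  have sub: "?V e \<in> subvarieties Y" for e
  proof -
    have "?V e \<subseteq> variety_of \<Sigma>" by (auto simp: variety_of_def)
    then show ?thesis unfolding subvarieties_def monoid_variety_def \<Sigma> by blast
  qed
  have "\<not> ?V e1 \<subseteq> ?V e2" "\<not> ?V e2 \<subseteq> ?V e1"
    unfolding variety_of_subset_iff using e(1,2) by auto
  moreover from this have "?V e1 \<noteq> Y" by (auto simp: \<Sigma> variety_of_def)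
  moreover have "\<not> ?V e1 \<subseteq> variety_L"
  proof
    assume "?V e1 \<subseteq> variety_L"
    then have "derives (insert e1 \<Sigma>) u v" if "(u, v) \<in> identities_L" for u v
      using that unfolding variety_L_def variety_of_subset_iff by blast
    then show False using derives_mono[OF e(3)] e(1) by blast
  qed
  moreover from calculation(1,2) have "\<not> chain_variety Y"
    using sub unfolding chain_variety_def chain_subset_def by blast
  ultimately show ?thesis using that sub by blast
qed

theorem corollary7p4:
  fixes X :: "'a::infinite monoid set"
  assumes "monoid_variety X"
    and "variety_L \<subset> X"
    and "X \<subseteq> variety_O"
  shows "\<not> chain_variety X \<and> \<not> (\<exists>Y\<in>subvarieties X. just_non_chain_variety Y)"
proof
  show "\<not> chain_variety X"
    using non_chain_outside_L[OF assms(1,3)] assms(2) by blast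
  show "\<not> (\<exists>Y\<in>subvarieties X. just_non_chain_variety Y)"
  proof
    assume "\<exists>Y\<in>subvarieties X. just_non_chain_variety Y"
    then obtain Y where YX: "Y \<subseteq> X" and just: "just_non_chain_variety Y"
      by (auto simp: subvarieties_def)
    then have Y: "monoid_variety Y" "Y \<subseteq> variety_O" "\<not> chain_variety Y"
      using assms(3) by (auto simp: just_non_chain_variety_def)
    have sub: "chain_variety W" if "W \<in> subvarieties Y" "W \<noteq> Y" for W
      using just that by (simp add: just_non_chain_variety_def)
    \<comment> \<open>The same lemma serves twice: for \<open>Y\<close> it provides a proper
      subvariety outside \<open>L\<close>, and for that subvariety it shows that it is not a chain
      variety.\<close>
    have "\<not> Y \<subseteq> variety_L" using chain_below_L Y by blast
    then obtain W where W: "W \<in> subvarieties Y" "W \<noteq> Y" "\<not> W \<subseteq> variety_L"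
      using non_chain_outside_L[OF Y(1,2)] by blast
    then have "monoid_variety W" "W \<subseteq> variety_O" using Y(2) by (auto simp: subvarieties_def)
    then have "\<not> chain_variety W" using non_chain_outside_L W(3) by blast
    then show False using sub W by blast
  qed
qed

end
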